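(* Let $1<p<\infty$, let $q$ be its conjugate exponent, and let $[\alpha,\beta]$ be a closed and bounded interval of $\mathbb{R}$. Let $u \in \mathcal{L}^p([\alpha - r, \beta], \mathbb{C}^n)$ and $v \in \mathcal{L}^q([\alpha, \beta + r], (\mathbb{C}^n)')$ be given. If the restrictions $u|_{[\alpha, \beta]}$ and $v|_{[\alpha, \beta]}$ are absolutely continuous, then the function $$[\alpha, \beta] \ni t \mapsto \tilde{B}(v^t, u_t) \in \mathbb{C}$$ is absolutely continuous and satisfies $$\frac{d}{dt} \tilde{B}(v^t, u_t) = \left[\frac{d}{dt}\left(v(t) + L^* \int_\alpha^t v^s\, ds\right)\right] u(t) + v(t) \left[\frac{d}{dt}\left(u(t) - L \int_\alpha^t u_s\, ds\right)\right]$$ for a.e. $t \in [\alpha, \beta]$.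
   Context: Let $r>0$ and let $n$ be a positive integer. $\mathbb{C}^n$ denotes column vectors, $(\mathbb{C}^n)'$ denotes $n$-dimensional complex row vectors, $M_n(\mathbb{C})$ the $n\times n$ complex matrices. Let $\eta=(\eta_{ij})\colon [-r,0]\to M_n(\mathbb{C})$ be a function of bounded variation. Integrals against $d\eta$ are Riemann–Stieltjes integrals taken componentwise: for continuous $\phi$ (column valued) and $\psi$ (row valued), $\left(\int d\eta(\theta)\,\phi(\theta)\right)_i=\sum_j\int \phi_j(\theta)\,d\eta_{ij}(\theta)$ and $\left(\int \psi(\theta)\,d\eta(\theta)\right)_j=\sum_i\int \psi_i(\theta)\,d\eta_{ij}(\theta)$. Write $C=C([-r,0],\mathbb{C}^n)$ and $C^*=C([0,r],(\mathbb{C}^n)')$ (supremum norms). Define $L\colon C\to\mathbb{C}^n$, $L\phi=\int_{-r}^0 d\eta(\theta)\,\phi(\theta)$, and $L^*\colon C^*\to(\mathbb{C}^n)'$, $L^*\psi=\int_{-r}^0\psi(-\theta)\,d\eta(\theta)$. The bilinear form $B\colon C^*\times C\to\mathbb{C}$ is $$B(\psi,\phi)=\psi(0)\phi(0)+\int_{-r}^0\left(\int_{-r}^{\xi}\psi(\xi-\theta)\,d\eta(\theta)\right)\phi(\xi)\,d\xi ,$$ where the inner integral, as a function of $\xi\in[-r,0]$, is Riemann integrable. Let $m$ be the sum of the Lebesgue measure on $[-r,0]$ and the Dirac measure at $0$, and let $m^*$ be the sum of the Lebesgue measure on $[0,r]$ and the Dirac measure at $0$. Set $M^p=L^p(([-r,0],m),\mathbb{C}^n)$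 and $M^{*q}=L^q(([0,r],m^* ),(\mathbb{C}^n)')$. $C$ and $C^*$ are regarded as dense subspaces of $M^p$ and $M^{*q}$. $\tilde B\colon M^{*q}\times M^p\to\mathbb{C}$ denotes the unique bounded bilinear form extending $B$ (which exists). $\mathcal{L}^p(I,\cdot)$ denotes $p$-integrable functions (not equivalence classes), defined almost everywhere on the interval $I$; here $u$ and $v$ are defined at every point of $[\alpha,\beta]$. For $t\in[\alpha,\beta]$, $u_t\in M^p$ and $v^t\in M^{*q}$ are given by $u_t(\theta)=u(t+\theta)$ for $m$-a.e. $\theta\in[-r,0]$ and $v^t(\tau)=v(t+\tau)$ for $m^*$-a.e. $\tau\in[0,r]$. For $[a,b]\subset[\alpha,\beta]$, $\int_a^b u_t\,dt\in C$ and $\int_a^b v^t\,dt\in C^*$ are the continuous functions $\left(\int_a^b u_t\,dt\right)(\theta)=\int_a^b u(t+\theta)\,dt$ for $\theta\in[-r,0]$ and $\left(\int_a^b v^t\,dt\right)(\tau)=\int_a^b v(t+\tau)\,dt$ for $\tau\in[0,r]$. *)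

theory Defs
  imports "HOL-Analysis.Analysis"
begin

text \<open>Both column vectors and row vectors of length \<open>n = CARD('n)\<close> are elements of
  \<^typ>\<open>complex ^ 'n\<close>; the product of a row \<open>x\<close> and a column \<open>y\<close> is
  \<^term>\<open>scalar_product x y\<close> (no complex conjugation).\<close>


section \<open>Bounded variation, absolute continuity, Riemann--Stieltjes integrals\<close>

definition bounded_variation_on_interval ::
    "real \<Rightarrow> real \<Rightarrow> (real \<Rightarrow> 'b::real_normed_vector) \<Rightarrow> bool" where
  "bounded_variation_on_interval a b f \<longleftrightarrow>
     (\<exists>K. \<forall>D. D division_of {a..b} \<longrightarrow> (\<Sum>I\<in>D. norm (f (Sup I) - f (Inf I))) \<le> K)"

text \<open>Here \<open>D\<close> ranges over the finite families of non-overlapping compact subintervals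
  of \<open>[a, b]\<close>.\<close>

definition absolutely_continuous_on_interval ::
    "real \<Rightarrow> real \<Rightarrow> (real \<Rightarrow> 'b::real_normed_vector) \<Rightarrow> bool" where
  "absolutely_continuous_on_interval a b f \<longleftrightarrow>
     (\<forall>\<epsilon>>0. \<exists>\<delta>>0. \<forall>D. D division_of \<Union>D \<and> \<Union>D \<subseteq> {a..b} \<and>
        (\<Sum>I\<in>D. Sup I - Inf I) < \<delta> \<longrightarrow>
        (\<Sum>I\<in>D. norm (f (Sup I) - f (Inf I))) < \<epsilon>)"

definition has_RS_integral ::
    "(real \<Rightarrow> complex) \<Rightarrow> (real \<Rightarrow> complex) \<Rightarrow> real \<Rightarrow> real \<Rightarrow> complex \<Rightarrow> bool" where
  "has_RS_integral f g a b J \<longleftrightarrow>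
     (\<forall>\<epsilon>>0. \<exists>\<delta>>0. \<forall>T. T tagged_division_of {a..b} \<and>
        (\<forall>(x, I)\<in>T. Sup I - Inf I < \<delta>) \<longrightarrow>
        norm ((\<Sum>(x, I)\<in>T. f x * (g (Sup I) - g (Inf I))) - J) < \<epsilon>)"

definition RS_integral ::
    "real \<Rightarrow> real \<Rightarrow> (real \<Rightarrow> complex) \<Rightarrow> (real \<Rightarrow> complex) \<Rightarrow> complex" where
  "RS_integral a b f g = (THE J. has_RS_integral f g a b J)"

text \<open>The column \<open>\<integral>\<^sub>a\<^sup>b d\<eta>(\<theta>) \<phi>(\<theta>)\<close> and the row \<open>\<integral>\<^sub>a\<^sup>b \<psi>(\<theta>) d\<eta>(\<theta>)\<close>.\<close>

definition RS_integral_col ::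
    "real \<Rightarrow> real \<Rightarrow> (real \<Rightarrow> complex ^ 'n ^ 'n) \<Rightarrow> (real \<Rightarrow> complex ^ 'n) \<Rightarrow> complex ^ 'n" where
  "RS_integral_col a b \<eta> \<phi> =
     (\<chi> i. \<Sum>j\<in>UNIV. RS_integral a b (\<lambda>\<theta>. \<phi> \<theta> $ j) (\<lambda>\<theta>. \<eta> \<theta> $ i $ j))"

definition RS_integral_row ::
    "real \<Rightarrow> real \<Rightarrow> (real \<Rightarrow> complex ^ 'n) \<Rightarrow> (real \<Rightarrow> complex ^ 'n ^ 'n) \<Rightarrow> complex ^ 'n" where
  "RS_integral_row a b \<psi> \<eta> =
     (\<chi> j. \<Sum>i\<in>UNIV. RS_integral a b (\<lambda>\<theta>. \<psi> \<theta> $ i) (\<lambda>\<theta>. \<eta> \<theta> $ i $ j))"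


section \<open>The functionals and the bilinear form on continuous functions\<close>

definition L_op ::
    "real \<Rightarrow> (real \<Rightarrow> complex ^ 'n ^ 'n) \<Rightarrow> (real \<Rightarrow> complex ^ 'n) \<Rightarrow> complex ^ 'n" where
  "L_op r \<eta> \<phi> = RS_integral_col (- r) 0 \<eta> \<phi>"

definition L_star ::
    "real \<Rightarrow> (real \<Rightarrow> complex ^ 'n ^ 'n) \<Rightarrow> (real \<Rightarrow> complex ^ 'n) \<Rightarrow> complex ^ 'n" where
  "L_star r \<eta> \<psi> = RS_integral_row (- r) 0 (\<lambda>\<theta>. \<psi> (- \<theta>)) \<eta>"

definition B_form ::
    "real \<Rightarrow> (real \<Rightarrow> complex ^ 'n ^ 'n) \<Rightarrow>
     (real \<Rightarrow> complex ^ 'n) \<Rightarrow> (real \<Rightarrow> complex ^ 'n) \<Rightarrow> complex" where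
  "B_form r \<eta> \<psi> \<phi> = scalar_product (\<psi> 0) (\<phi> 0) +
     integral {- r..0} (\<lambda>\<xi>.
       scalar_product (RS_integral_row (- r) \<xi> (\<lambda>\<theta>. \<psi> (\<xi> - \<theta>)) \<eta>) (\<phi> \<xi>))"


section \<open>Lebesgue spaces and the extended bilinear form\<close>

definition leb_dirac0 :: "real set \<Rightarrow> real measure" where
  "leb_dirac0 S = measure_of S (sets (lebesgue_on S))
     (\<lambda>A. emeasure (lebesgue_on S) A + indicator A 0)"

lemma space_leb_dirac0 [simp]: "space (leb_dirac0 S) = S"
  and sets_leb_dirac0 [simp]: "sets (leb_dirac0 S) = sets (lebesgue_on S)"
proof -
  have "sets (lebesgue_on S) \<subseteq> Pow S"
    using sets.space_closed[of "lebesgue_on S"] by simp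
  then show "space (leb_dirac0 S) = S"
    and "sets (leb_dirac0 S) = sets (lebesgue_on S)"
    unfolding leb_dirac0_def
    using sets.sigma_sets_eq[of "lebesgue_on S"]
    by (simp_all add: space_measure_of sets_measure_of)
qed

lemma emeasure_leb_dirac0:
  assumes "A \<in> sets (lebesgue_on S)"
  shows "emeasure (leb_dirac0 S) A = emeasure (lebesgue_on S) A + indicator A 0"
proof (rule emeasure_measure_of[OF leb_dirac0_def])
  show "sets (lebesgue_on S) \<subseteq> Pow S"
    using sets.space_closed[of "lebesgue_on S"] by simp
  show "A \<in> sets (leb_dirac0 S)"
    using assms by simp
  show "positive (sets (leb_dirac0 S)) (\<lambda>A. emeasure (lebesgue_on S) A + indicator A 0)"
    by (simp add: positive_def)
  show "countably_additive (sets (leb_dirac0 S))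
      (\<lambda>A. emeasure (lebesgue_on S) A + indicator A 0)"
  proof (rule countably_additiveI)
    fix X :: "nat \<Rightarrow> real set"
    assume X: "range X \<subseteq> sets (leb_dirac0 S)" "disjoint_family X"
    have "(\<Sum>i. emeasure (lebesgue_on S) (X i)) = emeasure (lebesgue_on S) (\<Union>i. X i)"
      using X by (intro suminf_emeasure) auto
    moreover have "(\<Sum>i. indicator (X i) 0 :: ennreal) = indicator (\<Union>i. X i) 0"
      using X(2) by (rule suminf_indicator)
    ultimately show "(\<Sum>i. emeasure (lebesgue_on S) (X i) + indicator (X i) 0) =
        emeasure (lebesgue_on S) (\<Union>i. X i) + indicator (\<Union>i. X i) 0"
      by (simp add: suminf_add[symmetric])
  qed
qed

text \<open>\<open>p\<close>-integrable functions, not equivalence classes. The values outside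
  \<^term>\<open>space M\<close> are irrelevant.\<close>

definition Lp_fun ::
    "real \<Rightarrow> 'a measure \<Rightarrow> ('a \<Rightarrow> 'b::{banach, second_countable_topology}) set" where
  "Lp_fun p M = {f. f \<in> borel_measurable M \<and> integrable M (\<lambda>x. norm (f x) powr p)}"

definition Lp_norm :: "real \<Rightarrow> 'a measure \<Rightarrow> ('a \<Rightarrow> 'b::real_normed_vector) \<Rightarrow> real" where
  "Lp_norm p M f = (\<integral>x. norm (f x) powr p \<partial>M) powr (1 / p)"

abbreviation Mp :: "real \<Rightarrow> real \<Rightarrow> (real \<Rightarrow> complex ^ 'n) set" where
  "Mp r p \<equiv> Lp_fun p (leb_dirac0 {- r..0})"

abbreviation Mq_star :: "real \<Rightarrow> real \<Rightarrow> (real \<Rightarrow> complex ^ 'n) set" where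
  "Mq_star r q \<equiv> Lp_fun q (leb_dirac0 {0..r})"

text \<open>A bounded bilinear form on the Lebesgue spaces, given on representatives, that
  agrees with \<^const>\<open>B_form\<close> on continuous functions. Bilinearity and the bound imply that
  the value depends only on the equivalence classes of the arguments; since continuous
  functions are dense, these conditions determine the form uniquely.\<close>

definition is_bounded_bilinear_extension ::
    "real \<Rightarrow> (real \<Rightarrow> complex ^ 'n ^ 'n) \<Rightarrow> real \<Rightarrow> real \<Rightarrow>
     ((real \<Rightarrow> complex ^ 'n) \<Rightarrow> (real \<Rightarrow> complex ^ 'n) \<Rightarrow> complex) \<Rightarrow> bool" where
  "is_bounded_bilinear_extension r \<eta> p q Bt \<longleftrightarrow>
     (\<forall>c. \<forall>\<psi>\<^sub>1\<in>Mq_star r q. \<forall>\<psi>\<^sub>2\<in>Mq_star r q. \<forall>\<phi>\<in>Mp r p.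
        Bt (\<lambda>\<tau>. c *s \<psi>\<^sub>1 \<tau> + \<psi>\<^sub>2 \<tau>) \<phi> = c * Bt \<psi>\<^sub>1 \<phi> + Bt \<psi>\<^sub>2 \<phi>) \<and>
     (\<forall>c. \<forall>\<psi>\<in>Mq_star r q. \<forall>\<phi>\<^sub>1\<in>Mp r p. \<forall>\<phi>\<^sub>2\<in>Mp r p.
        Bt \<psi> (\<lambda>\<theta>. c *s \<phi>\<^sub>1 \<theta> + \<phi>\<^sub>2 \<theta>) = c * Bt \<psi> \<phi>\<^sub>1 + Bt \<psi> \<phi>\<^sub>2) \<and>
     (\<exists>K. \<forall>\<psi>\<in>Mq_star r q. \<forall>\<phi>\<in>Mp r p.
        norm (Bt \<psi> \<phi>) \<le>
          K * Lp_norm q (leb_dirac0 {0..r}) \<psi> * Lp_norm p (leb_dirac0 {- r..0}) \<phi>) \<and>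
     (\<forall>\<psi> \<phi>. continuous_on {0..r} \<psi> \<and> continuous_on {- r..0} \<phi> \<longrightarrow>
        Bt \<psi> \<phi> = B_form r \<eta> \<psi> \<phi>)"


section \<open>Translates and their integrals\<close>

text \<open>\<open>u\<^sub>t\<close> and \<open>v\<^sup>t\<close> are both \<^term>\<open>translate w t\<close>, considered on \<open>[-r, 0]\<close> for \<open>u\<close> and on
  \<open>[0, r]\<close> for \<open>v\<close>.\<close>

definition translate :: "(real \<Rightarrow> complex ^ 'n) \<Rightarrow> real \<Rightarrow> real \<Rightarrow> complex ^ 'n" where
  "translate w t = (\<lambda>\<theta>. w (t + \<theta>))"

definition integral_translate ::
    "real \<Rightarrow> real \<Rightarrow> (real \<Rightarrow> complex ^ 'n) \<Rightarrow> real \<Rightarrow> complex ^ 'n" where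
  "integral_translate a b w = (\<lambda>\<theta>. integral {a..b} (\<lambda>t. translate w t \<theta>))"

end

theory Submission
  imports Defs
begin

text \<open>
  For continuous \<open>u\<close> and \<open>v\<close> the assertion comes from an interchange of integrations. It turns
  \<open>B(v\<^sup>t, u\<^sub>t) - v(t) u(t)\<close> into the Stieltjes integral \<open>d\<eta>(\<theta>)\<close> of the integrals of
  \<open>v(s - \<theta>) u(s)\<close> over \<open>t + \<theta> \<le> s \<le> t\<close>. This window moves rigidly with \<open>t\<close>, so its integral has the
  derivative \<open>v(t - \<theta>) u(t) - v(t) u(t + \<theta>)\<close>, and integration over \<open>\<theta>\<close> yields
  \<open>(L\<^sup>* v\<^sup>t) u(t) - v(t) (L u\<^sub>t)\<close>. The integrated form of this statement is
  \<open>B_form_translate_difference\<close>; its analytic core is \<open>RS_integral_truncated_kernel\<close>.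

  In general \<open>L\<^sup>* v\<^sup>t\<close> and \<open>L u\<^sub>t\<close> need not be defined, but the integrated form survives a
  limit. Choose continuous \<open>v\<^sub>k\<close> and \<open>u\<^sub>k\<close> that agree with \<open>v\<close> and \<open>u\<close> on \<open>[\<alpha>, \<beta>]\<close>, where these are
  continuous, and converge to them in the mean elsewhere (\<open>continuous_approximation_fixing_interval\<close>).
  By the agreement the atoms at \<open>0\<close> are matched exactly, so the translates converge in the Lebesgue
  spaces and the values of \<open>B\<close> converge to those of its extension
  (\<open>bounded_bilinear_extension_tendsto\<close>). The functions \<open>L\<^sup>* v\<^sub>k\<^sup>s\<close> and \<open>L u\<^sub>k\<^sub>,\<^sub>s\<close> of \<open>s\<close> converge in
  the mean to functions \<open>g\<^sub>v\<close> and \<open>g\<^sub>u\<close> whose indefinite integrals are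
  \<open>L\<^sup>* \<integral> v\<^sup>s ds\<close> and \<open>L \<integral> u\<^sub>s ds\<close> (\<open>RS_integral_translate_L1_limit\<close>). In the limit, the extended form along
  the translates equals \<open>v(t) u(t)\<close> plus a constant plus the indefinite integral of
  \<open>g\<^sub>v u - v g\<^sub>u\<close>. This is absolutely continuous, and it is differentiated almost everywhere by the
  product rule and Lebesgue's differentiation theorem. The derivatives of \<open>u\<close> and \<open>v\<close> exist almost
  everywhere because absolutely continuous functions are indefinite integrals
  (\<open>absolutely_continuous_imp_indefinite_integral\<close>).

  The function \<open>\<eta>\<close> enters through a monotone function that dominates its increments.
  Riemann--Stieltjes integrals are obtained from integration by parts for polynomials and uniform
  approximation.\<close>

section \<open>Variation along chains of points\<close>

text \<open>A division is a set of intervals, so a family of intervals may have fewer members as a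
  division than it has indices. Only degenerate intervals can occur twice, and these contribute
  nothing to a sum of increments; hence sums over the index set and over the division agree.\<close>

lemma division_of_indexed_intervals:
  fixes c d :: "'i \<Rightarrow> real"
  assumes fin: "finite A" and le: "\<And>i. i \<in> A \<Longrightarrow> c i \<le> d i"
    and dj: "\<And>i j. i \<in> A \<Longrightarrow> j \<in> A \<Longrightarrow> i \<noteq> j \<Longrightarrow> {c i<..<d i} \<inter> {c j<..<d j} = {}"
  shows "(\<lambda>i. {c i..d i}) ` A division_of (\<Union>i\<in>A. {c i..d i})"
    and "(\<And>x. g x x = (0::real)) \<Longrightarrow>
      (\<Sum>I\<in>(\<lambda>i. {c i..d i}) ` A. g (Inf I) (Sup I)) = (\<Sum>i\<in>A. g (c i) (d i))"
proof -
  show "(\<lambda>i. {c i..d i}) ` A division_of (\<Union>i\<in>A. {c i..d i})"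
  proof (rule division_ofI)
    show "finite ((\<lambda>i. {c i..d i}) ` A)" using fin by simp
    show "K \<subseteq> (\<Union>i\<in>A. {c i..d i})" if "K \<in> (\<lambda>i. {c i..d i}) ` A" for K using that by auto
    show "K \<noteq> {}" if "K \<in> (\<lambda>i. {c i..d i}) ` A" for K using that le by auto
    show "\<exists>a b. K = cbox a b" if "K \<in> (\<lambda>i. {c i..d i}) ` A" for K using that by auto
    show "interior K1 \<inter> interior K2 = {}"
      if K: "K1 \<in> (\<lambda>i. {c i..d i}) ` A" "K2 \<in> (\<lambda>i. {c i..d i}) ` A" "K1 \<noteq> K2" for K1 K2
    proof -
      from K obtain i j where ij: "i \<in> A" "j \<in> A" "K1 = {c i..d i}" "K2 = {c j..d j}" by auto
      with K(3) have "i \<noteq> j" by auto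
      from dj[OF ij(1,2) this] show ?thesis unfolding ij(3,4) interior_atLeastAtMost_real .
    qed
  qed simp
  assume g0: "\<And>x. g x x = 0"
  have "(\<Sum>I\<in>(\<lambda>i. {c i..d i}) ` A. g (Inf I) (Sup I)) = (\<Sum>i\<in>A. g (Inf {c i..d i}) (Sup {c i..d i}))"
  proof (subst sum.reindex_nontrivial[OF fin])
    fix i j assume ij: "i \<in> A" "j \<in> A" "i \<noteq> j" "{c i..d i} = {c j..d j}"
    then have "c i = c j" "d i = d j" using le[of i] le[of j] by (auto simp: atLeastatMost_empty_iff Icc_eq_Icc)
    then have "{c i<..<d i} = {}" using dj[OF ij(1,2,3)] by simp
    then have "c i = d i" using le[OF ij(1)] by (simp add: greaterThanLessThan_empty_iff)
    then show "g (Inf {c i..d i}) (Sup {c i..d i}) = 0" using g0 by simp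
  qed simp
  also have "\<dots> = (\<Sum>i\<in>A. g (c i) (d i))" using le by (intro sum.cong) auto
  finally show "(\<Sum>I\<in>(\<lambda>i. {c i..d i}) ` A. g (Inf I) (Sup I)) = (\<Sum>i\<in>A. g (c i) (d i))" .
qed

text \<open>Partitions are monotone sequences here rather than sets of intervals: a sequence is cut at a
  point by taking the minimum and the maximum with that point, which is all that the additivity of
  the variation requires.\<close>

definition chain :: "real \<Rightarrow> real \<Rightarrow> nat \<Rightarrow> (nat \<Rightarrow> real) \<Rightarrow> bool" where
  "chain a b n x \<longleftrightarrow> x 0 = a \<and> x n = b \<and> (\<forall>i<n. x i \<le> x (Suc i))"

definition chain_sum :: "(real \<Rightarrow> 'b::real_normed_vector) \<Rightarrow> nat \<Rightarrow> (nat \<Rightarrow> real) \<Rightarrow> real" where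
  "chain_sum f n x = (\<Sum>i<n. norm (f (x (Suc i)) - f (x i)))"

definition variation :: "(real \<Rightarrow> 'b::real_normed_vector) \<Rightarrow> real \<Rightarrow> real \<Rightarrow> real" where
  "variation f a b = Sup {chain_sum f n x | n x. chain a b n x}"

lemma chain_mono: "chain a b n x \<Longrightarrow> i \<le> j \<Longrightarrow> j \<le> n \<Longrightarrow> x i \<le> x j"
proof (induction j)
  case (Suc j)
  then show ?case by (cases "i = Suc j") (auto simp: chain_def less_Suc_eq_le intro: order_trans)
qed simp

lemma chain_range: "chain a b n x \<Longrightarrow> i \<le> n \<Longrightarrow> a \<le> x i \<and> x i \<le> b"
  using chain_mono[of a b n x 0 i] chain_mono[of a b n x i n] by (auto simp: chain_def)

lemma chain_gaps_disjoint:
  assumes "chain a b n x" "i < n" "j < n" "i \<noteq> j"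
  shows "{x i<..<x (Suc i)} \<inter> {x j<..<x (Suc j)} = {}"
proof -
  have "x (Suc i) \<le> x j" if "i < j" using chain_mono[OF assms(1), of "Suc i" j] that assms by auto
  moreover have "x (Suc j) \<le> x i" if "j < i" using chain_mono[OF assms(1), of "Suc j" i] that assms by auto
  ultimately show ?thesis using assms(4) by (cases "i < j") auto
qed

lemma chain_union:
  assumes "chain a b n x" "n > 0"
  shows "(\<Union>i<n. {x i..x (Suc i)}) = {a..b}"
proof -
  have "(\<Union>i<Suc m. {x i..x (Suc i)}) = {a..x (Suc m)}" if "Suc m \<le> n" for m
    using that
  proof (induction m)
    case 0 then show ?case using assms(1) by (auto simp: chain_def)
  next
    case (Suc m)
    have "(\<Union>i<Suc (Suc m). {x i..x (Suc i)}) = {a..x (Suc m)} \<union> {x (Suc m)..x (Suc (Suc m))}"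
      using Suc by (simp add: lessThan_Suc[of "Suc m"] Un_commute)
    also have "\<dots> = {a..x (Suc (Suc m))}"
      using chain_range[OF assms(1), of "Suc m"] chain_mono[OF assms(1), of "Suc m" "Suc (Suc m)"] Suc.prems
      by (intro ivl_disj_un) auto
    finally show ?case .
  qed
  from this[of "n - 1"] assms show ?thesis by (simp add: chain_def)
qed

text \<open>The link that straddles \<open>c\<close> is estimated by the triangle inequality; every other link
  survives in one of the two parts and is constant in the other.\<close>

lemma chain_split:
  assumes x: "chain a d n x" and c: "a \<le> c" "c \<le> d"
  shows "chain a c n (\<lambda>i. min (x i) c)" "chain c d n (\<lambda>i. max c (x i))"
    and "chain_sum f n x \<le> chain_sum f n (\<lambda>i. min (x i) c) + chain_sum f n (\<lambda>i. max c (x i))"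
proof -
  show "chain a c n (\<lambda>i. min (x i) c)" "chain c d n (\<lambda>i. max c (x i))"
    using x c unfolding chain_def by (auto simp: min_def max_def)
  show "chain_sum f n x \<le> chain_sum f n (\<lambda>i. min (x i) c) + chain_sum f n (\<lambda>i. max c (x i))"
    unfolding chain_sum_def sum.distrib[symmetric]
  proof (rule sum_mono)
    fix i assume "i \<in> {..<n}"
    then have "x i \<le> x (Suc i)" using x by (auto simp: chain_def)
    moreover have "norm (f (x (Suc i)) - f (x i)) \<le> norm (f c - f (x i)) + norm (f (x (Suc i)) - f c)"
      using norm_triangle_ineq[of "f c - f (x i)" "f (x (Suc i)) - f c"] by simp
    ultimately show "norm (f (x (Suc i)) - f (x i)) \<le>
        norm (f (min (x (Suc i)) c) - f (min (x i) c)) + norm (f (max c (x (Suc i))) - f (max c (x i)))"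
      by (cases "x (Suc i) \<le> c"; cases "c \<le> x i") (auto simp: min_def max_def)
  qed
qed

lemma chain_append:
  assumes "chain a c n x" "c \<le> d"
  shows "chain a d (Suc n) (\<lambda>i. if i \<le> n then x i else d)"
    and "chain_sum f (Suc n) (\<lambda>i. if i \<le> n then x i else d) = chain_sum f n x + norm (f d - f c)"
  using assms unfolding chain_def chain_sum_def by (auto simp: less_Suc_eq)

lemma chain_trivial: "a \<le> b \<Longrightarrow> chain a b 1 (\<lambda>i. if i = 0 then a else b)"
  by (auto simp: chain_def)

context
  fixes f :: "real \<Rightarrow> 'b::real_normed_vector" and a b K :: real
  assumes bound: "\<And>n x. chain a b n x \<Longrightarrow> chain_sum f n x \<le> K"
begin

lemma chain_sum_le_bound:
  assumes "chain a c n x" "c \<le> b" shows "chain_sum f n x \<le> K"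
  using bound[OF chain_append(1)[OF assms]] chain_append(2)[OF assms, of f]
  by (smt (verit) norm_ge_zero)

lemma chain_sum_le_variation:
  assumes "chain a c n x" "c \<le> b" shows "chain_sum f n x \<le> variation f a c"
  unfolding variation_def
proof (rule cSup_upper)
  show "bdd_above {chain_sum f n x |n x. chain a c n x}"
    using chain_sum_le_bound assms(2) by (auto intro!: bdd_aboveI)
qed (use assms in blast)

lemma variation_le:
  assumes "a \<le> c" "\<And>n x. chain a c n x \<Longrightarrow> chain_sum f n x \<le> M"
  shows "variation f a c \<le> M"
  unfolding variation_def using assms chain_trivial[OF assms(1)] by (intro cSup_least) auto

text \<open>A chain that ends at \<open>c\<close> becomes longer by the single link from \<open>c\<close> to \<open>d\<close>.\<close>

lemma norm_diff_le_variation: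
  assumes "a \<le> c" "c \<le> d" "d \<le> b"
  shows "norm (f d - f c) \<le> variation f a d - variation f a c"
proof -
  have "variation f a c \<le> variation f a d - norm (f d - f c)"
  proof (rule variation_le[OF assms(1)])
    fix n x assume "chain a c n x"
    from chain_sum_le_variation[OF chain_append(1)[OF this assms(2)] assms(3)]
    show "chain_sum f n x \<le> variation f a d - norm (f d - f c)"
      using chain_append(2)[OF \<open>chain a c n x\<close> assms(2), of f] by linarith
  qed
  then show ?thesis by linarith
qed

text \<open>The reverse estimate: what a chain up to \<open>d\<close> has beyond \<open>c\<close> is a chain from \<open>c\<close> to \<open>d\<close>.\<close>

lemma variation_diff_le:
  assumes "a \<le> c" "c \<le> d" "d \<le> b"
    and "\<And>n x. chain c d n x \<Longrightarrow> chain_sum f n x \<le> M"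
  shows "variation f a d - variation f a c \<le> M"
proof -
  have "variation f a d \<le> variation f a c + M"
  proof (rule variation_le)
    fix n x assume x: "chain a d n x"
    have "chain_sum f n (\<lambda>i. min (x i) c) \<le> variation f a c"
      using assms by (intro chain_sum_le_variation chain_split(1)[OF x]) auto
    moreover have "chain_sum f n (\<lambda>i. max c (x i)) \<le> M"
      using assms by (intro assms(4) chain_split(2)[OF x]) auto
    ultimately show "chain_sum f n x \<le> variation f a c + M"
      using chain_split(3)[OF x assms(1,2), of f] by linarith
  qed (use assms in auto)
  then show ?thesis by linarith
qed

end

text \<open>The function \<open>V\<close> is the variation from the left end point. This inequality carries all later
  estimates of Stieltjes integrals.\<close>

lemma bounded_variation_majorant:
  fixes f :: "real \<Rightarrow> 'b::real_normed_vector"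
  assumes "bounded_variation_on_interval a b f"
  obtains V :: "real \<Rightarrow> real"
  where "\<And>x y. a \<le> x \<Longrightarrow> x \<le> y \<Longrightarrow> y \<le> b \<Longrightarrow> norm (f y - f x) \<le> V y - V x"
proof -
  from assms obtain K where K: "\<And>D. D division_of {a..b} \<Longrightarrow> (\<Sum>I\<in>D. norm (f (Sup I) - f (Inf I))) \<le> K"
    unfolding bounded_variation_on_interval_def by blast
  have "chain_sum f n x \<le> max K 0" if x: "chain a b n x" for n x
  proof (cases "n = 0")
    case False
    have 1: "\<And>i. i \<in> {..<n} \<Longrightarrow> x i \<le> x (Suc i)" using x by (auto simp: chain_def)
    have 2: "\<And>i j. i \<in> {..<n} \<Longrightarrow> j \<in> {..<n} \<Longrightarrow> i \<noteq> j \<Longrightarrow> {x i<..<x (Suc i)} \<inter> {x j<..<x (Suc j)} = {}"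
      using chain_gaps_disjoint[OF x] by simp
    have "chain_sum f n x = (\<Sum>I\<in>(\<lambda>i. {x i..x (Suc i)}) ` {..<n}. norm (f (Sup I) - f (Inf I)))"
      unfolding chain_sum_def
      by (rule division_of_indexed_intervals(2)[OF _ 1 2, where A = "{..<n}" and g = "\<lambda>x y. norm (f y - f x)", symmetric]) auto
    also have "\<dots> \<le> K"
      using division_of_indexed_intervals(1)[of "{..<n}" x "\<lambda>i. x (Suc i)", OF finite_lessThan 1 2] chain_union[OF x] False
      by (intro K) simp
    finally show ?thesis by simp
  qed (simp add: chain_sum_def)
  then show ?thesis
    by (intro that[of "variation f a"] norm_diff_le_variation[where b = b and K = "max K 0"]) auto
qed

text \<open>The families to which absolute continuity is applied below are indexed by pairs or contain
  degenerate intervals; this form accepts them directly.\<close>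

lemma absolutely_continuous_indexed_intervals:
  assumes ac: "absolutely_continuous_on_interval a b f" and "\<epsilon> > 0"
  obtains \<delta> where "\<delta> > 0"
    "\<And>(A :: 'i set) c d. finite A \<Longrightarrow> (\<And>i. i \<in> A \<Longrightarrow> a \<le> c i \<and> c i \<le> d i \<and> d i \<le> b) \<Longrightarrow>
      (\<And>i j. i \<in> A \<Longrightarrow> j \<in> A \<Longrightarrow> i \<noteq> j \<Longrightarrow> {c i<..<d i} \<inter> {c j<..<d j} = {}) \<Longrightarrow>
      (\<Sum>i\<in>A. d i - c i) < \<delta> \<Longrightarrow> (\<Sum>i\<in>A. norm (f (d i) - f (c i))) < \<epsilon>"
proof -
  from assms obtain \<delta> where d: "\<delta> > 0" and *: "\<And>D. D division_of \<Union>D \<Longrightarrow> \<Union>D \<subseteq> {a..b} \<Longrightarrow>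
        (\<Sum>I\<in>D. Sup I - Inf I) < \<delta> \<Longrightarrow> (\<Sum>I\<in>D. norm (f (Sup I) - f (Inf I))) < \<epsilon>"
    unfolding absolutely_continuous_on_interval_def by meson
  show thesis
  proof (rule that[OF d])
    fix A :: "'i set" and c d 
    assume fin: "finite A" and le: "\<And>i. i \<in> A \<Longrightarrow> a \<le> c i \<and> c i \<le> d i \<and> d i \<le> b"
      and dj: "\<And>i j. i \<in> A \<Longrightarrow> j \<in> A \<Longrightarrow> i \<noteq> j \<Longrightarrow> {c i<..<d i} \<inter> {c j<..<d j} = {}"
      and sm: "(\<Sum>i\<in>A. d i - c i) < \<delta>"
    have le': "c i \<le> d i" if "i \<in> A" for i using le[OF that] by simp
    note D = division_of_indexed_intervals[OF fin le' dj]
    have "(\<Sum>I\<in>(\<lambda>i. {c i..d i}) ` A. norm (f (Sup I) - f (Inf I))) < \<epsilon>"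
    proof (rule *)
      show "(\<lambda>i. {c i..d i}) ` A division_of \<Union>((\<lambda>i. {c i..d i}) ` A)" using D(1) by simp
      show "\<Union>((\<lambda>i. {c i..d i}) ` A) \<subseteq> {a..b}" using le by fastforce
      show "(\<Sum>I\<in>(\<lambda>i. {c i..d i}) ` A. Sup I - Inf I) < \<delta>"
        using D(2)[where g = "\<lambda>x y. y - x"] sm by simp
    qed
    then show "(\<Sum>i\<in>A. norm (f (d i) - f (c i))) < \<epsilon>"
      using D(2)[where g = "\<lambda>x y. norm (f y - f x)"] by simp
  qed
qed

text \<open>On an interval shorter than the \<open>\<delta>\<close> that belongs to \<open>\<epsilon> = 1\<close> all chain sums are at most
  \<open>1\<close>, and finitely many such intervals cover the whole.\<close>

lemma absolutely_continuous_chain_bound: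
  assumes ac: "absolutely_continuous_on_interval a b f" and "a \<le> b"
  obtains K where "\<And>n x. chain a b n x \<Longrightarrow> chain_sum f n x \<le> K"
proof -
  obtain \<delta> where d: "\<delta> > 0" and
    *: "\<And>(A :: nat set) c d. finite A \<Longrightarrow> (\<And>i. i \<in> A \<Longrightarrow> a \<le> c i \<and> c i \<le> d i \<and> d i \<le> b) \<Longrightarrow>
      (\<And>i j. i \<in> A \<Longrightarrow> j \<in> A \<Longrightarrow> i \<noteq> j \<Longrightarrow> {c i<..<d i} \<inter> {c j<..<d j} = {}) \<Longrightarrow>
      (\<Sum>i\<in>A. d i - c i) < \<delta> \<Longrightarrow> (\<Sum>i\<in>A. norm (f (d i) - f (c i))) < 1"
    by (rule absolutely_continuous_indexed_intervals[OF ac, of 1, where 'i = nat]) (simp, blast)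
  have short: "chain_sum f n x \<le> 1" if x: "chain c d n x" and "a \<le> c" "d \<le> b" "d - c < \<delta>" for c d n x
    unfolding chain_sum_def
  proof (rule less_imp_le, rule *)
    show "a \<le> x i \<and> x i \<le> x (Suc i) \<and> x (Suc i) \<le> b" if "i \<in> {..<n}" for i
      using chain_range[OF x, of i] chain_range[OF x, of "Suc i"] x that \<open>a \<le> c\<close> \<open>d \<le> b\<close>
      by (auto simp: chain_def)
    show "(\<Sum>i<n. x (Suc i) - x i) < \<delta>"
      using that x by (simp add: sum_lessThan_telescope chain_def)
  qed (use chain_gaps_disjoint[OF x] in auto)
  have "\<forall>c. a \<le> c \<longrightarrow> c \<le> b \<longrightarrow> c \<le> a + real k * (\<delta>/2) \<longrightarrow> (\<forall>n x. chain a c n x \<longrightarrow> chain_sum f n x \<le> real (Suc k))" for k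
  proof (induction k)
    case 0
    then show ?case using short d by auto
  next
    case (Suc k)
    show ?case
    proof (intro allI impI)
      fix c n x assume c: "a \<le> c" "c \<le> b" "c \<le> a + real (Suc k) * (\<delta>/2)" and x: "chain a c n x"
      \<comment> \<open>Cut off a last piece that is shorter than \<open>\<delta>\<close>.\<close>
      define e where "e = min c (a + real k * (\<delta>/2))"
      have e: "a \<le> e" "e \<le> c" "e \<le> b" "e \<le> a + real k * (\<delta>/2)" using c d by (auto simp: e_def)
      have "chain_sum f n (\<lambda>i. min (x i) e) \<le> real (Suc k)"
        using Suc e chain_split(1)[OF x e(1,2)] by blast
      moreover have "chain_sum f n (\<lambda>i. max e (x i)) \<le> 1"
      proof (rule short[OF chain_split(2)[OF x e(1,2)]])
        have "c < a + real k * (\<delta>/2) + \<delta>" using c(3) d by (simp add: field_simps)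
        then show "c - e < \<delta>" using d by (auto simp: e_def min_def)
      qed (use e c in auto)
      ultimately show "chain_sum f n x \<le> real (Suc (Suc k))"
        using chain_split(3)[OF x e(1,2), of f] by simp
    qed
  qed
  note * = this
  obtain k where "(b - a) / (\<delta>/2) \<le> real k" using real_arch_simple by blast
  then have "b \<le> a + real k * (\<delta>/2)" using d by (simp add: field_simps)
  with * \<open>a \<le> b\<close> show thesis using that by (metis order_refl)
qed

text \<open>On each interval of a disjoint family, some chain nearly attains the increment of the
  variation. All links of all these chains together form a disjoint family of the same total length,
  to which the absolute continuity of \<open>f\<close> applies.\<close>

lemma absolutely_continuous_variation:
  fixes f :: "real \<Rightarrow> 'b::real_normed_vector"
  assumes ac: "absolutely_continuous_on_interval a b f" and "a \<le> b"
  shows "absolutely_continuous_on_interval a b (variation f a)"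
    and "\<And>x y. a \<le> x \<Longrightarrow> x \<le> y \<Longrightarrow> y \<le> b \<Longrightarrow> norm (f y - f x) \<le> variation f a y - variation f a x"
proof -
  obtain K where K: "\<And>n x. chain a b n x \<Longrightarrow> chain_sum f n x \<le> K"
    by (rule absolutely_continuous_chain_bound[OF assms]) blast
  show nd: "norm (f y - f x) \<le> variation f a y - variation f a x" if "a \<le> x" "x \<le> y" "y \<le> b" for x y
    by (rule norm_diff_le_variation[OF K that])
  show "absolutely_continuous_on_interval a b (variation f a)"
    unfolding absolutely_continuous_on_interval_def
  proof (intro allI impI)
    fix \<epsilon> :: real assume e: "\<epsilon> > 0"
    obtain \<delta> where d: "\<delta> > 0" and
      *: "\<And>(A :: (real set \<times> nat) set) c d. finite A \<Longrightarrow> (\<And>i. i \<in> A \<Longrightarrow> a \<le> c i \<and> c i \<le> d i \<and> d i \<le> b) \<Longrightarrow>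
      (\<And>i j. i \<in> A \<Longrightarrow> j \<in> A \<Longrightarrow> i \<noteq> j \<Longrightarrow> {c i<..<d i} \<inter> {c j<..<d j} = {}) \<Longrightarrow>
      (\<Sum>i\<in>A. d i - c i) < \<delta> \<Longrightarrow> (\<Sum>i\<in>A. norm (f (d i) - f (c i))) < \<epsilon>/2"
      by (rule absolutely_continuous_indexed_intervals[OF ac, of "\<epsilon>/2", where 'i = "real set \<times> nat"]) (use e in simp, blast)
    have "(\<Sum>I\<in>D. norm (variation f a (Sup I) - variation f a (Inf I))) < \<epsilon>"
      if D: "D division_of \<Union>D" "\<Union>D \<subseteq> {a..b}" "(\<Sum>I\<in>D. Sup I - Inf I) < \<delta>" for D
    proof -
      have fin: "finite D" using D(1) by blast
      have int_I: "interior I = {Inf I<..<Sup I}" and I: "a \<le> Inf I \<and> Inf I \<le> Sup I \<and> Sup I \<le> b" if "I \<in> D" for I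
      proof -
        obtain c d where cd: "I = cbox c d" using division_ofD(4)[OF D(1) \<open>I \<in> D\<close>] by blast
        have "I \<noteq> {}" using division_ofD(3)[OF D(1) \<open>I \<in> D\<close>] .
        moreover have "I \<subseteq> {a..b}" using D(2) \<open>I \<in> D\<close> by blast
        ultimately have "c \<le> d" "a \<le> c" "d \<le> b" using cd by auto
        then show "interior I = {Inf I<..<Sup I}" "a \<le> Inf I \<and> Inf I \<le> Sup I \<and> Sup I \<le> b"
          using cd by (auto simp: interior_atLeastAtMost_real)
      qed
      \<comment> \<open>The share of each interval in an error of \<open>\<epsilon>/2\<close>; the summand \<open>1\<close> covers empty \<open>D\<close>.\<close>
      define \<epsilon>' where "\<epsilon>' = \<epsilon> / (2 * real (card D) + 1)"
      have e': "\<epsilon>' > 0" using e by (simp add: \<epsilon>'_def)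
      have "\<exists>n x. chain (Inf I) (Sup I) n x \<and> variation f a (Sup I) - variation f a (Inf I) - \<epsilon>' \<le> chain_sum f n x"
        if "I \<in> D" for I
      proof (rule ccontr)
        assume "\<not> ?thesis"
        then have "variation f a (Sup I) - variation f a (Inf I) \<le> variation f a (Sup I) - variation f a (Inf I) - \<epsilon>'"
          using I[OF that] by (intro variation_diff_le[OF K]) (auto simp: not_le less_imp_le)
        then show False using e' by simp
      qed
      then obtain n x where ch: "\<And>I. I \<in> D \<Longrightarrow> chain (Inf I) (Sup I) (n I) (x I)" and
        chs: "\<And>I. I \<in> D \<Longrightarrow> variation f a (Sup I) - variation f a (Inf I) - \<epsilon>' \<le> chain_sum f (n I) (x I)"
        by metis
      have "(\<Sum>I\<in>D. chain_sum f (n I) (x I)) = (\<Sum>(I,i)\<in>(SIGMA I:D. {..<n I}). norm (f (x I (Suc i)) - f (x I i)))"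
        unfolding chain_sum_def using fin by (subst sum.Sigma) auto
      also have "\<dots> = (\<Sum>p\<in>(SIGMA I:D. {..<n I}). norm (f (x (fst p) (Suc (snd p))) - f (x (fst p) (snd p))))"
        by (simp add: case_prod_beta)
      also have "\<dots> < \<epsilon>/2"
      proof (rule *)
        show "finite (SIGMA I:D. {..<n I})" using fin by auto
        show "a \<le> x (fst p) (snd p) \<and> x (fst p) (snd p) \<le> x (fst p) (Suc (snd p)) \<and> x (fst p) (Suc (snd p)) \<le> b"
          if "p \<in> (SIGMA I:D. {..<n I})" for p
        proof -
          have p: "fst p \<in> D" "snd p < n (fst p)" using that by auto
          show ?thesis using chain_range[OF ch[OF p(1)], of "snd p"] chain_range[OF ch[OF p(1)], of "Suc (snd p)"]
            I[OF p(1)] p(2) ch[OF p(1)] by (auto simp: chain_def)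
        qed
        show "{x (fst p) (snd p)<..<x (fst p) (Suc (snd p))} \<inter> {x (fst p') (snd p')<..<x (fst p') (Suc (snd p'))} = {}"
          if "p \<in> (SIGMA I:D. {..<n I})" "p' \<in> (SIGMA I:D. {..<n I})" "p \<noteq> p'" for p p'
        proof -
          have p: "fst p \<in> D" "snd p < n (fst p)" "fst p' \<in> D" "snd p' < n (fst p')" using that by auto
          show ?thesis
          proof (cases "fst p = fst p'")
            case True
            then show ?thesis using chain_gaps_disjoint[OF ch[OF p(1)], of "snd p" "snd p'"] p that(3) by (auto simp: prod_eq_iff)
          next
            case False
            have sub: "{x I i<..<x I (Suc i)} \<subseteq> interior I" if "I \<in> D" "i < n I" for I i
            proof -
              have "{x I i<..<x I (Suc i)} \<subseteq> {Inf I<..<Sup I}"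
                using chain_range[OF ch[OF that(1)], of i] chain_range[OF ch[OF that(1)], of "Suc i"] that by auto
              also have "\<dots> = interior I" using int_I[OF that(1)] by simp
              finally show ?thesis .
            qed
            have "interior (fst p) \<inter> interior (fst p') = {}" using division_ofD(5)[OF D(1) p(1) p(3) False] .
            then show ?thesis using sub[OF p(1,2)] sub[OF p(3,4)] by blast
          qed
        qed
        have "(\<Sum>p\<in>(SIGMA I:D. {..<n I}). x (fst p) (Suc (snd p)) - x (fst p) (snd p)) =
            (\<Sum>(I,i)\<in>(SIGMA I:D. {..<n I}). x I (Suc i) - x I i)"
          by (simp add: case_prod_beta)
        also have "\<dots> = (\<Sum>I\<in>D. \<Sum>i<n I. x I (Suc i) - x I i)"
          using fin by (subst sum.Sigma) auto
        also have "\<dots> = (\<Sum>I\<in>D. Sup I - Inf I)"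
          using ch by (intro sum.cong) (auto simp: sum_lessThan_telescope chain_def)
        finally show "(\<Sum>p\<in>(SIGMA I:D. {..<n I}). x (fst p) (Suc (snd p)) - x (fst p) (snd p)) < \<delta>"
          using D(3) by simp
      qed
      finally have 1: "(\<Sum>I\<in>D. chain_sum f (n I) (x I)) < \<epsilon>/2" .
      have "(\<Sum>I\<in>D. norm (variation f a (Sup I) - variation f a (Inf I))) \<le> (\<Sum>I\<in>D. chain_sum f (n I) (x I) + \<epsilon>')"
      proof (rule sum_mono)
        fix I assume "I \<in> D"
        then show "norm (variation f a (Sup I) - variation f a (Inf I)) \<le> chain_sum f (n I) (x I) + \<epsilon>'"
          using chs[of I] nd[of "Inf I" "Sup I"] I[of I] norm_ge_zero[of "f (Sup I) - f (Inf I)"]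
            unfolding real_norm_def by linarith
      qed
      also have "\<dots> = (\<Sum>I\<in>D. chain_sum f (n I) (x I)) + real (card D) * \<epsilon>'" by (simp add: sum.distrib)
      also have "\<dots> < \<epsilon>/2 + \<epsilon>/2"
      proof -
        have "real (card D) * \<epsilon>' \<le> \<epsilon>/2" using e unfolding \<epsilon>'_def by (simp add: field_simps)
        with 1 show ?thesis by simp
      qed
      finally show ?thesis by simp
    qed
    with d show "\<exists>\<delta>>0. \<forall>D. D division_of \<Union> D \<and> \<Union> D \<subseteq> {a..b} \<and> (\<Sum>I\<in>D. Sup I - Inf I) < \<delta> \<longrightarrow>
             (\<Sum>I\<in>D. norm (variation f a (Sup I) - variation f a (Inf I))) < \<epsilon>"
      by blast
  qed
qed

section \<open>Absolutely continuous functions are indefinite integrals\<close>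

text \<open>For gauge integrals; the short name denotes the corresponding fact for Bochner integrals.\<close>

lemmas HK_integral_combine = Henstock_Kurzweil_Integration.integral_combine

lemma absolutely_integrable_integrable_subinterval:
  fixes f :: "real \<Rightarrow> 'b::euclidean_space"
  assumes "f absolutely_integrable_on {a..b}" "{c..d} \<subseteq> {a..b}"
  shows "f integrable_on {c..d}"
  by (rule integrable_subinterval_real[OF set_lebesgue_integral_eq_integral(1)[OF assms(1)] assms(2)])

text \<open>Lebesgue's differentiation theorem on an interval. Averages over intervals to the right of
  almost every point converge, which gives the right-hand derivative; the same fact for the reflected
  function gives the left-hand derivative.\<close>

lemma integral_has_vector_derivative_negligible:
  fixes f :: "real \<Rightarrow> 'b::euclidean_space"
  assumes f: "f integrable_on {a..b}"
  obtains N where "negligible N" "\<And>x. x \<in> {a..b} - N \<Longrightarrow>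
    ((\<lambda>t. integral {a..t} f) has_vector_derivative f x) (at x within {a..b})"
proof -
  \<comment> \<open>Extended by zero, \<open>f\<close> is integrable over all intervals.\<close>
  define F where "F = (\<lambda>x. if x \<in> {a..b} then f x else 0)"
  have "F integrable_on UNIV"
    using f unfolding F_def by (simp only: integrable_restrict_UNIV)
  then have Fint: "F integrable_on cbox c d" for c d
    by (rule integrable_on_subcbox) simp
  have Fint': "(\<lambda>x. F (- x)) integrable_on cbox c d" for c d
  proof -
    have "(\<lambda>x. F (- x)) integrable_on cbox (- (- c)) (- (- d))"
      by (subst Henstock_Kurzweil_Integration.integrable_reflect) (rule Fint)
    then show ?thesis by (simp only: minus_minus)
  qed
  from integrable_ccontinuous_explicit[of "\<lambda>x. F (- x)", OF Fint'] obtain N2 where N2: "negligible N2"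
    "\<And>x e. \<lbrakk>x \<notin> N2; 0 < e\<rbrakk> \<Longrightarrow> \<exists>d>0. \<forall>h. 0 < h \<and> h < d \<longrightarrow>
       norm (integral (cbox x (x + h *\<^sub>R One)) (\<lambda>x. F (- x)) /\<^sub>R h ^ DIM(real) - F (- x)) < e"
    by blast
  from integrable_ccontinuous_explicit[of F, OF Fint] obtain N1 where N1: "negligible N1"
    "\<And>x e. \<lbrakk>x \<notin> N1; 0 < e\<rbrakk> \<Longrightarrow> \<exists>d>0. \<forall>h. 0 < h \<and> h < d \<longrightarrow>
       norm (integral (cbox x (x + h *\<^sub>R One)) F /\<^sub>R h ^ DIM(real) - F x) < e"
    by blast
  have neg: "negligible (N1 \<union> uminus ` N2)"
  proof (rule negligible_Un[OF N1(1)])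
    show "negligible (uminus ` N2)"
      by (rule negligible_differentiable_image_negligible[OF _ N2(1)])
        (auto intro!: linear_imp_differentiable_on linear_uminus)
  qed
  show thesis
  proof (rule that[OF neg])
    fix x assume x: "x \<in> {a..b} - (N1 \<union> uminus ` N2)"
    then have x1: "x \<notin> N1" and x2: "- x \<notin> N2" by force+
    have IF: "integral {c..d} f = integral {c..d} F" if "a \<le> c" "d \<le> b" for c d
      using that by (intro integral_cong) (auto simp: F_def)
    have est: "norm (J - h *\<^sub>R y) \<le> e * h" if "norm (J /\<^sub>R h - y) < e" "h > 0" for J y :: 'b and h e :: real
    proof -
      have "J - h *\<^sub>R y = h *\<^sub>R (J /\<^sub>R h - y)" using that(2) by (simp add: algebra_simps)
      then have "norm (J - h *\<^sub>R y) = h * norm (J /\<^sub>R h - y)" using that(2) by simp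
      then show ?thesis using that by (simp add: mult.commute mult_left_mono)
    qed
    show "((\<lambda>t. integral {a..t} f) has_vector_derivative f x) (at x within {a..b})"
      unfolding has_vector_derivative_def has_derivative_within_alt
    proof (intro conjI allI impI)
      fix e :: real assume e: "e > 0"
      obtain d1 where d1: "d1 > 0" "\<And>h. 0 < h \<and> h < d1 \<Longrightarrow> norm (integral {x..x + h} F /\<^sub>R h - F x) < e"
        using N1(2)[OF x1 e] by auto
      obtain d2 where d2: "d2 > 0" "\<And>h. 0 < h \<and> h < d2 \<Longrightarrow> norm (integral {-x..-x + h} (\<lambda>x. F (- x)) /\<^sub>R h - F x) < e"
        using N2(2)[OF x2 e] by auto
      have "norm (integral {a..y} f - integral {a..x} f - (y - x) *\<^sub>R f x) \<le> e * norm (y - x)"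
        if y: "y \<in> {a..b}" and d: "norm (y - x) < min d1 d2" for y
      proof (cases "y = x")
        case False
        show ?thesis
        proof (cases "x < y")
          case True
          have "integral {a..x} f + integral {x..y} f = integral {a..y} f"
            using x y True integrable_subinterval_real[OF f] by (intro HK_integral_combine) auto
          then have "integral {a..y} f - integral {a..x} f = integral {x..x + (y - x)} F"
            using x y IF[of x y] by (auto simp: algebra_simps)
          moreover have "norm (integral {x..x + (y - x)} F - (y - x) *\<^sub>R F x) \<le> e * (y - x)"
            using True d by (intro est d1(2)) auto
          moreover have "F x = f x" using x by (simp add: F_def)
          ultimately show ?thesis using True by simp
        next
          case False
          then have "y < x" using \<open>y \<noteq> x\<close> by simp
          have "integral {a..y} f + integral {y..x} f = integral {a..x} f"
            using x y \<open>y < x\<close> integrable_subinterval_real[OF f] by (intro HK_integral_combine) auto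
          then have "integral {a..x} f - integral {a..y} f = integral {y..x} F"
            using x y IF[of y x] by (auto simp: algebra_simps)
          also have "\<dots> = integral {-x..-y} (\<lambda>x. F (- x))"
            by (rule Henstock_Kurzweil_Integration.integral_reflect_real[symmetric])
          also have "-y = -x + (x - y)" by simp
          finally have "norm (integral {a..x} f - integral {a..y} f - (x - y) *\<^sub>R F x) \<le> e * (x - y)"
            using \<open>y < x\<close> d by (simp only:) (intro est d2(2), auto)
          moreover have "F x = f x" using x by (simp add: F_def)
          moreover have "integral {a..y} f - integral {a..x} f - (y - x) *\<^sub>R f x
             = - (integral {a..x} f - integral {a..y} f - (x - y) *\<^sub>R f x)"
            by (simp add: algebra_simps)
          ultimately show ?thesis using \<open>y < x\<close> by (simp only: norm_minus_cancel) simp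
        qed
      qed simp
      then show "\<exists>d>0. \<forall>y\<in>{a..b}. norm (y - x) < d \<longrightarrow>
          norm (integral {a..y} f - integral {a..x} f - (y - x) *\<^sub>R f x) \<le> e * norm (y - x)"
        using d1(1) d2(1) by (intro exI[of _ "min d1 d2"]) auto
    qed (rule bounded_linear_scaleR_left)
  qed
qed

text \<open>A common source for the closure properties of absolute continuity: sums, differences,
  components and products all have increments that are dominated in this way.\<close>

lemma absolutely_continuous_on_interval_dominated:
  assumes f: "absolutely_continuous_on_interval a b f" and g: "absolutely_continuous_on_interval a b g"
    and "C \<ge> 0" and le: "\<And>x y. a \<le> x \<Longrightarrow> x \<le> y \<Longrightarrow> y \<le> b \<Longrightarrow>
      norm (h y - h x) \<le> C * (norm (f y - f x) + norm (g y - g x))"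
  shows "absolutely_continuous_on_interval a b h"
  unfolding absolutely_continuous_on_interval_def
proof (intro allI impI)
  fix \<epsilon> :: real assume e: "\<epsilon> > 0"
  define \<epsilon>' where "\<epsilon>' = \<epsilon> / (2 * (C + 1))"
  have e': "\<epsilon>' > 0" using e \<open>C \<ge> 0\<close> by (simp add: \<epsilon>'_def)
  obtain d1 where d1: "d1 > 0" "\<And>D. D division_of \<Union>D \<and> \<Union>D \<subseteq> {a..b} \<and> (\<Sum>I\<in>D. Sup I - Inf I) < d1 \<longrightarrow>
        (\<Sum>I\<in>D. norm (f (Sup I) - f (Inf I))) < \<epsilon>'"
    using f e' unfolding absolutely_continuous_on_interval_def by meson
  obtain d2 where d2: "d2 > 0" "\<And>D. D division_of \<Union>D \<and> \<Union>D \<subseteq> {a..b} \<and> (\<Sum>I\<in>D. Sup I - Inf I) < d2 \<longrightarrow>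
        (\<Sum>I\<in>D. norm (g (Sup I) - g (Inf I))) < \<epsilon>'"
    using g e' unfolding absolutely_continuous_on_interval_def by meson
  have "(\<Sum>I\<in>D. norm (h (Sup I) - h (Inf I))) < \<epsilon>"
    if D: "D division_of \<Union>D" "\<Union>D \<subseteq> {a..b}" "(\<Sum>I\<in>D. Sup I - Inf I) < min d1 d2" for D
  proof -
    have "(\<Sum>I\<in>D. norm (h (Sup I) - h (Inf I))) \<le> (\<Sum>I\<in>D. C * (norm (f (Sup I) - f (Inf I)) + norm (g (Sup I) - g (Inf I))))"
    proof (intro sum_mono le)
      fix I assume I: "I \<in> D"
      then obtain c d where cd: "I = {c..d}" "I \<noteq> {}" using D(1) by (metis division_ofD(3,4) interval_cbox)
      then have "c \<le> d" by simp
      moreover have "a \<le> c" "d \<le> b" using D(2) cd I \<open>c \<le> d\<close> by (fastforce simp: subset_iff)+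
      ultimately show "a \<le> Inf I" "Inf I \<le> Sup I" "Sup I \<le> b" using cd by auto
    qed
    also have "\<dots> = C * ((\<Sum>I\<in>D. norm (f (Sup I) - f (Inf I))) + (\<Sum>I\<in>D. norm (g (Sup I) - g (Inf I))))"
      by (simp only: sum_distrib_left[symmetric] sum.distrib)
    also have "\<dots> \<le> C * (\<epsilon>' + \<epsilon>')"
      using d1(2)[of D] d2(2)[of D] D \<open>C \<ge> 0\<close> by (intro mult_left_mono add_mono) auto
    also have "\<dots> < 2 * (C + 1) * \<epsilon>'" using e' by (simp add: algebra_simps)
    also have "\<dots> = \<epsilon>" using \<open>C \<ge> 0\<close> by (simp add: \<epsilon>'_def)
    finally show ?thesis .
  qed
  then show "\<exists>\<delta>>0. \<forall>D. D division_of \<Union> D \<and> \<Union> D \<subseteq> {a..b} \<and> (\<Sum>I\<in>D. Sup I - Inf I) < \<delta> \<longrightarrow>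
             (\<Sum>I\<in>D. norm (h (Sup I) - h (Inf I))) < \<epsilon>"
    using d1(1) d2(1) by (intro exI[of _ "min d1 d2"]) auto
qed

lemma absolutely_continuous_imp_continuous_on:
  assumes ac: "absolutely_continuous_on_interval a b f"
  shows "continuous_on {a..b} f"
  unfolding continuous_on_iff
proof (intro ballI allI impI)
  fix x \<epsilon> :: real assume x: "x \<in> {a..b}" and e: "\<epsilon> > 0"
  obtain \<delta> where d: "\<delta> > 0" and
    *: "\<And>(A :: unit set) c d. finite A \<Longrightarrow> (\<And>i. i \<in> A \<Longrightarrow> a \<le> c i \<and> c i \<le> d i \<and> d i \<le> b) \<Longrightarrow>
      (\<And>i j. i \<in> A \<Longrightarrow> j \<in> A \<Longrightarrow> i \<noteq> j \<Longrightarrow> {c i<..<d i} \<inter> {c j<..<d j} = {}) \<Longrightarrow>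
      (\<Sum>i\<in>A. d i - c i) < \<delta> \<Longrightarrow> (\<Sum>i\<in>A. norm (f (d i) - f (c i))) < \<epsilon>"
    by (rule absolutely_continuous_indexed_intervals[OF ac e, where 'i = unit]) blast
  have "norm (f y - f z) < \<epsilon>" if "a \<le> z" "z \<le> y" "y \<le> b" "y - z < \<delta>" for y z
    using *[of UNIV "\<lambda>_. z" "\<lambda>_. y"] that by simp
  note * = this
  have "dist (f y) (f x) < \<epsilon>" if "y \<in> {a..b}" "dist y x < \<delta>" for y
    using that x *[of x y] *[of y x]
    by (cases "x \<le> y") (auto simp: dist_norm norm_minus_commute[of "f y"] abs_if split: if_splits)
  with d show "\<exists>d>0. \<forall>x'\<in>{a..b}. dist x' x < d \<longrightarrow> dist (f x') (f x) < \<epsilon>" by blast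
qed

lemma absolutely_continuous_bounded_bilinear:
  assumes "bounded_bilinear mul"
    and f: "absolutely_continuous_on_interval a b f" and g: "absolutely_continuous_on_interval a b g"
  shows "absolutely_continuous_on_interval a b (\<lambda>t. mul (f t) (g t))"
proof -
  interpret bounded_bilinear mul by fact
  obtain K where K: "0 \<le> K" "\<And>x y. norm (mul x y) \<le> norm x * norm y * K"
    using nonneg_bounded by blast
  note fc = absolutely_continuous_imp_continuous_on[OF f] and gc = absolutely_continuous_imp_continuous_on[OF g]
  obtain M1 M2 where M1: "\<forall>y\<in>f ` {a..b}. norm y \<le> M1" and M2: "\<forall>y\<in>g ` {a..b}. norm y \<le> M2"
    using compact_imp_bounded[OF compact_continuous_image[OF fc compact_Icc]]
      compact_imp_bounded[OF compact_continuous_image[OF gc compact_Icc]] unfolding bounded_iff by blast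
  define M where "M = max 0 (max M1 M2)"
  show ?thesis
  proof (rule absolutely_continuous_on_interval_dominated[OF f g])
    show "0 \<le> M * K" using K by (simp add: M_def)
    fix x y assume xy: "a \<le> x" "x \<le> y" "y \<le> b"
    have Mx: "norm (f x) \<le> M" "norm (g y) \<le> M"
      using bspec[OF M1, of "f x"] bspec[OF M2, of "g y"] xy by (auto simp: M_def)
    have "mul (f y) (g y) - mul (f x) (g x) = mul (f y - f x) (g y) + mul (f x) (g y - g x)"
      by (simp add: diff_left diff_right)
    also have "norm \<dots> \<le> norm (f y - f x) * norm (g y) * K + norm (f x) * norm (g y - g x) * K"
      by (intro order_trans[OF norm_triangle_ineq] add_mono K(2))
    also have "\<dots> \<le> norm (f y - f x) * M * K + M * norm (g y - g x) * K"
      using Mx K(1) by (intro add_mono mult_right_mono mult_left_mono) auto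
    also have "\<dots> = M * K * (norm (f y - f x) + norm (g y - g x))" by (simp add: algebra_simps)
    finally show "norm (mul (f y) (g y) - mul (f x) (g x)) \<le> M * K * (norm (f y - f x) + norm (g y - g x))" .
  qed
qed

text \<open>Cut \<open>norm f\<close> at a level \<open>k\<close>: the part above, \<open>h k\<close>, has a small integral if \<open>k\<close> is large, and the
  part below contributes at most \<open>k\<close> times the total length of the intervals.\<close>

lemma absolutely_continuous_indefinite_integral:
  fixes f :: "real \<Rightarrow> 'b::euclidean_space"
  assumes f: "f absolutely_integrable_on {a..b}"
  shows "absolutely_continuous_on_interval a b (\<lambda>t. integral {a..t} f)"
  unfolding absolutely_continuous_on_interval_def
proof (intro allI impI)
  fix \<epsilon> :: real assume e: "\<epsilon> > 0"
  have fi: "f integrable_on {a..b}" and nf: "(\<lambda>x. norm (f x)) integrable_on {a..b}"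
    using f by (auto simp: absolutely_integrable_on_def)
  define h where "h = (\<lambda>k x. max (norm (f x) - real k) 0)"
  have h_int: "h k integrable_on {a..b}" for k
  proof -
    have "(\<lambda>x. norm (f x) - real k) absolutely_integrable_on {a..b}"
      using absolutely_integrable_norm[OF f] absolutely_integrable_continuous_real[of a b "\<lambda>_. real k"]
      by (intro set_integral_diff) (auto simp: o_def)
    from absolutely_integrable_max_1[OF this, of "\<lambda>_. 0"] show ?thesis
      unfolding h_def by (simp add: set_lebesgue_integral_eq_integral(1))
  qed
  have "(\<lambda>k. integral {a..b} (h k)) \<longlonglongrightarrow> integral {a..b} (\<lambda>x. 0)"
  proof (rule dominated_convergence(2)[OF h_int nf])
    show "norm (h k x) \<le> norm (f x)" for k x by (auto simp: h_def)
    show "(\<lambda>k. h k x) \<longlonglongrightarrow> 0" for x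
    proof (rule tendsto_eventually)
      obtain n where "norm (f x) \<le> real n" using real_arch_simple by blast
      then show "\<forall>\<^sub>F k in sequentially. h k x = 0"
        by (intro eventually_sequentiallyI[of n]) (auto simp: h_def)
    qed
  qed
  then have "\<forall>\<^sub>F k in sequentially. integral {a..b} (h k) < \<epsilon>/2"
    using e by (intro order_tendstoD) auto
  then obtain k where k: "integral {a..b} (h k) < \<epsilon>/2" by (meson eventually_happens sequentially_bot)
  define \<delta> where "\<delta> = \<epsilon> / (2 * (real k + 1))"
  have d: "\<delta> > 0" using e by (simp add: \<delta>_def)
  have "(\<Sum>I\<in>D. norm (integral {a..Sup I} f - integral {a..Inf I} f)) < \<epsilon>"
    if D: "D division_of \<Union>D" "\<Union>D \<subseteq> {a..b}" "(\<Sum>I\<in>D. Sup I - Inf I) < \<delta>" for D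
  proof -
    have "(\<Sum>I\<in>D. norm (integral {a..Sup I} f - integral {a..Inf I} f)) \<le> (\<Sum>I\<in>D. real k * (Sup I - Inf I) + integral I (h k))"
    proof (rule sum_mono)
      fix I assume I: "I \<in> D"
      then obtain c d where cd: "I = {c..d}" "I \<noteq> {}" using D(1) by (metis division_ofD(3,4) interval_cbox)
      then have "c \<le> d" by simp
      moreover have "a \<le> c" "d \<le> b" using D(2) cd I \<open>c \<le> d\<close> by (fastforce simp: subset_iff)+
      ultimately have *: "c \<le> d" "a \<le> c" "d \<le> b" by auto
      have "integral {a..c} f + integral {c..d} f = integral {a..d} f"
        using * integrable_subinterval_real[OF fi] by (intro HK_integral_combine) auto
      then have "norm (integral {a..d} f - integral {a..c} f) = norm (integral {c..d} f)"
        by (metis add_diff_cancel_left')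
      also have "\<dots> \<le> integral {c..d} (\<lambda>x. real k + h k x)"
        using * by (intro integral_norm_bound_integral integrable_add integrable_const_ivl
            integrable_subinterval_real[OF fi] integrable_subinterval_real[OF h_int]) (auto simp: h_def)
      also have "\<dots> = real k * (d - c) + integral {c..d} (h k)"
        using * by (subst integral_add) (auto intro!: integrable_subinterval_real[OF h_int])
      finally show "norm (integral {a..Sup I} f - integral {a..Inf I} f) \<le> real k * (Sup I - Inf I) + integral I (h k)"
        using * cd by simp
    qed
    also have "\<dots> = real k * (\<Sum>I\<in>D. Sup I - Inf I) + (\<Sum>I\<in>D. integral I (h k))"
      by (simp add: sum.distrib sum_distrib_left)
    also have "(\<Sum>I\<in>D. integral I (h k)) = integral (\<Union>D) (h k)"
      by (rule integral_combine_division_topdown[OF integrable_on_subdivision[OF D(1) h_int D(2)] D(1), symmetric])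
    also have "\<dots> \<le> integral {a..b} (h k)"
    proof (rule integral_subset_le[OF D(2) _ h_int])
      show "h k integrable_on \<Union>D" by (rule integrable_on_subdivision[OF D(1) h_int D(2)])
    qed (auto simp: h_def)
    also have "real k * (\<Sum>I\<in>D. Sup I - Inf I) \<le> real k * \<delta>" using D(3) by (intro mult_left_mono) auto
    also have "real k * \<delta> \<le> \<epsilon>/2" using e by (simp add: \<delta>_def field_simps)
    finally show ?thesis using k by simp
  qed
  with d show "\<exists>\<delta>>0. \<forall>D. D division_of \<Union> D \<and> \<Union> D \<subseteq> {a..b} \<and> (\<Sum>I\<in>D. Sup I - Inf I) < \<delta> \<longrightarrow>
             (\<Sum>I\<in>D. norm (integral {a..Sup I} f - integral {a..Inf I} f)) < \<epsilon>"
    by blast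
qed

text \<open>Continued by constants, \<open>F\<close> is the distribution function of a measure. A Lebesgue null set lies in
  an open set of Lebesgue measure below \<open>\<delta>\<close>, which is an increasing union of finite unions of
  intervals; absolute continuity of \<open>F\<close> makes the measure of all of these small.\<close>

lemma absolutely_continuous_mono_null:
  fixes F :: "real \<Rightarrow> real"
  assumes ac: "absolutely_continuous_on_interval a b F" and mono: "\<And>x y. a \<le> x \<Longrightarrow> x \<le> y \<Longrightarrow> y \<le> b \<Longrightarrow> F x \<le> F y"
    and "a \<le> b"
  defines "\<mu> \<equiv> interval_measure (\<lambda>x. F (max a (min b x)))"
  shows "\<And>c d. c \<le> d \<Longrightarrow> emeasure \<mu> {c..d} = ennreal (F (max a (min b d)) - F (max a (min b c)))"
    and "absolutely_continuous lborel \<mu>"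
proof -
  let ?G = "\<lambda>x. F (max a (min b x))"
  have mG: "?G x \<le> ?G y" if "x \<le> y" for x y using that \<open>a \<le> b\<close> by (intro mono) auto
  have cG: "continuous_on UNIV ?G"
    by (intro continuous_on_compose2[OF absolutely_continuous_imp_continuous_on[OF ac]] continuous_intros) (use \<open>a \<le> b\<close> in auto)
  show Icc: "emeasure \<mu> {c..d} = ennreal (?G d - ?G c)" if "c \<le> d" for c d
    unfolding \<mu>_def by (rule emeasure_interval_measure_Icc[OF that mG cG])
  have [simp]: "sets \<mu> = sets borel" by (simp add: \<mu>_def)
  show "absolutely_continuous lborel \<mu>"
    unfolding absolutely_continuous_def
  proof
    fix N :: "real set" assume N: "N \<in> null_sets lborel"
    have Nb: "N \<in> sets borel" using N by auto
    have "emeasure \<mu> N \<le> ennreal e" if e: "e > 0" for e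
    proof -
      obtain \<delta> where d: "\<delta> > 0" and
        *: "\<And>(A :: real set set) c d. finite A \<Longrightarrow> (\<And>i. i \<in> A \<Longrightarrow> a \<le> c i \<and> c i \<le> d i \<and> d i \<le> b) \<Longrightarrow>
          (\<And>i j. i \<in> A \<Longrightarrow> j \<in> A \<Longrightarrow> i \<noteq> j \<Longrightarrow> {c i<..<d i} \<inter> {c j<..<d j} = {}) \<Longrightarrow>
          (\<Sum>i\<in>A. d i - c i) < \<delta> \<Longrightarrow> (\<Sum>i\<in>A. norm (F (d i) - F (c i))) < e"
        by (rule absolutely_continuous_indexed_intervals[OF ac e, where 'i = "real set"]) blast
      obtain U where U: "open U" "N \<subseteq> U" "emeasure lborel (U - N) < ennreal \<delta>"
        using outer_regular_lborel[OF Nb d] by blast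
      have "emeasure lborel U = emeasure lborel (U - N)"
        using N U by (simp add: emeasure_Diff_null_set)
      then have U\<delta>: "emeasure lborel U < ennreal \<delta>" using U by simp
      obtain \<D> where \<D>: "countable \<D>" "\<And>X. X \<in> \<D> \<Longrightarrow> \<exists>a b. X = cbox a b" "\<Union>\<D> = U"
        by (rule open_countable_Union_open_cbox[OF U(1)]) blast
      \<comment> \<open>The empty interval stands in if \<open>U\<close> is empty.\<close>
      define Q where "Q = (\<lambda>n. if \<D> = {} then {} else from_nat_into \<D> n)"
      have Q: "\<exists>a b. Q n = cbox a b" for n
      proof (cases "\<D> = {}")
        case True
        then have "Q n = cbox 1 0" by (simp add: Q_def)
        then show ?thesis by blast
      next
        case False
        then show ?thesis using \<D>(2) from_nat_into[of \<D> n] by (simp add: Q_def)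
      qed
      have UQ: "(\<Union>n. Q n) = U"
      proof (cases "\<D> = {}")
        case False
        then have "(\<Union>n. Q n) = \<Union> (range (from_nat_into \<D>))" by (simp add: Q_def)
        also have "\<dots> = \<Union>\<D>" using range_from_nat_into[OF False \<D>(1)] by simp
        finally show ?thesis using \<D>(3) by simp
      qed (use \<D>(3) in \<open>auto simp: Q_def\<close>)
      define W where "W = (\<lambda>n. \<Union>i\<le>n. Q i)"
      have Qb: "Q n \<in> sets borel" for n using Q[of n] by auto
      have W: "range W \<subseteq> sets \<mu>" "incseq W" "(\<Union>n. W n) = U"
        using Qb UQ by (auto simp: W_def incseq_def intro: order_trans) 
      have "emeasure \<mu> (W n) \<le> ennreal e" for n
      proof -
        obtain D where D: "D division_of \<Union>(Q ` {..n})"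
          using elementary_unions_intervals[of "Q ` {..n}"] Q by blast
        then have DW: "\<Union>D = W n" by (simp add: W_def division_of_def)
        have fin: "finite D" using D by blast
        have I: "I = {Inf I..Sup I}" "Inf I \<le> Sup I" "interior I = {Inf I<..<Sup I}" if "I \<in> D" for I
        proof -
          obtain c d where cd: "I = cbox c d" using division_ofD(4)[OF D \<open>I \<in> D\<close>] by blast
          have "I \<noteq> {}" using division_ofD(3)[OF D \<open>I \<in> D\<close>] .
          with cd have "c \<le> d" by auto
          then show "I = {Inf I..Sup I}" "Inf I \<le> Sup I" "interior I = {Inf I<..<Sup I}"
            using cd by (auto simp: interior_atLeastAtMost_real)
        qed
        let ?c = "\<lambda>x. max a (min b x)"
        have "ennreal (\<Sum>I\<in>D. Sup I - Inf I) = emeasure lborel (W n)"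
        proof -
          have "(\<Sum>I\<in>D. Sup I - Inf I) = (\<Sum>I\<in>D. measure lebesgue I)"
          proof (rule sum.cong)
            fix I assume "I \<in> D"
            have "measure lebesgue {Inf I..Sup I} = Sup I - Inf I"
              using I(2)[OF \<open>I \<in> D\<close>] by (simp add: measure_completion)
            then show "Sup I - Inf I = measure lebesgue I"
              by (intro subst[OF I(1)[OF \<open>I \<in> D\<close>, symmetric], of "\<lambda>J. Sup I - Inf I = measure lebesgue J"]) simp
          qed simp
          also have "\<dots> = measure lebesgue (W n)"
            using content_division[OF D] by (simp add: W_def)
          also have "\<dots> = measure lborel (W n)"
            using Qb by (simp add: W_def measure_completion)
          also have "ennreal \<dots> = emeasure lborel (W n)"
          proof (rule emeasure_eq_ennreal_measure[symmetric])
            have "emeasure lborel (W n) \<le> emeasure lborel U"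
              using W U(1) by (intro emeasure_mono) auto
            then show "emeasure lborel (W n) \<noteq> top" using U\<delta> by (auto simp: top_unique)
          qed
          finally show ?thesis .
        qed
        also have "\<dots> \<le> emeasure lborel U"
          using W U(1) by (intro emeasure_mono) auto
        finally have "ennreal (\<Sum>I\<in>D. Sup I - Inf I) < ennreal \<delta>"
          using U\<delta> by (rule le_less_trans)
        moreover have "0 \<le> (\<Sum>I\<in>D. Sup I - Inf I)" using I(2) by (intro sum_nonneg) simp
        ultimately have len: "(\<Sum>I\<in>D. Sup I - Inf I) < \<delta>" by (simp add: ennreal_less_iff)
        have "(\<Sum>I\<in>D. norm (F (?c (Sup I)) - F (?c (Inf I)))) < e"
        proof (rule *[OF fin])
          show "a \<le> ?c (Inf I) \<and> ?c (Inf I) \<le> ?c (Sup I) \<and> ?c (Sup I) \<le> b" if "I \<in> D" for I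
            using I(2)[OF that] \<open>a \<le> b\<close> by auto
          show "{?c (Inf I)<..<?c (Sup I)} \<inter> {?c (Inf J)<..<?c (Sup J)} = {}"
            if "I \<in> D" "J \<in> D" "I \<noteq> J" for I J
          proof -
            have "{?c (Inf I)<..<?c (Sup I)} \<subseteq> {Inf I<..<Sup I}" for I using \<open>a \<le> b\<close> by auto
            moreover have "{Inf I<..<Sup I} \<inter> {Inf J<..<Sup J} = {}"
              using division_ofD(5)[OF D that] unfolding I(3)[OF that(1)] I(3)[OF that(2)] .
            ultimately show ?thesis by blast
          qed
          have "(\<Sum>I\<in>D. ?c (Sup I) - ?c (Inf I)) \<le> (\<Sum>I\<in>D. Sup I - Inf I)"
          proof (rule sum_mono)
            have c1: "?c y - ?c x \<le> y - x" if "x \<le> y" for x y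
              using that by (simp add: max_def min_def)
            show "?c (Sup I) - ?c (Inf I) \<le> Sup I - Inf I" if "I \<in> D" for I
              by (rule c1[OF I(2)[OF that]])
          qed
          then show "(\<Sum>I\<in>D. ?c (Sup I) - ?c (Inf I)) < \<delta>" using len by linarith
        qed
        note s1 = this
        have s2: "(\<Sum>I\<in>D. ?G (Sup I) - ?G (Inf I)) \<le> (\<Sum>I\<in>D. norm (F (?c (Sup I)) - F (?c (Inf I))))"
          by (rule sum_mono) (simp only: real_norm_def abs_ge_self)
        have s: "(\<Sum>I\<in>D. ?G (Sup I) - ?G (Inf I)) \<le> e"
          by (rule less_imp_le, rule le_less_trans, rule s2, rule s1)
        have "emeasure \<mu> (W n) = emeasure \<mu> (\<Union>I\<in>D. I)" using DW by simp
        also have "\<dots> \<le> (\<Sum>I\<in>D. emeasure \<mu> I)"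
        proof (rule emeasure_subadditive_finite[OF fin])
          have "I \<in> sets borel" if "I \<in> D" for I by (subst I(1)[OF that]) simp
          then show "(\<lambda>I. I) ` D \<subseteq> sets \<mu>" by auto
        qed
        also have "\<dots> = (\<Sum>I\<in>D. ennreal (?G (Sup I) - ?G (Inf I)))"
        proof (rule sum.cong)
          fix I assume "I \<in> D"
          show "emeasure \<mu> I = ennreal (?G (Sup I) - ?G (Inf I))"
            by (rule subst[OF I(1)[OF \<open>I \<in> D\<close>, symmetric], of "\<lambda>J. emeasure \<mu> J = ennreal (?G (Sup I) - ?G (Inf I))"])
              (rule Icc[OF I(2)[OF \<open>I \<in> D\<close>]])
        qed simp
        also have "\<dots> = ennreal (\<Sum>I\<in>D. ?G (Sup I) - ?G (Inf I))"
          using mG I(2) by (intro sum_ennreal) auto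
        also have "\<dots> \<le> ennreal e" using s by (rule ennreal_leI)
        finally show ?thesis .
      qed
      then have "(SUP n. emeasure \<mu> (W n)) \<le> ennreal e" by (rule SUP_least)
      then have "emeasure \<mu> U \<le> ennreal e"
        using SUP_emeasure_incseq[OF W(1,2)] W(3) by simp
      moreover have "emeasure \<mu> N \<le> emeasure \<mu> U" using U by (intro emeasure_mono) auto
      ultimately show ?thesis by simp
    qed
    note small = this
    have "emeasure \<mu> N \<le> 0"
    proof (rule ennreal_le_epsilon)
      fix e :: real assume "0 < e"
      from small[OF this] show "emeasure \<mu> N \<le> 0 + ennreal e" by (simp only: add_0)
    qed
    then show "N \<in> null_sets \<mu>" using Nb by (simp add: null_sets_def)
  qed
qed

text \<open>The density is the Radon--Nikodym derivative of the Stieltjes measure of \<open>F\<close>.\<close>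

lemma absolutely_continuous_mono_density:
  fixes F :: "real \<Rightarrow> real"
  assumes ac: "absolutely_continuous_on_interval a b F" and mono: "\<And>x y. a \<le> x \<Longrightarrow> x \<le> y \<Longrightarrow> y \<le> b \<Longrightarrow> F x \<le> F y"
    and "a \<le> b"
  obtains g where "g absolutely_integrable_on {a..b}" "\<And>t. t \<in> {a..b} \<Longrightarrow> F t = F a + integral {a..t} g"
proof -
  define \<mu> where "\<mu> = interval_measure (\<lambda>x. F (max a (min b x)))"
  have Icc: "emeasure \<mu> {a..t} = ennreal (F t - F a)" if "t \<in> {a..b}" for t
  proof -
    have "max a (min b t) = t" "max a (min b a) = a" using that by auto
    then show ?thesis
      using absolutely_continuous_mono_null(1)[OF assms(1,2,3), of a t] that by (simp add: \<mu>_def)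
  qed
  have [simp]: "sets \<mu> = sets borel" by (simp add: \<mu>_def)
  obtain G where G[measurable]: "G \<in> borel_measurable lborel" and dens: "density lborel G = \<mu>"
    using sigma_finite_measure.Radon_Nikodym[OF lborel.sigma_finite_measure_axioms absolutely_continuous_mono_null(2)[OF assms(1,2,3)]] by (auto simp: \<mu>_def)
  have int: "(\<integral>\<^sup>+x. G x * indicator {a..t} x \<partial>lborel) = ennreal (F t - F a)" if "t \<in> {a..b}" for t
    using Icc[OF that] emeasure_density[OF G, of "{a..t}"] by (simp add: dens)
  define g where "g = (\<lambda>x. enn2real (G x))"
  have [measurable]: "g \<in> borel_measurable borel" using G by (simp add: g_def)
  have "AE x in lborel. G x * indicator {a..b} x \<noteq> \<infinity>"
    using int[of b] \<open>a \<le> b\<close> by (intro nn_integral_PInf_AE) auto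
  then have fin: "AE x in lborel. x \<in> {a..b} \<longrightarrow> G x = ennreal (g x)"
    by eventually_elim (auto simp: g_def less_top ennreal_mult_eq_top_iff)
  have "(g has_integral (F t - F a)) {a..t}" if t: "t \<in> {a..b}" for t
  proof -
    have "(\<integral>\<^sup>+x. ennreal (g x * indicator {a..t} x) \<partial>lborel) = (\<integral>\<^sup>+x. G x * indicator {a..t} x \<partial>lborel)"
      using fin t by (intro nn_integral_cong_AE) (auto elim!: eventually_mono simp: indicator_def)
    then have "(\<integral>\<^sup>+x. ennreal (g x * indicator {a..t} x) \<partial>lborel) = ennreal (F t - F a)"
      using int[OF t] by simp
    then have "((\<lambda>x. g x * indicator {a..t} x) has_integral (F t - F a)) UNIV"
      using mono[of a t] t by (intro nn_integral_has_integral) (auto simp: g_def)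
    then have "((\<lambda>x. if x \<in> {a..t} then g x else 0) has_integral (F t - F a)) UNIV"
      by (rule has_integral_eq[rotated]) (auto simp: indicator_def)
    then show ?thesis by (simp only: has_integral_restrict_UNIV)
  qed
  note gi = this
  show thesis
  proof (rule that)
    show "g absolutely_integrable_on {a..b}"
      using gi[of b] \<open>a \<le> b\<close> by (intro nonnegative_absolutely_integrable_1) (auto simp: g_def)
    show "F t = F a + integral {a..t} g" if "t \<in> {a..b}" for t
      using integral_unique[OF gi[OF that]] by simp
  qed
qed

text \<open>The fundamental theorem of calculus for absolutely continuous functions. A component \<open>f \<bullet> i\<close> is the
  difference of its variation \<open>V\<close> and of \<open>V - f \<bullet> i\<close>, and both of these are monotone and absolutely
  continuous.\<close>

lemma absolutely_continuous_imp_indefinite_integral: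
  fixes f :: "real \<Rightarrow> 'b::euclidean_space"
  assumes ac: "absolutely_continuous_on_interval a b f" and "a \<le> b"
  obtains g where "g absolutely_integrable_on {a..b}" "\<And>t. t \<in> {a..b} \<Longrightarrow> f t = f a + integral {a..t} g"
proof -
  have "\<exists>g. g absolutely_integrable_on {a..b} \<and> (\<forall>t\<in>{a..b}. f t \<bullet> i = f a \<bullet> i + integral {a..t} g)"
    if i: "i \<in> Basis" for i
  proof -
    let ?h = "\<lambda>t. f t \<bullet> i"
    have ach: "absolutely_continuous_on_interval a b ?h"
    proof (rule absolutely_continuous_on_interval_dominated[OF ac ac, of 1])
      show "norm (?h y - ?h x) \<le> 1 * (norm (f y - f x) + norm (f y - f x))" for x y
        using Basis_le_norm[OF i, of "f y - f x"] norm_ge_zero[of "f y - f x"]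
        unfolding real_norm_def inner_diff_left mult_1 by linarith
    qed simp
    let ?V = "variation ?h a"
    note V = absolutely_continuous_variation[OF ach \<open>a \<le> b\<close>]
    have Vh: "absolutely_continuous_on_interval a b (\<lambda>t. ?V t - ?h t)"
    proof (rule absolutely_continuous_on_interval_dominated[OF V(1) ach, of 1])
      show "norm (?V y - ?h y - (?V x - ?h x)) \<le> 1 * (norm (?V y - ?V x) + norm (?h y - ?h x))" for x y
        unfolding real_norm_def mult_1 by linarith
    qed simp
    have "?V x \<le> ?V y" if "a \<le> x" "x \<le> y" "y \<le> b" for x y
      using V(2)[OF that] unfolding real_norm_def by linarith
    from absolutely_continuous_mono_density[OF V(1) this \<open>a \<le> b\<close>] obtain g1 where
      g1: "g1 absolutely_integrable_on {a..b}" "\<And>t. t \<in> {a..b} \<Longrightarrow> ?V t = ?V a + integral {a..t} g1" by blast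
    have "?V x - ?h x \<le> ?V y - ?h y" if "a \<le> x" "x \<le> y" "y \<le> b" for x y
      using V(2)[OF that] unfolding real_norm_def by linarith
    from absolutely_continuous_mono_density[OF Vh this \<open>a \<le> b\<close>] obtain g2 where
      g2: "g2 absolutely_integrable_on {a..b}" "\<And>t. t \<in> {a..b} \<Longrightarrow> ?V t - ?h t = ?V a - ?h a + integral {a..t} g2" by blast
    have "?h t = ?h a + integral {a..t} (\<lambda>x. g1 x - g2 x)" if t: "t \<in> {a..b}" for t
    proof -
      have "g1 integrable_on {a..t}" "g2 integrable_on {a..t}"
        using t by (auto intro: absolutely_integrable_integrable_subinterval[OF g1(1)] absolutely_integrable_integrable_subinterval[OF g2(1)])
      then show ?thesis using g1(2)[OF t] g2(2)[OF t] by (simp add: integral_diff)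
    qed
    with set_integral_diff(1)[OF g1(1) g2(1)] show ?thesis by blast
  qed
  then obtain G where G: "\<And>i. i \<in> Basis \<Longrightarrow> G i absolutely_integrable_on {a..b}"
    "\<And>i t. i \<in> Basis \<Longrightarrow> t \<in> {a..b} \<Longrightarrow> f t \<bullet> i = f a \<bullet> i + integral {a..t} (G i)" by metis
  define g where "g = (\<lambda>x. \<Sum>i\<in>Basis. G i x *\<^sub>R i)"
  show thesis
  proof (rule that)
    show "g absolutely_integrable_on {a..b}"
      unfolding g_def by (intro absolutely_integrable_sum absolutely_integrable_scaleR_right G) auto
    show "f t = f a + integral {a..t} g" if t: "t \<in> {a..b}" for t
    proof (rule euclidean_eqI)
      fix i :: 'b assume i: "i \<in> Basis"
      have Gt: "G j integrable_on {a..t}" if "j \<in> Basis" for j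
        using t by (auto intro: absolutely_integrable_integrable_subinterval[OF G(1)[OF that]])
      have "integral {a..t} g = (\<Sum>j\<in>Basis. integral {a..t} (G j) *\<^sub>R j)"
      proof -
        have "((\<lambda>x. G j x *\<^sub>R j) has_integral integral {a..t} (G j) *\<^sub>R j) {a..t}" if "j \<in> Basis" for j
          by (intro has_integral_scaleR_left integrable_integral Gt that)
        then show ?thesis unfolding g_def by (intro integral_unique has_integral_sum) auto
      qed
      then have "integral {a..t} g \<bullet> i = integral {a..t} (G i)"
        using i by simp
      then show "f t \<bullet> i = (f a + integral {a..t} g) \<bullet> i"
        using G(2)[OF i t] by (simp add: inner_add_left)
    qed
  qed
qed

section \<open>Riemann--Stieltjes integrals of continuous functions\<close>

text \<open>All estimates of Stieltjes integrals against \<open>f\<close> are made in terms of such a \<open>V\<close>, so that one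
  \<open>V\<close> can serve all entries of a matrix-valued function.\<close>

definition variation_majorant :: "real \<Rightarrow> real \<Rightarrow> (real \<Rightarrow> real) \<Rightarrow> (real \<Rightarrow> 'b::real_normed_vector) \<Rightarrow> bool" where
  "variation_majorant a b V f \<longleftrightarrow> (\<forall>x y. a \<le> x \<and> x \<le> y \<and> y \<le> b \<longrightarrow> norm (f y - f x) \<le> V y - V x)"

lemma variation_majorantD:
  "variation_majorant a b V f \<Longrightarrow> a \<le> x \<Longrightarrow> x \<le> y \<Longrightarrow> y \<le> b \<Longrightarrow> norm (f y - f x) \<le> V y - V x"
  by (simp add: variation_majorant_def)

lemma variation_majorant_mono:
  "variation_majorant a b V f \<Longrightarrow> a \<le> x \<Longrightarrow> x \<le> y \<Longrightarrow> y \<le> b \<Longrightarrow> V x \<le> V y"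
  using variation_majorantD[of a b V f x y] norm_ge_zero[of "f y - f x"] by linarith

lemma variation_majorant_subinterval:
  "variation_majorant a b V f \<Longrightarrow> a \<le> c \<Longrightarrow> d \<le> b \<Longrightarrow> variation_majorant c d V f"
  by (auto simp: variation_majorant_def)

definition RS_sum :: "(real \<Rightarrow> complex) \<Rightarrow> (real \<Rightarrow> complex) \<Rightarrow> (real \<times> real set) set \<Rightarrow> complex" where
  "RS_sum f g T = (\<Sum>(x, I)\<in>T. f x * (g (Sup I) - g (Inf I)))"

definition mesh_less :: "real \<Rightarrow> (real \<times> real set) set \<Rightarrow> bool" where
  "mesh_less \<delta> T \<longleftrightarrow> (\<forall>(x, I)\<in>T. Sup I - Inf I < \<delta>)"

lemma has_RS_integral_iff:
  "has_RS_integral f g a b J \<longleftrightarrow>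
    (\<forall>\<epsilon>>0. \<exists>\<delta>>0. \<forall>T. T tagged_division_of {a..b} \<and> mesh_less \<delta> T \<longrightarrow> norm (RS_sum f g T - J) < \<epsilon>)"
  by (simp add: has_RS_integral_def RS_sum_def mesh_less_def)

lemma tagged_division_of_Icc:
  assumes "T tagged_division_of {a..b::real}" "(x, I) \<in> T"
  shows "I = {Inf I..Sup I}" "Inf I \<le> x" "x \<le> Sup I" "a \<le> Inf I" "Sup I \<le> b"
    and "Inf I \<in> I" "Sup I \<in> I"
proof -
  obtain c d where cd: "I = {c..d}" using tagged_division_ofD(4)[OF assms] by auto
  have x: "x \<in> I" and sub: "I \<subseteq> {a..b}" using tagged_division_ofD(2,3)[OF assms] by auto
  have "c \<le> x" "x \<le> d" using x cd by auto
  then show "I = {Inf I..Sup I}" "Inf I \<le> x" "x \<le> Sup I" "a \<le> Inf I" "Sup I \<le> b"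
    "Inf I \<in> I" "Sup I \<in> I" using sub cd by auto
qed

lemma tagged_division_mesh_exists:
  assumes "\<delta> > 0" obtains T where "T tagged_division_of {a..b::real}" "mesh_less \<delta> T"
proof -
  have "gauge (\<lambda>x::real. ball x (\<delta>/3))" using assms by (intro gauge_ball) auto
  from fine_division_exists[OF this, of a b] obtain T where
    T: "T tagged_division_of {a..b}" "(\<lambda>x. ball x (\<delta>/3)) fine T" by auto
  have "Sup I - Inf I < \<delta>" if "(x, I) \<in> T" for x I
  proof -
    have sub: "I \<subseteq> ball x (\<delta>/3)" using T(2) that by (auto simp: fine_def)
    note I = tagged_division_of_Icc[OF T(1) that]
    have "dist x (Inf I) < \<delta>/3" "dist x (Sup I) < \<delta>/3" using sub I(6,7) by auto
    then show ?thesis using assms unfolding dist_real_def by linarith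
  qed
  with T(1) show thesis by (intro that) (auto simp: mesh_less_def)
qed

lemma mesh_less_mono: "mesh_less \<delta> T \<Longrightarrow> \<delta> \<le> \<delta>' \<Longrightarrow> mesh_less \<delta>' T"
  by (fastforce simp: mesh_less_def)

text \<open>One fixed sequence of tagged divisions whose mesh tends to \<open>0\<close>. All Riemann--Stieltjes
  integrals are limits of sums along it, and so inherit linearity, bounds and the interchange
  with other integrals from finite sums.\<close>

definition RS_partition :: "real \<Rightarrow> real \<Rightarrow> nat \<Rightarrow> (real \<times> real set) set" where
  "RS_partition a b k = (SOME T. T tagged_division_of {a..b} \<and> mesh_less (1 / real (Suc k)) T)"

lemma RS_partition_fine:
  "RS_partition a b k tagged_division_of {a..b}" "mesh_less (1 / real (Suc k)) (RS_partition a b k)"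
proof -
  have "\<exists>T. T tagged_division_of {a..b} \<and> mesh_less (1 / real (Suc k)) T"
    using tagged_division_mesh_exists[of "1 / real (Suc k)" a b] by (metis of_nat_0_less_iff zero_less_Suc zero_less_divide_1_iff)
  from someI_ex[OF this]
  show "RS_partition a b k tagged_division_of {a..b}" "mesh_less (1 / real (Suc k)) (RS_partition a b k)"
    unfolding RS_partition_def by auto
qed

lemma mesh_less_RS_partition:
  assumes "\<delta> > 0" shows "\<forall>\<^sub>F k in sequentially. mesh_less \<delta> (RS_partition a b k)"
proof -
  obtain n where n: "1 / real (Suc n) < \<delta>" using assms by (metis nat_approx_posE)
  show ?thesis
  proof (intro eventually_sequentiallyI[of n])
    fix k assume "n \<le> k"
    then have "1 / real (Suc k) \<le> 1 / real (Suc n)" by (simp add: frac_le)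
    then show "mesh_less \<delta> (RS_partition a b k)" using n by (intro mesh_less_mono[OF RS_partition_fine(2)]) auto
  qed
qed

lemma RS_sum_tendsto:
  assumes "has_RS_integral f g a b J"
  shows "(\<lambda>k. RS_sum f g (RS_partition a b k)) \<longlonglongrightarrow> J"
  unfolding tendsto_iff dist_norm
proof (intro allI impI)
  fix e :: real assume "0 < e"
  then obtain \<delta> where d: "\<delta> > 0" and *: "\<And>T. T tagged_division_of {a..b} \<and> mesh_less \<delta> T \<longrightarrow> norm (RS_sum f g T - J) < e"
    using assms unfolding has_RS_integral_iff by meson
  show "\<forall>\<^sub>F k in sequentially. norm (RS_sum f g (RS_partition a b k) - J) < e"
    using mesh_less_RS_partition[OF d, of a b] by eventually_elim (use * RS_partition_fine(1) in blast)
qed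

lemma RS_integral_eqI: "has_RS_integral f g a b J \<Longrightarrow> RS_integral a b f g = J"
  unfolding RS_integral_def by (rule the_equality) (auto intro: LIMSEQ_unique RS_sum_tendsto)

lemma RS_sum_bound:
  assumes V: "variation_majorant a b V g" and ab: "a \<le> b" and T: "T tagged_division_of {a..b}"
    and "\<And>x. x \<in> {a..b} \<Longrightarrow> norm (f x) \<le> M"
  shows "norm (RS_sum f g T) \<le> M * (V b - V a)"
proof -
  have "norm (RS_sum f g T) \<le> (\<Sum>(x, I)\<in>T. M * (V (Sup I) - V (Inf I)))"
    unfolding RS_sum_def
  proof (rule sum_norm_le, clarify)
    fix x I assume xI: "(x, I) \<in> T"
    note I = tagged_division_of_Icc[OF T xI]
    have "norm (g (Sup I) - g (Inf I)) \<le> V (Sup I) - V (Inf I)"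
      using variation_majorantD[OF V, of "Inf I" "Sup I"] I(2-5) by linarith
    moreover have "norm (f x) \<le> M" using assms(4)[of x] I(2-5) by auto
    ultimately show "norm (f x * (g (Sup I) - g (Inf I))) \<le> M * (V (Sup I) - V (Inf I))"
      using order_trans[OF norm_ge_zero \<open>norm (f x) \<le> M\<close>] unfolding norm_mult by (intro mult_mono) auto
  qed
  also have "\<dots> = M * (\<Sum>(x, I)\<in>T. V (Sup I) - V (Inf I))"
    by (simp add: sum_distrib_left case_prod_beta)
  also have "\<dots> = M * (V b - V a)" using additive_tagged_division_1[OF ab T, of V] by simp
  finally show ?thesis .
qed

lemma has_RS_integral_Cauchy:
  assumes "\<And>\<epsilon>. \<epsilon> > 0 \<Longrightarrow> \<exists>\<delta>>0. \<exists>J. \<forall>T. T tagged_division_of {a..b} \<and> mesh_less \<delta> T \<longrightarrow> norm (RS_sum f g T - J) < \<epsilon>"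
  obtains J where "has_RS_integral f g a b J"
proof -
  have close: "\<exists>\<delta>>0. \<forall>T T'. T tagged_division_of {a..b} \<and> mesh_less \<delta> T \<and> T' tagged_division_of {a..b} \<and> mesh_less \<delta> T' \<longrightarrow>
      norm (RS_sum f g T - RS_sum f g T') < e" if e: "e > 0" for e
  proof -
    obtain \<delta> J where d: "\<delta> > 0" and *: "\<And>T. T tagged_division_of {a..b} \<and> mesh_less \<delta> T \<longrightarrow> norm (RS_sum f g T - J) < e/2"
      using assms[of "e/2"] e by (auto simp del: split_paired_All)
    have "norm (RS_sum f g T - RS_sum f g T') < e"
      if "T tagged_division_of {a..b}" "mesh_less \<delta> T" "T' tagged_division_of {a..b}" "mesh_less \<delta> T'" for T T'
    proof -
      have "norm (RS_sum f g T - J) < e/2" "norm (RS_sum f g T' - J) < e/2"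
        using *[of T] *[of T'] that by auto
      then show ?thesis by (metis dist_norm dist_triangle_half_l dist_commute)
    qed
    with d show ?thesis by (intro exI[of _ \<delta>]) simp
  qed
  have "Cauchy (\<lambda>k. RS_sum f g (RS_partition a b k))"
  proof (rule metric_CauchyI)
    fix e :: real assume "e > 0"
    then obtain \<delta> where d: "\<delta> > 0" "\<And>T T'. T tagged_division_of {a..b} \<and> mesh_less \<delta> T \<and> T' tagged_division_of {a..b} \<and> mesh_less \<delta> T' \<longrightarrow>
      norm (RS_sum f g T - RS_sum f g T') < e" using close by meson
    obtain n where "\<And>k. k \<ge> n \<Longrightarrow> mesh_less \<delta> (RS_partition a b k)"
      using mesh_less_RS_partition[OF d(1), of a b] unfolding eventually_sequentially by blast
    then show "\<exists>M. \<forall>m\<ge>M. \<forall>n\<ge>M. dist (RS_sum f g (RS_partition a b m)) (RS_sum f g (RS_partition a b n)) < e"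
      using d(2) RS_partition_fine(1) unfolding dist_norm by metis
  qed
  then obtain J where J: "(\<lambda>k. RS_sum f g (RS_partition a b k)) \<longlonglongrightarrow> J"
    using Cauchy_convergent convergentD by blast
  show thesis
  proof (rule that[of J], unfold has_RS_integral_iff, intro allI impI)
    fix e :: real assume e: "e > 0"
    then obtain \<delta> where d: "\<delta> > 0" "\<And>T T'. T tagged_division_of {a..b} \<and> mesh_less \<delta> T \<and> T' tagged_division_of {a..b} \<and> mesh_less \<delta> T' \<longrightarrow>
      norm (RS_sum f g T - RS_sum f g T') < e/2" using close[of "e/2"] by (metis half_gt_zero)
    have "norm (RS_sum f g T - J) < e" if T: "T tagged_division_of {a..b}" "mesh_less \<delta> T" for T
    proof -
      have "norm (RS_sum f g T - J) \<le> e/2"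
      proof (rule tendsto_upperbound)
        show "(\<lambda>k. norm (RS_sum f g T - RS_sum f g (RS_partition a b k))) \<longlonglongrightarrow> norm (RS_sum f g T - J)"
          by (intro tendsto_intros J)
        show "\<forall>\<^sub>F k in sequentially. norm (RS_sum f g T - RS_sum f g (RS_partition a b k)) \<le> e/2"
          using mesh_less_RS_partition[OF d(1), of a b]
          by eventually_elim (use d(2) T RS_partition_fine(1) in \<open>meson less_imp_le\<close>)
      qed simp
      with e show ?thesis by linarith
    qed
    with d(1) show "\<exists>\<delta>>0. \<forall>T. T tagged_division_of {a..b} \<and> mesh_less \<delta> T \<longrightarrow> norm (RS_sum f g T - J) < e"
      by (intro exI[of _ \<delta>]) simp
  qed
qed

text \<open>If \<open>h\<close> is the real or the imaginary part of \<open>g\<close>, then \<open>V + h\<close> and \<open>V\<close> are monotone and their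
  difference is \<open>h\<close>.\<close>

lemma majorant_absolutely_integrable:
  fixes g :: "real \<Rightarrow> complex"
  assumes V: "variation_majorant a b V g"
  shows "g absolutely_integrable_on {a..b}"
proof -
  have mV: "mono_on {a..b} V"
    by (rule mono_onI) (use variation_majorant_mono[OF V] in auto)
  \<comment> \<open>Applied to the real and the imaginary part of \<open>g\<close>.\<close>
  have R: "h absolutely_integrable_on {a..b}" if h: "\<And>x y. norm (h y - h x) \<le> norm (g y - g x)" for h :: "real \<Rightarrow> real"
  proof -
    have "mono_on {a..b} (\<lambda>x. V x + h x)"
    proof (rule mono_onI)
      fix x y assume "x \<in> {a..b}" "y \<in> {a..b}" "x \<le> y"
      then show "V x + h x \<le> V y + h y"
        using variation_majorantD[OF V, of x y] h[of y x] unfolding real_norm_def by auto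
    qed
    from integrable_mono_on[OF this] integrable_mono_on[OF mV]
    have "integrable (lebesgue_on {a..b}) (\<lambda>x. (V x + h x) - V x)" by (rule Bochner_Integration.integrable_diff)
    then show ?thesis by (simp add: integrable_restrict_space set_integrable_def)
  qed
  have "(\<lambda>x. Re (g x)) absolutely_integrable_on {a..b}" "(\<lambda>x. Im (g x)) absolutely_integrable_on {a..b}"
    by (rule R, metis abs_Re_le_cmod minus_complex.simps(1) real_norm_def)
      (rule R, metis abs_Im_le_cmod minus_complex.simps(2) real_norm_def)
  then have "(\<lambda>x. Re (g x) *\<^sub>R 1 + Im (g x) *\<^sub>R \<i>) absolutely_integrable_on {a..b}"
    by (intro set_integral_add absolutely_integrable_scaleR_right)
  then show ?thesis by (simp add: scaleR_conv_of_real mult.commute flip: complex_eq)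
qed

lemma majorant_integrable_mult:
  fixes g f :: "real \<Rightarrow> complex"
  assumes V: "variation_majorant a b V g" and f: "continuous_on {a..b} f"
  shows "(\<lambda>x. f x * g x) absolutely_integrable_on {a..b}"
proof (rule absolutely_integrable_bounded_measurable_product[OF bilinear_times _ _ _ majorant_absolutely_integrable[OF V]])
  show "f \<in> borel_measurable (lebesgue_on {a..b})" using f by (rule continuous_imp_measurable_on_sets_lebesgue) auto
  show "bounded (f ` {a..b})" using f by (intro compact_imp_bounded compact_continuous_image) auto
qed auto

text \<open>On a cell \<open>[c, d]\<close> with tag \<open>x\<close>, the term of the Riemann--Stieltjes sum differs from the contribution
  of the cell to the right-hand side by
  \<open>\<integral>\<^sub>c\<^sup>x f' (g - g c) + \<integral>\<^sub>x\<^sup>d f' (g - g d)\<close>, which is at most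
  \<open>M (d - c) (V d - V c)\<close>. Summation over the cells bounds the error by the mesh times
  \<open>M (V b - V a)\<close>.\<close>

lemma has_RS_integral_by_parts:
  assumes V: "variation_majorant a b V g" and ab: "a \<le> b"
    and f: "\<And>x. x \<in> {a..b} \<Longrightarrow> (f has_vector_derivative f' x) (at x within {a..b})"
    and f': "continuous_on {a..b} f'"
  shows "has_RS_integral f g a b (f b * g b - f a * g a - integral {a..b} (\<lambda>x. f' x * g x))"
proof -
  obtain M where "M > 0" and M': "\<forall>y\<in>f' ` {a..b}. norm y \<le> M"
    using compact_imp_bounded[OF compact_continuous_image[OF f' compact_Icc]] unfolding bounded_pos by blast
  have M: "norm (f' x) \<le> M" if "x \<in> {a..b}" for x using M' that by blast
  have int: "(\<lambda>x. f' x * g x) integrable_on {a..b}"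
    using majorant_integrable_mult[OF V f'] by (rule set_lebesgue_integral_eq_integral(1))
  \<comment> \<open>Half of a cell: here \<open>[c, d]\<close> lies between the tag and an end point \<open>e\<close> of the cell.\<close>
  have half: "norm (integral {c..d} (\<lambda>x. f' x * g x) - g e * (f d - f c)) \<le> M * W * (d - c)"
    if "a \<le> c" "c \<le> d" "d \<le> b" and e: "\<And>x. c \<le> x \<Longrightarrow> x \<le> d \<Longrightarrow> norm (g x - g e) \<le> W" for c d e W
  proof -
    have sub: "{c..d} \<subseteq> {a..b}" using that by auto
    have "(f' has_integral (f d - f c)) {c..d}"
      using that by (intro fundamental_theorem_of_calculus has_vector_derivative_within_subset[OF f sub]) auto
    then have "((\<lambda>x. f' x * g x - g e * f' x) has_integral integral {c..d} (\<lambda>x. f' x * g x) - g e * (f d - f c)) {c..d}"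
      by (intro has_integral_diff has_integral_mult_right integrable_integral integrable_subinterval_real[OF int sub])
    note hi = this
    show ?thesis
    proof (rule order_trans[OF has_integral_bound_real[OF _ _ hi]])
      show "norm (f' x * g x - g e * f' x) \<le> M * W" if "x \<in> {c..d} - {}" for x
      proof -
        have "norm (f' x * g x - g e * f' x) = norm (f' x) * norm (g x - g e)"
          by (simp add: norm_mult[symmetric] algebra_simps)
        also have "\<dots> \<le> M * W" using M[of x] e[of x] that sub \<open>M > 0\<close> by (intro mult_mono) auto
        finally show ?thesis .
      qed
      show "0 \<le> M * W" using \<open>M > 0\<close> order_trans[OF norm_ge_zero e[of c]] that by auto
    qed (use that in auto)
  qed
  have cell: "norm (f x * (g d - g c) - ((f d * g d - f c * g c) - integral {c..d} (\<lambda>x. f' x * g x))) \<le> M * (d - c) * (V d - V c)"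
    if "a \<le> c" "c \<le> x" "x \<le> d" "d \<le> b" for x c d
  proof -
    have "norm (integral {c..x} (\<lambda>x. f' x * g x) - g c * (f x - f c)) \<le> M * (V d - V c) * (x - c)"
    proof (rule half)
      fix y assume "c \<le> y" "y \<le> x"
      then show "norm (g y - g c) \<le> V d - V c"
        using variation_majorantD[OF V, of c y] variation_majorant_mono[OF V, of y d] that by linarith
    qed (use that in auto)
    moreover have "norm (integral {x..d} (\<lambda>x. f' x * g x) - g d * (f d - f x)) \<le> M * (V d - V c) * (d - x)"
    proof (rule half)
      fix y assume "x \<le> y" "y \<le> d"
      then show "norm (g y - g d) \<le> V d - V c"
        using variation_majorantD[OF V, of y d] variation_majorant_mono[OF V, of c y] that by (simp add: norm_minus_commute)
    qed (use that in auto)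
    moreover have "integral {c..x} (\<lambda>x. f' x * g x) + integral {x..d} (\<lambda>x. f' x * g x) = integral {c..d} (\<lambda>x. f' x * g x)"
      using that by (intro HK_integral_combine integrable_subinterval_real[OF int]) auto
    moreover have "f x * (g d - g c) - ((f d * g d - f c * g c) - (I1 + I2)) = (I1 - g c * (f x - f c)) + (I2 - g d * (f d - f x))" for I1 I2
      by (simp add: algebra_simps)
    moreover have "M * (V d - V c) * (x - c) + M * (V d - V c) * (d - x) = M * (d - c) * (V d - V c)"
      by (simp add: algebra_simps)
    ultimately show ?thesis using norm_triangle_ineq by (smt (verit))
  qed
  show ?thesis unfolding has_RS_integral_iff
  proof (intro allI impI)
    fix \<epsilon> :: real assume e: "\<epsilon> > 0"
    define \<delta> where "\<delta> = \<epsilon> / (M * (V b - V a) + 1)"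
    have Vab: "V a \<le> V b" using variation_majorant_mono[OF V] ab by auto
    have d: "\<delta> > 0" using e Vab \<open>M > 0\<close> by (simp add: \<delta>_def add_nonneg_pos)
    have "norm (RS_sum f g T - (f b * g b - f a * g a - integral {a..b} (\<lambda>x. f' x * g x))) < \<epsilon>"
      if T: "T tagged_division_of {a..b}" "mesh_less \<delta> T" for T
    proof -
      have "f b * g b - f a * g a = (\<Sum>(x, I)\<in>T. f (Sup I) * g (Sup I) - f (Inf I) * g (Inf I))"
        using additive_tagged_division_1[OF ab T(1), of "\<lambda>x. f x * g x"] by simp
      moreover have "integral {a..b} (\<lambda>x. f' x * g x) = (\<Sum>(x, I)\<in>T. integral I (\<lambda>x. f' x * g x))"
        using integral_combine_tagged_division_topdown[of "\<lambda>x. f' x * g x" a b T] int T(1) by simp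
      ultimately have "RS_sum f g T - (f b * g b - f a * g a - integral {a..b} (\<lambda>x. f' x * g x)) =
          (\<Sum>(x, I)\<in>T. f x * (g (Sup I) - g (Inf I)) - ((f (Sup I) * g (Sup I) - f (Inf I) * g (Inf I)) - integral I (\<lambda>x. f' x * g x)))"
        unfolding RS_sum_def by (simp add: case_prod_beta sum_subtractf)
      also have "norm \<dots> \<le> (\<Sum>(x, I)\<in>T. M * \<delta> * (V (Sup I) - V (Inf I)))"
      proof (rule sum_norm_le, clarify)
        fix x I assume xI: "(x, I) \<in> T"
        note I = tagged_division_of_Icc[OF T(1) xI]
        have "norm (f x * (g (Sup I) - g (Inf I)) - ((f (Sup I) * g (Sup I) - f (Inf I) * g (Inf I)) - integral {Inf I..Sup I} (\<lambda>x. f' x * g x)))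
            \<le> M * (Sup I - Inf I) * (V (Sup I) - V (Inf I))"
          using I(2-5) by (intro cell)
        also have "\<dots> \<le> M * \<delta> * (V (Sup I) - V (Inf I))"
          using T(2) xI \<open>M > 0\<close> variation_majorant_mono[OF V, of "Inf I" "Sup I"] I(2-5)
          by (intro mult_right_mono mult_left_mono) (auto simp: mesh_less_def intro: less_imp_le)
        finally show "norm (f x * (g (Sup I) - g (Inf I)) - ((f (Sup I) * g (Sup I) - f (Inf I) * g (Inf I)) - integral I (\<lambda>x. f' x * g x)))
            \<le> M * \<delta> * (V (Sup I) - V (Inf I))"
          unfolding I(1)[symmetric] .
      qed
      also have "\<dots> = M * \<delta> * (\<Sum>(x, I)\<in>T. V (Sup I) - V (Inf I))"
        by (simp add: sum_distrib_left case_prod_beta)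
      also have "\<dots> = \<delta> * (M * (V b - V a))" using additive_tagged_division_1[OF ab T(1), of V] by simp
      also have "\<dots> < \<delta> * (M * (V b - V a) + 1)" using d by simp
      also have "\<dots> = \<epsilon>" using Vab \<open>M > 0\<close> unfolding \<delta>_def by (simp add: add_nonneg_pos less_imp_neq[symmetric] add_nonneg_eq_0_iff)
      finally show ?thesis .
    qed
    with d show "\<exists>\<delta>>0. \<forall>T. T tagged_division_of {a..b} \<and> mesh_less \<delta> T \<longrightarrow>
        norm (RS_sum f g T - (f b * g b - f a * g a - integral {a..b} (\<lambda>x. f' x * g x))) < \<epsilon>"
      by (intro exI[of _ \<delta>]) simp
  qed
qed

lemma RS_sum_diff: "RS_sum (\<lambda>x. f x - h x) g T = RS_sum f g T - RS_sum h g T"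
  by (simp add: RS_sum_def case_prod_beta sum_subtractf left_diff_distrib)

lemma RS_sum_cmult: "RS_sum (\<lambda>x. c * f x) g T = c * RS_sum f g T"
  by (simp add: RS_sum_def case_prod_beta sum_distrib_left mult.assoc)

text \<open>Integration by parts settles the case of polynomials. By the Weierstrass theorem, \<open>f\<close> is uniformly
  close to a polynomial, and replacing it by the polynomial changes all sums by at most the distance times
  \<open>V b - V a\<close>.\<close>

lemma has_RS_integral_continuous:
  assumes V: "variation_majorant a b V g" and ab: "a \<le> b" and f: "continuous_on {a..b} f"
  shows "has_RS_integral f g a b (RS_integral a b f g)"
proof -
  have Vab: "V a \<le> V b" using variation_majorant_mono[OF V] ab by auto
  have "\<exists>\<delta>>0. \<exists>J. \<forall>T. T tagged_division_of {a..b} \<and> mesh_less \<delta> T \<longrightarrow> norm (RS_sum f g T - J) < \<epsilon>"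
    if e: "\<epsilon> > 0" for \<epsilon>
  proof -
    define e' where "e' = \<epsilon> / 2 / (V b - V a + 1)"
    have e': "e' > 0" using e Vab by (simp add: e'_def)
    obtain p where p: "polynomial_function p" and fp: "\<forall>x\<in>{a..b}. norm (f x - p x) < e'"
      using Stone_Weierstrass_polynomial_function[OF compact_Icc f e'] by blast
    obtain p' where p': "polynomial_function p'" "\<And>x. (p has_vector_derivative p' x) (at x)"
      by (rule has_vector_derivative_polynomial_function[OF p]) blast
    define J where "J = p b * g b - p a * g a - integral {a..b} (\<lambda>x. p' x * g x)"
    have hJ: "has_RS_integral p g a b J" unfolding J_def
      by (rule has_RS_integral_by_parts[OF V ab has_vector_derivative_at_within[OF p'(2)]
            continuous_on_polymonial_function[OF p'(1)]])
    have "0 < \<epsilon>/2" using e by simp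
    from mp[OF spec[OF hJ[unfolded has_RS_integral_iff], where x = "\<epsilon>/2"] this]
    obtain \<delta> where d: "\<delta> > 0" and
      J: "\<forall>T. T tagged_division_of {a..b} \<and> mesh_less \<delta> T \<longrightarrow> norm (RS_sum p g T - J) < \<epsilon>/2"
      by (elim exE conjE)
    have "norm (RS_sum f g T - J) < \<epsilon>" if T: "T tagged_division_of {a..b}" "mesh_less \<delta> T" for T
    proof -
      have "norm (RS_sum (\<lambda>x. f x - p x) g T) \<le> e' * (V b - V a)"
        using fp by (intro RS_sum_bound[OF V ab T(1)]) (auto intro: less_imp_le)
      also have "\<dots> \<le> e' * (V b - V a + 1)" using e' by simp
      also have "\<dots> = \<epsilon>/2" unfolding e'_def using Vab by (intro nonzero_eq_divide_eq[THEN iffD1, OF _ refl]) simp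
      finally have "norm (RS_sum f g T - RS_sum p g T) \<le> \<epsilon>/2" by (simp add: RS_sum_diff)
      moreover have "norm (RS_sum p g T - J) < \<epsilon>/2" using J T by simp
      ultimately show ?thesis
        using norm_triangle_ineq[of "RS_sum f g T - RS_sum p g T" "RS_sum p g T - J"] by simp
    qed
    with d show ?thesis by (intro exI[of _ \<delta>] exI[of _ J] conjI allI impI) auto
  qed
  then obtain J where "has_RS_integral f g a b J" by (rule has_RS_integral_Cauchy)
  then show ?thesis using RS_integral_eqI by metis
qed

context
  fixes a b :: real and V and g :: "real \<Rightarrow> complex"
  assumes V: "variation_majorant a b V g" and ab: "a \<le> b"
begin

lemma RS_sum_tendsto_RS_integral:
  "continuous_on {a..b} f \<Longrightarrow> (\<lambda>k. RS_sum f g (RS_partition a b k)) \<longlonglongrightarrow> RS_integral a b f g"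
  by (intro RS_sum_tendsto has_RS_integral_continuous[OF V ab])

lemma RS_integral_diff:
  assumes "continuous_on {a..b} f" "continuous_on {a..b} h"
  shows "RS_integral a b (\<lambda>x. f x - h x) g = RS_integral a b f g - RS_integral a b h g"
  by (rule LIMSEQ_unique[OF RS_sum_tendsto_RS_integral[OF continuous_on_diff[OF assms]]])
    (unfold RS_sum_diff, intro tendsto_diff RS_sum_tendsto_RS_integral assms)

lemma RS_integral_cmult:
  assumes "continuous_on {a..b} f"
  shows "RS_integral a b (\<lambda>x. c * f x) g = c * RS_integral a b f g"
  by (rule LIMSEQ_unique[OF RS_sum_tendsto_RS_integral[OF continuous_on_mult_left[OF assms]]])
    (unfold RS_sum_cmult, intro tendsto_mult tendsto_const RS_sum_tendsto_RS_integral assms)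

lemma RS_integral_bound:
  assumes "continuous_on {a..b} f" "\<And>x. x \<in> {a..b} \<Longrightarrow> norm (f x) \<le> M"
  shows "norm (RS_integral a b f g) \<le> M * (V b - V a)"
  by (rule LIMSEQ_le_const2[OF tendsto_norm[OF RS_sum_tendsto_RS_integral[OF assms(1)]]])
    (intro exI[of _ 0] allI impI RS_sum_bound[OF V ab RS_partition_fine(1)] assms(2))

lemma RS_integral_by_parts:
  assumes "\<And>x. x \<in> {a..b} \<Longrightarrow> (f has_vector_derivative f' x) (at x within {a..b})" "continuous_on {a..b} f'"
  shows "RS_integral a b f g = f b * g b - f a * g a - integral {a..b} (\<lambda>x. f' x * g x)"
  by (rule RS_integral_eqI[OF has_RS_integral_by_parts[OF V ab assms]])

lemma RS_integral_const: "RS_integral a b (\<lambda>_. c) g = c * (g b - g a)"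
  using RS_integral_by_parts[of "\<lambda>_. c" "\<lambda>_. 0"] by (simp add: algebra_simps)

lemma continuous_on_RS_integral:
  assumes k: "continuous_on UNIV (\<lambda>(\<theta>, s). k \<theta> s)"
  shows "continuous_on {c..d} (\<lambda>s::real. RS_integral a b (\<lambda>\<theta>. k \<theta> s) g)"
  unfolding continuous_on_iff
proof (intro ballI allI impI)
  fix s e :: real assume s: "s \<in> {c..d}" and e: "e > 0"
  have Vab: "V a \<le> V b" using variation_majorant_mono[OF V] ab by auto
  define e' where "e' = e / (V b - V a + 1)"
  have e': "e' > 0" using e Vab by (simp add: e'_def)
  have kc: "continuous_on {a..b} (\<lambda>\<theta>. k \<theta> s)" for s
    using continuous_on_compose2[OF k continuous_on_Pair[OF continuous_on_id continuous_on_const]] by auto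
  have "uniformly_continuous_on ({a..b} \<times> {c..d}) (\<lambda>(\<theta>, s). k \<theta> s)"
    by (intro compact_uniformly_continuous compact_Times compact_Icc continuous_on_subset[OF k]) auto
  then obtain \<delta> where d: "\<delta> > 0" and *: "\<And>x x'. x \<in> {a..b} \<times> {c..d} \<Longrightarrow> x' \<in> {a..b} \<times> {c..d} \<Longrightarrow>
      dist x' x < \<delta> \<Longrightarrow> dist ((\<lambda>(\<theta>, s). k \<theta> s) x') ((\<lambda>(\<theta>, s). k \<theta> s) x) < e'"
    unfolding uniformly_continuous_on_def using e' by meson
  have "dist (RS_integral a b (\<lambda>\<theta>. k \<theta> s') g) (RS_integral a b (\<lambda>\<theta>. k \<theta> s) g) < e"
    if s': "s' \<in> {c..d}" "dist s' s < \<delta>" for s'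
  proof -
    have "norm (RS_integral a b (\<lambda>\<theta>. k \<theta> s' - k \<theta> s) g) \<le> e' * (V b - V a)"
    proof (intro RS_integral_bound continuous_on_diff kc)
      fix \<theta> assume "\<theta> \<in> {a..b}"
      then show "norm (k \<theta> s' - k \<theta> s) \<le> e'"
        using *[of "(\<theta>, s)" "(\<theta>, s')"] s s' by (auto simp: dist_norm dist_Pair_Pair dist_prod_def)
    qed
    also have "\<dots> < e' * (V b - V a + 1)" using e' by simp
    also have "\<dots> = e" using Vab by (simp add: e'_def)
    finally show ?thesis by (simp add: RS_integral_diff kc dist_norm)
  qed
  with d show "\<exists>d'>0. \<forall>x'\<in>{c..d}. dist x' s < d' \<longrightarrow>
      dist (RS_integral a b (\<lambda>\<theta>. k \<theta> x') g) (RS_integral a b (\<lambda>\<theta>. k \<theta> s) g) < e" by blast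
qed

text \<open>Fubini's theorem for a Stieltjes and a Lebesgue integral, together with the resulting bound in the
  mean. Both are evident for Riemann--Stieltjes sums and pass to the limit by dominated convergence.\<close>

lemma RS_integral_of_integral:
  assumes k: "continuous_on UNIV (\<lambda>(\<theta>, s). k \<theta> s)"
  shows "RS_integral a b (\<lambda>\<theta>. integral {c..d} (k \<theta>)) g = integral {c..d} (\<lambda>s::real. RS_integral a b (\<lambda>\<theta>. k \<theta> s) g)"
    and "(\<And>\<theta>. \<theta> \<in> {a..b} \<Longrightarrow> integral {c..d} (\<lambda>s. norm (k \<theta> s)) \<le> M) \<Longrightarrow>
      integral {c..d} (\<lambda>s. norm (RS_integral a b (\<lambda>\<theta>. k \<theta> s) g)) \<le> M * (V b - V a)"
proof -
  have k1: "continuous_on S (\<lambda>\<theta>. k \<theta> s)" for s S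
    using continuous_on_compose2[OF k continuous_on_Pair[OF continuous_on_id continuous_on_const]] by auto
  have k2: "continuous_on S (k \<theta>)" for \<theta> S
    using continuous_on_compose2[OF k continuous_on_Pair[OF continuous_on_const continuous_on_id]] by auto
  obtain C where C: "\<forall>y\<in>(\<lambda>(\<theta>, s). k \<theta> s) ` ({a..b} \<times> {c..d}). norm y \<le> C"
    using compact_imp_bounded[OF compact_continuous_image[OF continuous_on_subset[OF k] compact_Times[OF compact_Icc compact_Icc]], of a b c d]
    unfolding bounded_iff by blast
  let ?T = "RS_partition a b"
  have S_le: "norm (RS_sum (\<lambda>\<theta>. k \<theta> s) g (?T n)) \<le> C * (V b - V a)" if "s \<in> {c..d}" for s n
    by (rule RS_sum_bound[OF V ab RS_partition_fine(1)]) (use C that in force)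
  have S_lim: "(\<lambda>n. RS_sum (\<lambda>\<theta>. k \<theta> s) g (?T n)) \<longlonglongrightarrow> RS_integral a b (\<lambda>\<theta>. k \<theta> s) g" for s
    by (intro RS_sum_tendsto_RS_integral k1)
  have S_int: "((\<lambda>s. RS_sum (\<lambda>\<theta>. k \<theta> s) g T) has_integral RS_sum (\<lambda>\<theta>. integral {c..d} (k \<theta>)) g T) {c..d}"
    if "finite T" for T
    unfolding RS_sum_def case_prod_beta
    by (intro has_integral_sum that has_integral_mult_left integrable_integral integrable_continuous_real k2)
  have fin: "finite (?T n)" for n using RS_partition_fine(1) by blast
  show "RS_integral a b (\<lambda>\<theta>. integral {c..d} (k \<theta>)) g = integral {c..d} (\<lambda>s. RS_integral a b (\<lambda>\<theta>. k \<theta> s) g)"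
  proof (rule LIMSEQ_unique)
    have "continuous_on {a..b} (\<lambda>\<theta>. integral (cbox c d) (k \<theta>))"
      by (intro integral_continuous_on_param continuous_on_subset[OF k]) auto
    then show "(\<lambda>n. RS_sum (\<lambda>\<theta>. integral {c..d} (k \<theta>)) g (?T n)) \<longlonglongrightarrow> RS_integral a b (\<lambda>\<theta>. integral {c..d} (k \<theta>)) g"
      by (intro RS_sum_tendsto_RS_integral) simp
    have "(\<lambda>n. integral {c..d} (\<lambda>s. RS_sum (\<lambda>\<theta>. k \<theta> s) g (?T n))) \<longlonglongrightarrow> integral {c..d} (\<lambda>s. RS_integral a b (\<lambda>\<theta>. k \<theta> s) g)"
      by (rule dominated_convergence(2)[where h = "\<lambda>_. C * (V b - V a)"])
        (use S_int[OF fin] S_le S_lim in \<open>auto simp: integrable_on_def\<close>)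
    then show "(\<lambda>n. RS_sum (\<lambda>\<theta>. integral {c..d} (k \<theta>)) g (?T n)) \<longlonglongrightarrow> integral {c..d} (\<lambda>s. RS_integral a b (\<lambda>\<theta>. k \<theta> s) g)"
      by (simp only: integral_unique[OF S_int[OF fin]])
  qed
  assume M: "\<And>\<theta>. \<theta> \<in> {a..b} \<Longrightarrow> integral {c..d} (\<lambda>s. norm (k \<theta> s)) \<le> M"
  have S_cont: "continuous_on {c..d} (\<lambda>s. RS_sum (\<lambda>\<theta>. k \<theta> s) g T)" for T
    unfolding RS_sum_def case_prod_beta by (intro continuous_intros k2)
  have "(\<lambda>n. integral {c..d} (\<lambda>s. norm (RS_sum (\<lambda>\<theta>. k \<theta> s) g (?T n)))) \<longlonglongrightarrow> integral {c..d} (\<lambda>s. norm (RS_integral a b (\<lambda>\<theta>. k \<theta> s) g))"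
    by (rule dominated_convergence(2)[where h = "\<lambda>_. C * (V b - V a)"])
      (auto intro!: integrable_continuous_real continuous_on_norm S_cont S_le tendsto_norm S_lim)
  moreover have "integral {c..d} (\<lambda>s. norm (RS_sum (\<lambda>\<theta>. k \<theta> s) g (?T n))) \<le> M * (V b - V a)" for n
  proof -
    have "integral {c..d} (\<lambda>s. norm (RS_sum (\<lambda>\<theta>. k \<theta> s) g (?T n))) \<le>
        integral {c..d} (\<lambda>s. \<Sum>(x, I)\<in>?T n. norm (k x s) * (V (Sup I) - V (Inf I)))"
    proof (rule integral_le)
      show "(\<lambda>s. norm (RS_sum (\<lambda>\<theta>. k \<theta> s) g (?T n))) integrable_on {c..d}"
        by (intro integrable_continuous_real continuous_on_norm S_cont)
      show "(\<lambda>s. \<Sum>(x, I)\<in>?T n. norm (k x s) * (V (Sup I) - V (Inf I))) integrable_on {c..d}"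
        unfolding case_prod_beta by (intro integrable_continuous_real continuous_intros k2)
      show "norm (RS_sum (\<lambda>\<theta>. k \<theta> s) g (?T n)) \<le> (\<Sum>(x, I)\<in>?T n. norm (k x s) * (V (Sup I) - V (Inf I)))" for s
        unfolding RS_sum_def
      proof (rule sum_norm_le, clarify)
        fix x I assume "(x, I) \<in> ?T n"
        note I = tagged_division_of_Icc[OF RS_partition_fine(1) this]
        show "norm (k x s * (g (Sup I) - g (Inf I))) \<le> norm (k x s) * (V (Sup I) - V (Inf I))"
          unfolding norm_mult using I(2-5) by (intro mult_left_mono variation_majorantD[OF V]) auto
      qed
    qed
    also have "\<dots> = (\<Sum>(x, I)\<in>?T n. integral {c..d} (\<lambda>s. norm (k x s)) * (V (Sup I) - V (Inf I)))"
      unfolding case_prod_beta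
      by (intro integral_unique has_integral_sum fin has_integral_mult_left integrable_integral integrable_continuous_real continuous_on_norm k2)
    also have "\<dots> \<le> (\<Sum>(x, I)\<in>?T n. M * (V (Sup I) - V (Inf I)))"
    proof (intro sum_mono, clarify)
      fix x I assume "(x, I) \<in> ?T n"
      note I = tagged_division_of_Icc[OF RS_partition_fine(1) this]
      have "V (Inf I) \<le> V (Sup I)" using variation_majorant_mono[OF V, of "Inf I" "Sup I"] I(2-5) by auto
      then show "integral {c..d} (\<lambda>s. norm (k x s)) * (V (Sup I) - V (Inf I)) \<le> M * (V (Sup I) - V (Inf I))"
        using M[of x] I(2-5) by (intro mult_right_mono) auto
    qed
    also have "\<dots> = M * (\<Sum>(x, I)\<in>?T n. V (Sup I) - V (Inf I))"
      by (simp add: sum_distrib_left case_prod_beta)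
    also have "\<dots> = M * (V b - V a)" using additive_tagged_division_1[OF ab RS_partition_fine(1), of V] by simp
    finally show ?thesis .
  qed
  ultimately show "integral {c..d} (\<lambda>s. norm (RS_integral a b (\<lambda>\<theta>. k \<theta> s) g)) \<le> M * (V b - V a)"
    by (intro LIMSEQ_le_const2) auto
qed

end

text \<open>For polynomials this is the additivity of the formula for integration by parts; uniform
  approximation extends it to continuous functions.\<close>

lemma RS_integral_combine:
  fixes g :: "real \<Rightarrow> complex"
  assumes V: "variation_majorant a b V g" and c: "a \<le> c" "c \<le> b" and f: "continuous_on {a..b} f"
  shows "RS_integral a b f g = RS_integral a c f g + RS_integral c b f g"
proof -
  have ab: "a \<le> b" using c by simp
  have Vac: "variation_majorant a c V g" and Vcb: "variation_majorant c b V g"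
    using variation_majorant_subinterval[OF V] c by auto
  have Vm: "V a \<le> V c" "V c \<le> V b" using variation_majorant_mono[OF V] c by auto
  let ?d = "RS_integral a b f g - (RS_integral a c f g + RS_integral c b f g)"
  have "norm ?d \<le> e" if e: "e > 0" for e
  proof -
    define e' where "e' = e / (2 * (V b - V a) + 1)"
    have e': "e' > 0" using e Vm by (simp add: e'_def)
    obtain p where p: "polynomial_function p" and fp: "\<forall>x\<in>{a..b}. norm (f x - p x) < e'"
      using Stone_Weierstrass_polynomial_function[OF compact_Icc f e'] by blast
    obtain p' where p': "polynomial_function p'" "\<And>x. (p has_vector_derivative p' x) (at x)"
      by (rule has_vector_derivative_polynomial_function[OF p]) blast
    have pc: "continuous_on S p" "continuous_on S p'" for S
      using p p'(1) by (auto intro: continuous_on_polymonial_function)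
    have parts: "RS_integral x y p g = p y * g y - p x * g x - integral {x..y} (\<lambda>x. p' x * g x)"
      if "variation_majorant x y V g" "x \<le> y" for x y
      by (rule RS_integral_by_parts[OF that has_vector_derivative_at_within[OF p'(2)] pc(2)])
    have "(\<lambda>x. p' x * g x) integrable_on {a..b}"
      using majorant_integrable_mult[OF V pc(2)] by (rule set_lebesgue_integral_eq_integral(1))
    then have comb: "integral {a..c} (\<lambda>x. p' x * g x) + integral {c..b} (\<lambda>x. p' x * g x) = integral {a..b} (\<lambda>x. p' x * g x)"
      using c by (intro HK_integral_combine) auto
    then have pp: "RS_integral a b p g = RS_integral a c p g + RS_integral c b p g"
      unfolding parts[OF V ab] parts[OF Vac c(1)] parts[OF Vcb c(2)] comb[symmetric] by simp
    have diff: "norm (RS_integral x y f g - RS_integral x y p g) \<le> e' * (V y - V x)"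
      if "variation_majorant x y V g" "x \<le> y" "a \<le> x" "y \<le> b" for x y
    proof -
      have fc: "continuous_on {x..y} f" using that by (intro continuous_on_subset[OF f]) auto
      have "norm (RS_integral x y (\<lambda>s. f s - p s) g) \<le> e' * (V y - V x)"
        using that fp by (intro RS_integral_bound[OF that(1,2)] continuous_on_diff fc pc) (auto intro: less_imp_le)
      then show ?thesis by (simp add: RS_integral_diff[OF that(1,2) fc pc(1)])
    qed
    have "norm ?d = norm ((RS_integral a b f g - RS_integral a b p g) - ((RS_integral a c f g - RS_integral a c p g) + (RS_integral c b f g - RS_integral c b p g)))"
      unfolding pp by (rule arg_cong[of _ _ norm]) simp
    also have "\<dots> \<le> norm (RS_integral a b f g - RS_integral a b p g) + (norm (RS_integral a c f g - RS_integral a c p g) + norm (RS_integral c b f g - RS_integral c b p g))"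
      by (intro order_trans[OF norm_triangle_ineq4] add_left_mono norm_triangle_ineq)
    also have "\<dots> \<le> e' * (V b - V a) + (e' * (V c - V a) + e' * (V b - V c))"
      using diff[OF V ab] diff[OF Vac c(1)] diff[OF Vcb c(2)] c by (intro add_mono) auto
    also have "\<dots> = e' * (2 * (V b - V a))" by (simp add: algebra_simps)
    also have "\<dots> \<le> e' * (2 * (V b - V a) + 1)" using e' by simp
    also have "\<dots> = e" using Vm by (simp add: e'_def)
    finally show ?thesis .
  qed
  note small = this
  have "norm ?d \<le> 0"
  proof (rule field_le_epsilon)
    fix e :: real assume "0 < e"
    from small[OF this] show "norm ?d \<le> 0 + e" by (simp only: add_0)
  qed
  then show ?thesis by simp
qed

lemma RS_integral_cong:
  assumes "\<And>x. x \<in> {a..b} \<Longrightarrow> f x = h x"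
  shows "RS_integral a b f g = RS_integral a b h g"
proof -
  have "RS_sum f g T = RS_sum h g T" if T: "T tagged_division_of {a..b}" for T
    unfolding RS_sum_def
  proof (rule sum.cong, simp, clarify)
    fix x I assume "(x, I) \<in> T"
    then have "x \<in> {a..b}" using tagged_division_ofD(2,3)[OF T] by blast
    then show "f x * (g (Sup I) - g (Inf I)) = h x * (g (Sup I) - g (Inf I))" using assms by simp
  qed
  then have "has_RS_integral f g a b J = has_RS_integral h g a b J" for J
    unfolding has_RS_integral_iff by (intro all_cong1 ex_cong1 imp_cong conj_cong refl) auto
  then have "has_RS_integral f g a b = has_RS_integral h g a b" by (rule ext)
  then show ?thesis unfolding RS_integral_def by simp
qed

section \<open>The bilinear form along translates of continuous functions\<close>

text \<open>Replacing \<open>m \<theta> \<xi>\<close> by \<open>m \<theta> (max \<theta> \<xi>)\<close> makes the domain of integration independent of \<open>\<theta>\<close>, at the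
  cost of an explicit term.\<close>

lemma continuous_on_integral_lower_limit:
  fixes m :: "real \<Rightarrow> real \<Rightarrow> complex"
  assumes m: "continuous_on UNIV (\<lambda>(\<theta>, \<xi>). m \<theta> \<xi>)"
  shows "continuous_on {a..b} (\<lambda>\<theta>. integral {\<theta>..b} (m \<theta>))"
proof -
  have mc: "continuous_on S (\<lambda>x. m (f x) (h x))" if "continuous_on S f" "continuous_on S h" for S :: "'z::topological_space set" and f h
    using continuous_on_compose2[OF m continuous_on_Pair[OF that]] by simp
  have "continuous_on {a..b} (\<lambda>\<theta>. integral (cbox a b) (\<lambda>\<xi>. m \<theta> (max \<theta> \<xi>)) - (\<theta> - a) *\<^sub>R m \<theta> \<theta>)"
    by (intro continuous_on_diff continuous_on_scaleR integral_continuous_on_param)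
      (unfold case_prod_beta, (intro mc continuous_intros)+)
  moreover have "integral (cbox a b) (\<lambda>\<xi>. m \<theta> (max \<theta> \<xi>)) - (\<theta> - a) *\<^sub>R m \<theta> \<theta> = integral {\<theta>..b} (m \<theta>)"
    if \<theta>: "\<theta> \<in> {a..b}" for \<theta>
  proof -
    have "integral {a..\<theta>} (\<lambda>\<xi>. m \<theta> (max \<theta> \<xi>)) + integral {\<theta>..b} (\<lambda>\<xi>. m \<theta> (max \<theta> \<xi>)) = integral {a..b} (\<lambda>\<xi>. m \<theta> (max \<theta> \<xi>))"
      using \<theta> by (intro HK_integral_combine integrable_continuous_real mc continuous_intros) auto
    moreover have "integral {a..\<theta>} (\<lambda>\<xi>. m \<theta> (max \<theta> \<xi>)) = integral {a..\<theta>} (\<lambda>\<xi>. m \<theta> \<theta>)"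
      by (rule integral_cong) (auto simp: max_def)
    moreover have "integral {\<theta>..b} (\<lambda>\<xi>. m \<theta> (max \<theta> \<xi>)) = integral {\<theta>..b} (m \<theta>)"
      by (rule integral_cong) (auto simp: max_def)
    ultimately show ?thesis using \<theta> by (simp add: algebra_simps)
  qed
  ultimately show ?thesis by (subst continuous_on_cong[OF refl, symmetric]) auto
qed

text \<open>The interchange of integrations over the triangle \<open>\<theta> \<le> \<xi>\<close>, which reduces to rectangles: continue
  \<open>\<psi>\<close> by the constant \<open>\<psi> 0\<close> to negative arguments. Then the inner integral is one over all of
  \<open>[a, b]\<close>, minus \<open>\<psi> 0 (g b - g \<xi>)\<close>. The first part is covered by the interchange over a rectangle,
  the second one by integration by parts with a primitive \<open>\<Phi>\<close> of \<open>\<phi>\<close>.\<close>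

lemma RS_integral_truncated_kernel:
  fixes \<psi> \<phi> g :: "real \<Rightarrow> complex"
  assumes V: "variation_majorant a b V g" and ab: "a \<le> b"
    and \<psi>: "continuous_on UNIV \<psi>" and \<phi>: "continuous_on UNIV \<phi>"
  shows "((\<lambda>\<xi>. RS_integral a \<xi> (\<lambda>\<theta>. \<psi> (\<xi> - \<theta>)) g * \<phi> \<xi>) has_integral
      RS_integral a b (\<lambda>\<theta>. integral {\<theta>..b} (\<lambda>\<xi>. \<psi> (\<xi> - \<theta>) * \<phi> \<xi>)) g) {a..b}"
proof -
  define \<psi>' where "\<psi>' = (\<lambda>x. \<psi> (max 0 x))"
  have \<psi>'c: "continuous_on S \<psi>'" for S
    unfolding \<psi>'_def by (rule continuous_on_compose2[OF \<psi>]) (auto intro!: continuous_intros)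
  have \<phi>c: "continuous_on S \<phi>" for S using \<phi> by (rule continuous_on_subset) simp
  define k where "k = (\<lambda>\<theta> \<xi>. \<psi>' (\<xi> - \<theta>) * \<phi> \<xi>)"
  have kc: "continuous_on UNIV (\<lambda>(\<theta>, \<xi>). k \<theta> \<xi>)"
    unfolding k_def case_prod_beta
    by (intro continuous_on_mult continuous_on_compose2[OF \<psi>'c[of UNIV]] continuous_on_compose2[OF \<phi>c[of UNIV]]
        continuous_intros) auto
  have kc2: "continuous_on S (k \<theta>)" for S \<theta>
    unfolding k_def
    by (intro continuous_on_mult continuous_on_compose2[OF \<psi>'c[of UNIV]] \<phi>c continuous_intros) auto
  have rc: "continuous_on S (\<lambda>\<theta>. \<psi>' (\<xi> - \<theta>))" for S \<xi>
    by (intro continuous_on_compose2[OF \<psi>'c[of UNIV]] continuous_intros) auto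
  define \<Psi> where "\<Psi> = (\<lambda>\<xi>. RS_integral a b (\<lambda>\<theta>. \<psi>' (\<xi> - \<theta>)) g)"
  have Kdecomp: "RS_integral a \<xi> (\<lambda>\<theta>. \<psi> (\<xi> - \<theta>)) g = \<Psi> \<xi> - \<psi> 0 * (g b - g \<xi>)" if \<xi>: "\<xi> \<in> {a..b}" for \<xi>
  proof -
    have V1: "variation_majorant a \<xi> V g" and V2: "variation_majorant \<xi> b V g"
      using variation_majorant_subinterval[OF V] \<xi> by auto
    have "\<Psi> \<xi> = RS_integral a \<xi> (\<lambda>\<theta>. \<psi>' (\<xi> - \<theta>)) g + RS_integral \<xi> b (\<lambda>\<theta>. \<psi>' (\<xi> - \<theta>)) g"
      unfolding \<Psi>_def using \<xi> by (intro RS_integral_combine[OF V] rc) auto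
    moreover have "RS_integral a \<xi> (\<lambda>\<theta>. \<psi>' (\<xi> - \<theta>)) g = RS_integral a \<xi> (\<lambda>\<theta>. \<psi> (\<xi> - \<theta>)) g"
      by (rule RS_integral_cong) (auto simp: \<psi>'_def max_def)
    moreover have "RS_integral \<xi> b (\<lambda>\<theta>. \<psi>' (\<xi> - \<theta>)) g = RS_integral \<xi> b (\<lambda>\<theta>. \<psi> 0) g"
      by (rule RS_integral_cong) (auto simp: \<psi>'_def max_def)
    moreover have "RS_integral \<xi> b (\<lambda>\<theta>. \<psi> 0) g = \<psi> 0 * (g b - g \<xi>)"
      using \<xi> by (intro RS_integral_const[OF V2]) auto
    ultimately show ?thesis by simp
  qed
  define \<Phi> where "\<Phi> = (\<lambda>\<theta>. integral {a..\<theta>} \<phi>)"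
  have d\<Phi>: "(\<Phi> has_vector_derivative \<phi> x) (at x within {a..b})" if "x \<in> {a..b}" for x
    unfolding \<Phi>_def using that by (intro integral_has_vector_derivative \<phi>c)
  have \<Phi>c: "continuous_on {a..b} \<Phi>"
    by (rule continuous_on_vector_derivative[OF d\<Phi>])
  have RS\<Phi>: "RS_integral a b \<Phi> g = integral {a..b} \<phi> * g b - integral {a..b} (\<lambda>x. \<phi> x * g x)"
    using RS_integral_by_parts[OF V ab d\<Phi> \<phi>c] by (simp add: \<Phi>_def)
  have gint: "(\<lambda>x. \<phi> x * g x) integrable_on {a..b}"
    using majorant_integrable_mult[OF V \<phi>c] by (rule set_lebesgue_integral_eq_integral(1))
  have "((\<lambda>\<xi>. \<phi> \<xi> * g b - \<phi> \<xi> * g \<xi>) has_integral RS_integral a b \<Phi> g) {a..b}"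
    unfolding RS\<Phi>
    by (intro has_integral_diff has_integral_mult_left integrable_integral gint integrable_continuous_real \<phi>c)
  then have i2: "((\<lambda>\<xi>. \<psi> 0 * (\<phi> \<xi> * g b - \<phi> \<xi> * g \<xi>)) has_integral \<psi> 0 * RS_integral a b \<Phi> g) {a..b}"
    by (rule has_integral_mult_right)
  have Rk: "RS_integral a b (\<lambda>\<theta>. k \<theta> \<xi>) g = \<Psi> \<xi> * \<phi> \<xi>" for \<xi>
    unfolding k_def \<Psi>_def using RS_integral_cmult[OF V ab rc, of "\<phi> \<xi>" \<xi>] by (simp add: mult.commute)
  have "continuous_on {a..b} (\<lambda>\<xi>. \<Psi> \<xi> * \<phi> \<xi>)"
    unfolding Rk[symmetric] by (rule continuous_on_RS_integral[OF V ab kc])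
  then have "((\<lambda>\<xi>. \<Psi> \<xi> * \<phi> \<xi>) has_integral integral {a..b} (\<lambda>\<xi>. \<Psi> \<xi> * \<phi> \<xi>)) {a..b}"
    by (intro integrable_integral integrable_continuous_real)
  also have "integral {a..b} (\<lambda>\<xi>. \<Psi> \<xi> * \<phi> \<xi>) = RS_integral a b (\<lambda>\<theta>. integral {a..b} (k \<theta>)) g"
    unfolding RS_integral_of_integral(1)[OF V ab kc] Rk ..
  finally have i1: "((\<lambda>\<xi>. \<Psi> \<xi> * \<phi> \<xi>) has_integral RS_integral a b (\<lambda>\<theta>. integral {a..b} (k \<theta>)) g) {a..b}" .
  have "((\<lambda>\<xi>. RS_integral a \<xi> (\<lambda>\<theta>. \<psi> (\<xi> - \<theta>)) g * \<phi> \<xi>) has_integral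
      RS_integral a b (\<lambda>\<theta>. integral {a..b} (k \<theta>)) g - \<psi> 0 * RS_integral a b \<Phi> g) {a..b}"
  proof (rule has_integral_eq[OF _ has_integral_diff[OF i1 i2]])
    fix \<xi> assume \<xi>: "\<xi> \<in> {a..b}"
    show "\<Psi> \<xi> * \<phi> \<xi> - \<psi> 0 * (\<phi> \<xi> * g b - \<phi> \<xi> * g \<xi>) = RS_integral a \<xi> (\<lambda>\<theta>. \<psi> (\<xi> - \<theta>)) g * \<phi> \<xi>"
      unfolding Kdecomp[OF \<xi>] by (simp add: algebra_simps)
  qed
  also have "RS_integral a b (\<lambda>\<theta>. integral {a..b} (k \<theta>)) g - \<psi> 0 * RS_integral a b \<Phi> g =
      RS_integral a b (\<lambda>\<theta>. integral {a..b} (k \<theta>) - \<psi> 0 * \<Phi> \<theta>) g"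
  proof -
    have "continuous_on {a..b} (\<lambda>\<theta>. integral (cbox a b) (k \<theta>))"
      by (intro integral_continuous_on_param continuous_on_subset[OF kc]) auto
    then show ?thesis
      by (subst RS_integral_diff[OF V ab]) (auto simp: RS_integral_cmult[OF V ab \<Phi>c] intro!: continuous_on_mult_left \<Phi>c)
  qed
  also have "RS_integral a b (\<lambda>\<theta>. integral {a..b} (k \<theta>) - \<psi> 0 * \<Phi> \<theta>) g =
      RS_integral a b (\<lambda>\<theta>. integral {\<theta>..b} (\<lambda>\<xi>. \<psi> (\<xi> - \<theta>) * \<phi> \<xi>)) g"
  proof (rule RS_integral_cong)
    fix \<theta> assume \<theta>: "\<theta> \<in> {a..b}"
    have "integral {a..\<theta>} (k \<theta>) + integral {\<theta>..b} (k \<theta>) = integral {a..b} (k \<theta>)"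
      using \<theta> by (intro HK_integral_combine integrable_continuous_real kc2) auto
    moreover have "integral {a..\<theta>} (k \<theta>) = integral {a..\<theta>} (\<lambda>\<xi>. \<psi> 0 * \<phi> \<xi>)"
      by (rule integral_cong) (auto simp: k_def \<psi>'_def max_def)
    moreover have "integral {\<theta>..b} (k \<theta>) = integral {\<theta>..b} (\<lambda>\<xi>. \<psi> (\<xi> - \<theta>) * \<phi> \<xi>)"
      by (rule integral_cong) (auto simp: k_def \<psi>'_def max_def)
    ultimately show "integral {a..b} (k \<theta>) - \<psi> 0 * \<Phi> \<theta> = integral {\<theta>..b} (\<lambda>\<xi>. \<psi> (\<xi> - \<theta>) * \<phi> \<xi>)"
      by (simp add: \<Phi>_def algebra_simps)
  qed
  finally show ?thesis .
qed

lemma integral_window_difference: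
  fixes h :: "real \<Rightarrow> complex"
  assumes h: "continuous_on UNIV h" and "\<alpha> \<le> t" "\<theta> \<le> 0"
  shows "integral {t + \<theta>..t} h - integral {\<alpha> + \<theta>..\<alpha>} h = integral {\<alpha>..t} (\<lambda>s. h s - h (s + \<theta>))"
proof -
  have hi: "h integrable_on {x..y}" for x y
    by (intro integrable_continuous_real continuous_on_subset[OF h]) auto
  have "integral {\<alpha> + \<theta>..t + \<theta>} h + integral {t + \<theta>..t} h = integral {\<alpha> + \<theta>..t} h"
    using assms hi by (intro HK_integral_combine) auto
  moreover have "integral {\<alpha> + \<theta>..\<alpha>} h + integral {\<alpha>..t} h = integral {\<alpha> + \<theta>..t} h"
    using assms hi by (intro HK_integral_combine) auto
  moreover have "integral {\<alpha> + \<theta>..t + \<theta>} h = integral {\<alpha>..t} (\<lambda>s. h (s + \<theta>))"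
    using integral_shift_real_ivl[of "\<alpha> + \<theta>" \<theta> "t + \<theta>" h] by simp
  moreover have "integral {\<alpha>..t} (\<lambda>s. h s - h (s + \<theta>)) = integral {\<alpha>..t} h - integral {\<alpha>..t} (\<lambda>s. h (s + \<theta>))"
    by (intro integral_diff hi integrable_continuous_real continuous_on_compose2[OF h] continuous_intros) auto
  moreover have "B - D = G" if "A + B = C" "D + E = C" "A = F" "G = E - F" for A B C D E F G :: complex
  proof -
    have "A + B = D + E" using that(1,2) by simp
    then show ?thesis unfolding that(3,4) by (metis add_diff_cancel_left' add_diff_eq diff_diff_eq2 add.commute)
  qed
  ultimately show ?thesis by blast
qed

text \<open>The derivative along translates in integrated form, for continuous functions. After the interchange
  of integrations, \<open>D t\<close> is the integral \<open>dg(\<theta>)\<close> of the integrals of \<open>v (s - \<theta>) u s\<close> over the window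
  \<open>[t + \<theta>, t]\<close>. While the window moves from \<open>\<alpha>\<close> to \<open>t\<close>, it gains \<open>v (s - \<theta>) u s\<close> at its upper end and loses
  \<open>v s u (s + \<theta>)\<close> at its lower end.\<close>

lemma delay_pairing_difference:
  fixes v u g :: "real \<Rightarrow> complex"
  assumes V: "variation_majorant (- r) 0 V g" and r: "r \<ge> 0"
    and v: "continuous_on UNIV v" and u: "continuous_on UNIV u" and "\<alpha> \<le> t"
  defines "D \<equiv> \<lambda>t. integral {- r..0} (\<lambda>\<xi>. RS_integral (- r) \<xi> (\<lambda>\<theta>. v (t + (\<xi> - \<theta>))) g * u (t + \<xi>))"
  shows "D t - D \<alpha> = integral {\<alpha>..t} (\<lambda>s. RS_integral (- r) 0 (\<lambda>\<theta>. v (s - \<theta>)) g * u s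
      - v s * RS_integral (- r) 0 (\<lambda>\<theta>. u (s + \<theta>)) g)"
proof -
  have ab: "- r \<le> (0::real)" using r by simp
  have vc: "continuous_on S (\<lambda>x. v (f x))" if "continuous_on S f" for S f
    by (rule continuous_on_compose2[OF v that]) simp
  have uc: "continuous_on S (\<lambda>x. u (f x))" if "continuous_on S f" for S f
    by (rule continuous_on_compose2[OF u that]) simp
  define G where "G = (\<lambda>t \<theta>. integral {t + \<theta>..t} (\<lambda>s. v (s - \<theta>) * u s))"
  have Geq: "integral {\<theta>..0} (\<lambda>\<xi>. v (t + (\<xi> - \<theta>)) * u (t + \<xi>)) = G t \<theta>" for t \<theta>
  proof -
    have "integral {t + \<theta> - t..t - t} (\<lambda>x. v (x + t - \<theta>) * u (x + t)) = integral {t + \<theta>..t} (\<lambda>s. v (s - \<theta>) * u s)"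
      by (rule integral_shift_real_ivl)
    then show ?thesis by (simp add: G_def algebra_simps)
  qed
  have D: "D t = RS_integral (- r) 0 (G t) g" for t
    unfolding D_def Geq[symmetric]
    by (intro integral_unique RS_integral_truncated_kernel[OF V ab] vc uc continuous_intros)
  define k where "k = (\<lambda>\<theta> s. v (s - \<theta>) * u s - v s * u (s + \<theta>))"
  have kc: "continuous_on UNIV (\<lambda>(\<theta>, s). k \<theta> s)"
    unfolding k_def case_prod_beta by (intro continuous_on_diff continuous_on_mult vc uc continuous_intros)
  have Gdiff: "G t \<theta> - G \<alpha> \<theta> = integral {\<alpha>..t} (k \<theta>)" if "\<theta> \<le> 0" for \<theta>
    unfolding G_def k_def
    using integral_window_difference[of "\<lambda>s. v (s - \<theta>) * u s" \<alpha> t \<theta>] that \<open>\<alpha> \<le> t\<close>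
    by (simp add: vc uc continuous_intros)
  have Gc: "continuous_on {- r..0} (G t)" for t
  proof -
    have "continuous_on {- r..0} (\<lambda>\<theta>. integral {\<theta>..0} (\<lambda>\<xi>. v (t + (\<xi> - \<theta>)) * u (t + \<xi>)))"
      by (rule continuous_on_integral_lower_limit)
        (unfold case_prod_beta, intro continuous_on_mult vc uc continuous_intros)
    then show ?thesis unfolding Geq .
  qed
  have Rk: "RS_integral (- r) 0 (\<lambda>\<theta>. k \<theta> s) g = RS_integral (- r) 0 (\<lambda>\<theta>. v (s - \<theta>)) g * u s
      - v s * RS_integral (- r) 0 (\<lambda>\<theta>. u (s + \<theta>)) g" for s
  proof -
    have "RS_integral (- r) 0 (\<lambda>\<theta>. k \<theta> s) g =
      RS_integral (- r) 0 (\<lambda>\<theta>. u s * v (s - \<theta>)) g - RS_integral (- r) 0 (\<lambda>\<theta>. v s * u (s + \<theta>)) g"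
      unfolding k_def mult.commute[of _ "u s"]
      by (intro RS_integral_diff[OF V ab] continuous_on_mult_left vc uc continuous_intros)
    then show ?thesis
      by (simp add: RS_integral_cmult[OF V ab] vc uc continuous_intros mult.commute)
  qed
  have "D t - D \<alpha> = RS_integral (- r) 0 (\<lambda>\<theta>. G t \<theta> - G \<alpha> \<theta>) g"
    unfolding D by (rule RS_integral_diff[OF V ab Gc Gc, symmetric])
  also have "\<dots> = RS_integral (- r) 0 (\<lambda>\<theta>. integral {\<alpha>..t} (k \<theta>)) g"
    by (rule RS_integral_cong) (simp add: Gdiff)
  also have "\<dots> = integral {\<alpha>..t} (\<lambda>s. RS_integral (- r) 0 (\<lambda>\<theta>. k \<theta> s) g)"
    by (rule RS_integral_of_integral(1)[OF V ab kc])
  finally show ?thesis unfolding Rk .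
qed

lemma B_form_translate_difference:
  fixes v u :: "real \<Rightarrow> complex ^ 'n"
  assumes V: "\<And>i j. variation_majorant (- r) 0 V (\<lambda>\<theta>. \<eta> \<theta> $ i $ j)" and r: "r \<ge> 0"
    and v: "continuous_on UNIV v" and u: "continuous_on UNIV u" and "\<alpha> \<le> t"
  shows "B_form r \<eta> (translate v t) (translate u t) - B_form r \<eta> (translate v \<alpha>) (translate u \<alpha>) =
    scalar_product (v t) (u t) - scalar_product (v \<alpha>) (u \<alpha>) +
    (\<Sum>j\<in>UNIV. \<Sum>i\<in>UNIV. integral {\<alpha>..t} (\<lambda>s.
      RS_integral (- r) 0 (\<lambda>\<theta>. v (s - \<theta>) $ i) (\<lambda>\<theta>. \<eta> \<theta> $ i $ j) * u s $ j
      - v s $ i * RS_integral (- r) 0 (\<lambda>\<theta>. u (s + \<theta>) $ j) (\<lambda>\<theta>. \<eta> \<theta> $ i $ j)))"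
proof -
  have ab: "- r \<le> 0" using r by simp
  have vc: "continuous_on S (\<lambda>x. v (f x) $ i)" if "continuous_on S f" for S f i
    by (intro continuous_on_component continuous_on_compose2[OF v that]) simp
  have uc: "continuous_on S (\<lambda>x. u (f x) $ i)" if "continuous_on S f" for S f i
    by (intro continuous_on_component continuous_on_compose2[OF u that]) simp
  define D where "D = (\<lambda>i j t. integral {- r..0} (\<lambda>\<xi>. RS_integral (- r) \<xi> (\<lambda>\<theta>. v (t + (\<xi> - \<theta>)) $ i) (\<lambda>\<theta>. \<eta> \<theta> $ i $ j) * u (t + \<xi>) $ j))"
  have B: "B_form r \<eta> (translate v t) (translate u t) = scalar_product (v t) (u t) + (\<Sum>j\<in>UNIV. \<Sum>i\<in>UNIV. D i j t)" for t
  proof -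
    have "((\<lambda>\<xi>. RS_integral (- r) \<xi> (\<lambda>\<theta>. v (t + (\<xi> - \<theta>)) $ i) (\<lambda>\<theta>. \<eta> \<theta> $ i $ j) * u (t + \<xi>) $ j) has_integral D i j t) {- r..0}" for i j
      unfolding D_def
      by (intro integrable_integral has_integral_integrable[OF RS_integral_truncated_kernel[OF V ab]] vc uc continuous_intros)
    then have "((\<lambda>\<xi>. \<Sum>j\<in>UNIV. \<Sum>i\<in>UNIV. RS_integral (- r) \<xi> (\<lambda>\<theta>. v (t + (\<xi> - \<theta>)) $ i) (\<lambda>\<theta>. \<eta> \<theta> $ i $ j) * u (t + \<xi>) $ j)
        has_integral (\<Sum>j\<in>UNIV. \<Sum>i\<in>UNIV. D i j t)) {- r..0}"
      by (intro has_integral_sum) auto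
    from integral_unique[OF this] show ?thesis
      by (simp add: B_form_def RS_integral_row_def scalar_product_def translate_def sum_distrib_right)
  qed
  have "D i j t - D i j \<alpha> = integral {\<alpha>..t} (\<lambda>s.
      RS_integral (- r) 0 (\<lambda>\<theta>. v (s - \<theta>) $ i) (\<lambda>\<theta>. \<eta> \<theta> $ i $ j) * u s $ j
      - v s $ i * RS_integral (- r) 0 (\<lambda>\<theta>. u (s + \<theta>) $ j) (\<lambda>\<theta>. \<eta> \<theta> $ i $ j))" for i j
    unfolding D_def
    by (rule delay_pairing_difference[OF V r vc[OF continuous_on_id] uc[OF continuous_on_id] \<open>\<alpha> \<le> t\<close>])
  then show ?thesis unfolding B by (simp add: sum_subtractf[symmetric])
qed

section \<open>Continuous approximation in the mean\<close>

lemma AE_lebesgue_on_Icc_I: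
  fixes a b :: real
  assumes "negligible N" "\<And>x. x \<in> {a..b} - N \<Longrightarrow> P x"
  shows "AE x in lebesgue_on {a..b}. P x"
proof -
  have "AE x in lebesgue. x \<notin> N"
    using assms(1) by (intro AE_not_in) (simp add: negligible_iff_null_sets)
  then have "AE x in lebesgue. x \<in> {a..b} \<longrightarrow> P x"
    by eventually_elim (use assms(2) in blast)
  then show ?thesis by (subst AE_restrict_space_iff) auto
qed

lemma absolutely_integrable_on_iff_integrable:
  fixes f :: "real \<Rightarrow> 'b::euclidean_space"
  shows "f absolutely_integrable_on {a..b} \<longleftrightarrow> integrable (lebesgue_on {a..b}) f"
  by (simp add: integrable_restrict_space set_integrable_def)

lemma nonneg_integrable_on_iff:
  fixes f :: "real \<Rightarrow> real"
  assumes "\<And>x. 0 \<le> f x"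
  shows "f integrable_on {a..b} \<longleftrightarrow> integrable (lebesgue_on {a..b}) f"
  unfolding absolutely_integrable_on_iff_integrable[symmetric]
  using absolutely_integrable_on_iff_nonneg[of "{a..b}" f] assms by simp

lemma powr_add_le:
  fixes x y q :: real
  assumes "0 \<le> x" "0 \<le> y" "0 \<le> q"
  shows "(x + y) powr q \<le> 2 powr q * (x powr q + y powr q)"
proof -
  have "(x + y) powr q \<le> (2 * max x y) powr q" using assms by (intro powr_mono2) auto
  also have "\<dots> = 2 powr q * max x y powr q" using assms by (simp add: powr_mult)
  also have "max x y powr q \<le> x powr q + y powr q" by (auto simp: max_def)
  finally show ?thesis by (simp add: mult_left_mono)
qed

lemma le_one_plus_powr:
  fixes x q :: real
  assumes "0 \<le> x" "1 \<le> q"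
  shows "x \<le> 1 + x powr q"
proof (cases "x \<le> 1")
  case False
  then have "x powr 1 \<le> x powr q" using assms by (intro powr_mono) auto
  then show ?thesis using False by simp
qed (use powr_ge_zero[of x q] in linarith)

lemma integral_vec_nth:
  fixes f :: "real \<Rightarrow> complex ^ 'n"
  assumes "f integrable_on S" shows "integral S f $ i = integral S (\<lambda>s. f s $ i)"
  using integral_linear[OF assms bounded_linear_vec_nth, of i] by (simp add: o_def)

lemma absolutely_integrable_vec_nth:
  fixes f :: "real \<Rightarrow> complex ^ 'n"
  assumes "f absolutely_integrable_on S" shows "(\<lambda>s. f s $ i) absolutely_integrable_on S"
  using absolutely_integrable_linear[OF assms bounded_linear_vec_nth, of i] by (simp add: o_def)

lemma absolutely_integrable_vec_lambda:
  fixes f :: "'n::finite \<Rightarrow> real \<Rightarrow> complex"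
  assumes "\<And>j. f j absolutely_integrable_on S"
  shows "(\<lambda>s. \<chi> j. f j s) absolutely_integrable_on S"
proof -
  have "(axis j \<circ> f j :: real \<Rightarrow> complex ^ 'n) absolutely_integrable_on S" for j
  proof (rule absolutely_integrable_linear[OF assms])
    have "linear (axis j :: complex \<Rightarrow> complex ^ 'n)"
      by (rule linearI) (auto simp: axis_def vec_eq_iff)
    then show "bounded_linear (axis j :: complex \<Rightarrow> complex ^ 'n)" by (simp add: linear_conv_bounded_linear)
  qed
  note axis_f = this
  have "(\<lambda>s. \<Sum>j\<in>UNIV. (axis j \<circ> f j) s :: complex ^ 'n) absolutely_integrable_on S"
    by (rule absolutely_integrable_sum) (simp, rule axis_f)
  moreover have "(\<Sum>j\<in>UNIV. (axis j \<circ> f j) s) = (\<chi> j. f j s)" for s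
    by (simp add: vec_eq_iff axis_def if_distrib cong: if_cong)
  ultimately show ?thesis by simp
qed

text \<open>The intervals of integration have length at most \<open>B - A\<close>, so that they stay in \<open>[A, C]\<close> for all
  points of \<open>[B, C]\<close>.\<close>

lemma backward_averages_tendsto:
  fixes W :: "real \<Rightarrow> 'b::euclidean_space"
  assumes W: "W integrable_on {A..C}" and AB: "A < B"
  obtains N where "negligible N"
    "\<And>x. x \<in> {B..C} - N \<Longrightarrow> (\<lambda>k. real (Suc k) *\<^sub>R integral {x - (B - A) / real (Suc k)..x} W) \<longlonglongrightarrow> (B - A) *\<^sub>R W x"
proof -
  obtain N where N: "negligible N" "\<And>x. x \<in> {A..C} - N \<Longrightarrow>
    ((\<lambda>t. integral {A..t} W) has_vector_derivative W x) (at x within {A..C})"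
    using integral_has_vector_derivative_negligible[OF W] by blast
  show thesis
  proof (rule that[OF N(1)])
    fix x assume x: "x \<in> {B..C} - N"
    define h where "h = (\<lambda>k. (B - A) / real (Suc k))"
    have h: "0 < h k" "h k \<le> B - A" for k using AB by (auto simp: h_def divide_le_eq)
    have h0: "h \<longlonglongrightarrow> 0" unfolding h_def by (rule LIMSEQ_Suc[OF lim_const_over_n])
    have I: "integral {x - h k..x} W = integral {A..x} W - integral {A..x - h k} W" for k
    proof -
      have "integral {A..x - h k} W + integral {x - h k..x} W = integral {A..x} W"
        using x h[of k] by (intro HK_integral_combine integrable_subinterval_real[OF W]) auto
      then show ?thesis by (simp add: algebra_simps)
    qed
    have "((\<lambda>t. integral {A..t} W) has_vector_derivative W x) (at x within {A..C})"
      using N(2) x AB by auto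
    then have der: "\<forall>e>0. \<exists>d>0. \<forall>y\<in>{A..C}. norm (y - x) < d \<longrightarrow>
        norm (integral {A..y} W - integral {A..x} W - (y - x) *\<^sub>R W x) \<le> e * norm (y - x)"
      unfolding has_vector_derivative_def has_derivative_within_alt by blast
    show "(\<lambda>k. real (Suc k) *\<^sub>R integral {x - (B - A) / real (Suc k)..x} W) \<longlonglongrightarrow> (B - A) *\<^sub>R W x"
      unfolding tendsto_iff dist_norm
    proof (intro allI impI)
      fix e :: real assume e: "e > 0"
      define e' where "e' = e / 2 / (B - A)"
      have "e' * (B - A) = e / 2" unfolding e'_def using AB by (intro nonzero_eq_divide_eq[THEN iffD1, OF _ refl]) simp
      then have e': "e' * (B - A) < e" using e by linarith
      have e'0: "e' > 0" using e AB by (simp add: e'_def)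
      obtain d where d: "d > 0" and *: "\<forall>y\<in>{A..C}. norm (y - x) < d \<longrightarrow>
        norm (integral {A..y} W - integral {A..x} W - (y - x) *\<^sub>R W x) \<le> e' * norm (y - x)"
        using der e'0 by blast
      have "\<forall>\<^sub>F k in sequentially. h k < d" using h0 d by (rule order_tendstoD)
      then show "\<forall>\<^sub>F k in sequentially.
          norm (real (Suc k) *\<^sub>R integral {x - (B - A) / real (Suc k)..x} W - (B - A) *\<^sub>R W x) < e"
      proof eventually_elim
        case (elim k)
        have "x - h k \<in> {A..C}" "norm ((x - h k) - x) < d" using x h[of k] elim by auto
        then have "norm (integral {A..x - h k} W - integral {A..x} W - ((x - h k) - x) *\<^sub>R W x) \<le> e' * norm ((x - h k) - x)"
          using * by blast
        also have "integral {A..x - h k} W - integral {A..x} W - ((x - h k) - x) *\<^sub>R W x = - (integral {x - h k..x} W - h k *\<^sub>R W x)"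
          unfolding I by simp
        finally have "norm (integral {x - h k..x} W - h k *\<^sub>R W x) \<le> e' * h k"
          using h[of k] unfolding norm_minus_cancel by simp
        then have "real (Suc k) * norm (integral {x - h k..x} W - h k *\<^sub>R W x) \<le> real (Suc k) * (e' * h k)"
          by (intro mult_left_mono) auto
        also have "real (Suc k) * (e' * h k) = e' * (B - A)" by (simp add: h_def)
        also have "real (Suc k) * norm (integral {x - h k..x} W - h k *\<^sub>R W x) =
            norm (real (Suc k) *\<^sub>R (integral {x - h k..x} W - h k *\<^sub>R W x))" by simp
        also have "real (Suc k) *\<^sub>R (integral {x - h k..x} W - h k *\<^sub>R W x) =
            real (Suc k) *\<^sub>R integral {x - h k..x} W - (B - A) *\<^sub>R W x"
          by (simp add: scaleR_diff_right h_def del: of_nat_Suc)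
        finally show ?case using e' unfolding h_def by linarith
      qed
    qed
  qed
qed

text \<open>Cut \<open>w\<close> off at a high level \<open>M\<close>, continue the result to the left of \<open>b\<close> by the constant \<open>w b\<close>, and take
  averages over short intervals \<open>[x - h, x]\<close>. These are continuous in \<open>x\<close> and equal to \<open>w b\<close> at
  \<open>b\<close>, so they fit together with \<open>w\<close> on \<open>[a, b]\<close>; being bounded by \<open>M\<close> and convergent almost
  everywhere, they converge in the mean. The distance combines the first and the \<open>q\<close>-th power: the
  latter controls the extended bilinear form, the former the Stieltjes integrals of translates.\<close>

lemma continuous_approximation_fixing_interval:
  fixes w :: "real \<Rightarrow> 'b::euclidean_space"
  assumes q: "1 \<le> q" and ab: "a \<le> b" and bc: "b \<le> c"
    and wc: "continuous_on {a..b} w" and wi: "w absolutely_integrable_on {a..c}"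
    and wq: "(\<lambda>x. norm (w x) powr q) integrable_on {a..c}" and \<epsilon>: "\<epsilon> > 0"
  obtains g where "continuous_on UNIV g" "\<And>x. x \<in> {a..b} \<Longrightarrow> g x = w x"
    "(\<lambda>x. norm (g x - w x) + norm (g x - w x) powr q) integrable_on {a..c}"
    "integral {a..c} (\<lambda>x. norm (g x - w x) + norm (g x - w x) powr q) < \<epsilon>"
proof -
  let ?L = "lebesgue_on {a..c}"
  \<comment> \<open>The pointwise distance that is to be made small in the mean.\<close>
  define \<Phi> :: "'b \<Rightarrow> real" where "\<Phi> = (\<lambda>y. norm y + norm y powr q)"
  have \<Phi>0: "0 \<le> \<Phi> y" for y by (simp add: \<Phi>_def)
  have \<Phi>m[measurable]: "\<Phi> \<in> borel_measurable borel" unfolding \<Phi>_def by measurable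
  have \<Phi>_cont: "(\<lambda>k. \<Phi> (y k)) \<longlonglongrightarrow> \<Phi> l" if "y \<longlonglongrightarrow> l" for y l
    unfolding \<Phi>_def using that q by (intro tendsto_add tendsto_norm tendsto_powr2 tendsto_const) auto
  have wI: "integrable ?L w" using wi by (simp add: absolutely_integrable_on_iff_integrable)
  then have [measurable]: "w \<in> borel_measurable ?L" by auto
  have wqI: "integrable ?L (\<lambda>x. norm (w x) powr q)" using wq by (subst (asm) nonneg_integrable_on_iff) auto
  have const: "integrable ?L (\<lambda>x. C)" for C :: real
    using absolutely_integrable_continuous_real[of a c "\<lambda>_. C"] by (simp add: absolutely_integrable_on_iff_integrable)
  have DCT: "(\<lambda>k. \<integral>x. \<Phi> (f k x - w x) \<partial>?L) \<longlonglongrightarrow> (\<integral>x. \<Phi> (l x - w x) \<partial>?L)"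
    and DCT_int: "\<And>k. integrable ?L (\<lambda>x. \<Phi> (f k x - w x))"
    if [measurable]: "\<And>k. f k \<in> borel_measurable ?L" "l \<in> borel_measurable ?L"
      and lim: "AE x in ?L. (\<lambda>k. f k x) \<longlonglongrightarrow> l x"
      and bd: "\<And>k x. x \<in> {a..c} \<Longrightarrow> norm (f k x) \<le> C + norm (w x)" and C: "C \<ge> 0" for f :: "nat \<Rightarrow> real \<Rightarrow> 'b" and l C
  proof -
    let ?D = "\<lambda>x. 1 * (C + 2 * norm (w x)) + 2 powr q * (C powr q + 2 powr q * norm (w x) powr q)"
    have dom2: "integrable ?L ?D"
      by (intro Bochner_Integration.integrable_add integrable_mult_right const integrable_norm wI wqI)
    have le: "norm (\<Phi> (f k x - w x)) \<le> ?D x"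
      if "x \<in> {a..c}" for k x
    proof -
      have n: "norm (f k x - w x) \<le> C + 2 * norm (w x)"
        using bd[OF that, of k] norm_triangle_ineq4[of "f k x" "w x"] by linarith
      then have "norm (f k x - w x) powr q \<le> (C + 2 * norm (w x)) powr q" using q by (intro powr_mono2) auto
      also have "\<dots> \<le> 2 powr q * (C powr q + (2 * norm (w x)) powr q)" using C q by (intro powr_add_le) auto
      also have "(2 * norm (w x)) powr q = 2 powr q * norm (w x) powr q" by (simp add: powr_mult)
      finally show ?thesis using n \<Phi>0[of "f k x - w x"] by (simp add: \<Phi>_def)
    qed
    have AEle: "AE x in ?L. norm (\<Phi> (f k x - w x)) \<le> ?D x" for k
      using le by (intro AE_I2) simp
    show "(\<lambda>k. \<integral>x. \<Phi> (f k x - w x) \<partial>?L) \<longlonglongrightarrow> (\<integral>x. \<Phi> (l x - w x) \<partial>?L)"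
    proof (rule integral_dominated_convergence[OF _ _ dom2 _ AEle])
      show "AE x in ?L. (\<lambda>k. \<Phi> (f k x - w x)) \<longlonglongrightarrow> \<Phi> (l x - w x)"
        using lim by eventually_elim (intro \<Phi>_cont tendsto_diff tendsto_const)
    qed measurable
    show "integrable ?L (\<lambda>x. \<Phi> (f k x - w x))" for k
    proof (rule Bochner_Integration.integrable_bound[OF dom2])
      show "AE x in ?L. norm (\<Phi> (f k x - w x)) \<le>
          norm (?D x)"
        using AEle[of k] by eventually_elim (erule order_trans, simp only: real_norm_def abs_ge_self)
    qed measurable
  qed
  define T where "T = (\<lambda>M x. if norm (w x) \<le> M then w x else 0)"
  have Tm[measurable]: "T M \<in> borel_measurable ?L" for M unfolding T_def by measurable
  have "(\<lambda>k. \<integral>x. \<Phi> (T (real k) x - w x) \<partial>?L) \<longlonglongrightarrow> (\<integral>x. \<Phi> (w x - w x) \<partial>?L)"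
  proof (rule DCT[of _ _ 0])
    show "AE x in ?L. (\<lambda>k. T (real k) x) \<longlonglongrightarrow> w x"
    proof (rule AE_I2, rule tendsto_eventually)
      fix x
      obtain n where n: "norm (w x) \<le> real n" using real_arch_simple by blast
      show "\<forall>\<^sub>F k in sequentially. T (real k) x = w x"
        using eventually_ge_at_top[of n] by eventually_elim (use n in \<open>auto simp: T_def\<close>)
    qed
  qed (auto simp: T_def)
  then have "(\<lambda>k. \<integral>x. \<Phi> (T (real k) x - w x) \<partial>?L) \<longlonglongrightarrow> 0" by (simp add: \<Phi>_def)
  then have E: "\<forall>\<^sub>F k in sequentially. (\<integral>x. \<Phi> (T (real k) x - w x) \<partial>?L) < \<epsilon>"
    using \<epsilon> by (rule order_tendstoD)
  obtain C where C: "\<forall>x\<in>{a..b}. norm (w x) \<le> C"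
    using compact_imp_bounded[OF compact_continuous_image[OF wc compact_Icc]] by (auto simp: bounded_iff)
  obtain n0 where n0: "C \<le> real n0" using real_arch_simple by blast
  have "\<forall>\<^sub>F k in sequentially. (\<integral>x. \<Phi> (T (real k) x - w x) \<partial>?L) < \<epsilon> \<and> C \<le> real k"
    using E eventually_ge_at_top[of n0] by eventually_elim (use n0 in auto)
  then obtain m where m: "(\<integral>x. \<Phi> (T (real m) x - w x) \<partial>?L) < \<epsilon>" "C \<le> real m"
    using eventually_happens'[OF sequentially_bot] by blast
  define M where "M = real m"
  have M0: "M \<ge> 0" by (simp add: M_def)
  have TC: "T M x = w x" if "x \<in> {a..b}" for x using C that m(2) by (force simp: T_def M_def)
  \<comment> \<open>At \<open>b\<close> both descriptions agree, because \<open>M\<close> bounds \<open>w\<close> on \<open>[a, b]\<close>.\<close>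
  define W where "W = (\<lambda>x. if x \<le> b then w b else T M x)"
  have Wle: "norm (W x) \<le> M" for x using bspec[OF C, of b] m(2) M0 ab by (auto simp: W_def T_def M_def)
  have Wi: "W absolutely_integrable_on {b - 1..c}"
  proof -
    have "W absolutely_integrable_on {b - 1..b}"
      using absolutely_integrable_continuous_real[of "b - 1" b "\<lambda>_. w b"]
      by (rule set_integrable_cong[THEN iffD1, rotated 3]) (auto simp: W_def)
    moreover have "W absolutely_integrable_on {b..c}"
    proof -
      have "integrable ?L (T M)"
        by (rule Bochner_Integration.integrable_bound[OF const[of M] Tm]) (use M0 in \<open>auto simp: T_def\<close>)
      then have "T M absolutely_integrable_on {a..c}" by (simp add: absolutely_integrable_on_iff_integrable)
      then have "T M absolutely_integrable_on {b..c}"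
        by (rule absolutely_integrable_on_subinterval) (use ab in auto)
      then show ?thesis
        by (rule set_integrable_cong[THEN iffD1, rotated 3]) (use TC[of b] ab in \<open>auto simp: W_def\<close>)
    qed
    ultimately show ?thesis by (rule absolutely_integrable_on_combine) (use bc in simp_all)
  qed
  then have Wint: "W integrable_on {b - 1..c}" by (rule set_lebesgue_integral_eq_integral(1))
  define A where "A = (\<lambda>k x. real (Suc k) *\<^sub>R integral {x - 1 / real (Suc k)..x} W)"
  \<comment> \<open>The clamps only extend the functions continuously to the whole line.\<close>
  define g where "g = (\<lambda>k x. if x \<le> b then w (max a x) else A k (min c x))"
  have h: "0 < 1 / real (Suc k)" "1 / real (Suc k) \<le> 1" for k by auto
  have b1: "b - 1 \<le> x - 1 / real (Suc k)" "x - 1 / real (Suc k) \<le> x" if "b \<le> x" for k x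
    using h[of k] that by linarith+
  have subI: "W integrable_on {x - 1 / real (Suc k)..x}" if "x \<in> {b..c}" for k x
    by (rule integrable_subinterval_real[OF Wint]) (use b1[of x k] that in \<open>simp del: of_nat_Suc\<close>)
  have Ale: "norm (A k x) \<le> M" if "x \<in> {b..c}" for k x
  proof -
    have "norm (integral {x - 1 / real (Suc k)..x} W) \<le> integral {x - 1 / real (Suc k)..x} (\<lambda>_. M)"
      using Wle by (intro integral_norm_bound_integral integrable_const_ivl subI[OF that])
    also have "\<dots> = M * (1 / real (Suc k))" using h[of k] by simp
    finally have "real (Suc k) * norm (integral {x - 1 / real (Suc k)..x} W) \<le> real (Suc k) * (M * (1 / real (Suc k)))"
      by (intro mult_left_mono) auto
    then show ?thesis by (simp add: A_def)
  qed
  have Ac: "continuous_on {b..c} (A k)" for k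
  proof -
    have Jc: "continuous_on {b - 1..c} (\<lambda>t. integral {b - 1..t} W)"
      by (rule indefinite_integral_continuous_1[OF Wint])
    have im: "(\<lambda>x. x - 1 / real (Suc k)) ` {b..c} \<subseteq> {b - 1..c}"
    proof (rule image_subsetI)
      fix x assume "x \<in> {b..c}"
      then show "x - 1 / real (Suc k) \<in> {b - 1..c}" using b1[of x k] unfolding atLeastAtMost_iff by linarith
    qed
    have im2: "(\<lambda>x. x) ` {b..c} \<subseteq> {b - 1..c}" by auto
    have "continuous_on {b..c} (\<lambda>x. real (Suc k) *\<^sub>R (integral {b - 1..x} W - integral {b - 1..x - 1 / real (Suc k)} W))"
      by (intro continuous_intros continuous_on_compose2[OF Jc _ im] continuous_on_compose2[OF Jc _ im2])
    moreover have "A k x = real (Suc k) *\<^sub>R (integral {b - 1..x} W - integral {b - 1..x - 1 / real (Suc k)} W)" if "x \<in> {b..c}" for x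
    proof -
      have "integral {b - 1..x - 1 / real (Suc k)} W + integral {x - 1 / real (Suc k)..x} W = integral {b - 1..x} W"
        using that b1[of x k]
        by (intro HK_integral_combine integrable_subinterval_real[OF Wint])
          (simp_all del: of_nat_Suc)
      then show ?thesis unfolding A_def by (metis add_diff_cancel_left')
    qed
    ultimately show ?thesis by (subst continuous_on_cong[OF refl]) auto
  qed
  have Ab: "A k b = w b" for k
  proof -
    have "integral {b - 1 / real (Suc k)..b} W = integral {b - 1 / real (Suc k)..b} (\<lambda>_. w b)"
      by (rule integral_cong) (auto simp: W_def)
    then show ?thesis using h[of k] by (simp add: A_def)
  qed
  have gc: "continuous_on UNIV (g k)" for k
  proof -
    have "continuous_on ({..b} \<union> {b..}) (\<lambda>x. if x \<le> b then w (max a x) else A k (min c x))"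
    proof (rule continuous_on_cases)
      show "continuous_on {..b} (\<lambda>x. w (max a x))"
        by (rule continuous_on_compose2[OF wc]) (use ab in \<open>auto intro!: continuous_intros\<close>)
      show "continuous_on {b..} (\<lambda>x. A k (min c x))"
        by (rule continuous_on_compose2[OF Ac]) (use bc in \<open>auto intro!: continuous_intros\<close>)
      show "\<forall>x. x \<in> {..b} \<and> \<not> x \<le> b \<or> x \<in> {b..} \<and> x \<le> b \<longrightarrow> w (max a x) = A k (min c x)"
      proof (intro allI impI)
        fix x assume "x \<in> {..b} \<and> \<not> x \<le> b \<or> x \<in> {b..} \<and> x \<le> b"
        then have "x = b" by auto
        moreover have "max a b = b" "min c b = b" using ab bc by auto
        ultimately show "w (max a x) = A k (min c x)" by (simp add: Ab)
      qed
    qed auto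
    moreover have "{..b} \<union> {b..} = UNIV" by auto
    ultimately show ?thesis by (simp add: g_def)
  qed
  have gw: "g k x = w x" if "x \<in> {a..b}" for k x using that by (simp add: g_def)
  obtain N where N: "negligible N" "\<And>x. x \<in> {b..c} - N \<Longrightarrow> (\<lambda>k. A k x) \<longlonglongrightarrow> W x"
    using backward_averages_tendsto[OF Wint, of b] unfolding A_def by auto
  have glim: "AE x in ?L. (\<lambda>k. g k x) \<longlonglongrightarrow> T M x"
  proof (rule AE_lebesgue_on_Icc_I[OF N(1)])
    fix x assume x: "x \<in> {a..c} - N"
    show "(\<lambda>k. g k x) \<longlonglongrightarrow> T M x"
    proof (cases "x \<le> b")
      case True
      then show ?thesis using gw[of x] TC[of x] x by simp
    next
      case False
      then have "g k x = A k x" for k using x by (simp add: g_def)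
      then show ?thesis using N(2)[of x] x False by (simp add: W_def)
    qed
  qed
  have gm: "g k \<in> borel_measurable ?L" for k
    using continuous_on_subset[OF gc] by (intro continuous_imp_measurable_on_sets_lebesgue) auto
  have gle: "norm (g k x) \<le> M + norm (w x)" if "x \<in> {a..c}" for k x
  proof (cases "x \<le> b")
    case True then show ?thesis using gw[of x] that M0 by simp
  next
    case False
    then have "norm (g k x) \<le> M" using Ale[of x k] that by (simp add: g_def)
    then show ?thesis by (simp add: add_increasing2)
  qed
  have "(\<lambda>k. \<integral>x. \<Phi> (g k x - w x) \<partial>?L) \<longlonglongrightarrow> (\<integral>x. \<Phi> (T M x - w x) \<partial>?L)"
    by (rule DCT[OF gm Tm glim gle M0])
  then have "\<forall>\<^sub>F k in sequentially. (\<integral>x. \<Phi> (g k x - w x) \<partial>?L) < \<epsilon>"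
    using m(1) unfolding M_def by (rule order_tendstoD)
  then obtain k where k: "(\<integral>x. \<Phi> (g k x - w x) \<partial>?L) < \<epsilon>"
    using eventually_happens'[OF sequentially_bot] by blast
  have int: "integrable ?L (\<lambda>x. \<Phi> (g k x - w x))" by (rule DCT_int[OF gm Tm glim gle M0])
  show thesis
  proof (rule that[OF gc gw])
    show "(\<lambda>x. norm (g k x - w x) + norm (g k x - w x) powr q) integrable_on {a..c}"
      using int \<Phi>0 unfolding \<Phi>_def by (subst nonneg_integrable_on_iff) auto
    show "integral {a..c} (\<lambda>x. norm (g k x - w x) + norm (g k x - w x) powr q) < \<epsilon>"
      using k lebesgue_integral_eq_integral[OF int] unfolding \<Phi>_def by simp
  qed
qed

lemma continuous_approximation_fixing_right_interval:
  fixes w :: "real \<Rightarrow> 'b::euclidean_space"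
  assumes q: "1 \<le> q" and ab: "a \<le> b" and bc: "b \<le> c"
    and wc: "continuous_on {b..c} w" and wi: "w absolutely_integrable_on {a..c}"
    and wq: "(\<lambda>x. norm (w x) powr q) integrable_on {a..c}" and \<epsilon>: "\<epsilon> > 0"
  obtains g where "continuous_on UNIV g" "\<And>x. x \<in> {b..c} \<Longrightarrow> g x = w x"
    "(\<lambda>x. norm (g x - w x) + norm (g x - w x) powr q) integrable_on {a..c}"
    "integral {a..c} (\<lambda>x. norm (g x - w x) + norm (g x - w x) powr q) < \<epsilon>"
proof -
  have c': "continuous_on {-c..-b} (\<lambda>x. w (- x))"
    by (rule continuous_on_compose2[OF wc]) (auto intro!: continuous_intros)
  have i': "(\<lambda>x. w (- x)) absolutely_integrable_on {-c..-a}"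
    using wi by (simp only: absolutely_integrable_reflect_real)
  have q': "(\<lambda>x. norm (w (- x)) powr q) integrable_on {-c..-a}"
    using wq Henstock_Kurzweil_Integration.integrable_reflect_real[of "\<lambda>x. norm (w x) powr q" c a] by simp
  obtain g where g: "continuous_on UNIV g" "\<And>x. x \<in> {-c..-b} \<Longrightarrow> g x = w (- x)"
    "(\<lambda>x. norm (g x - w (- x)) + norm (g x - w (- x)) powr q) integrable_on {-c..-a}"
    "integral {-c..-a} (\<lambda>x. norm (g x - w (- x)) + norm (g x - w (- x)) powr q) < \<epsilon>"
    using continuous_approximation_fixing_interval[OF q _ _ c' i' q' \<epsilon>] ab bc by auto
  let ?h = "\<lambda>x. norm (g (- x) - w x) + norm (g (- x) - w x) powr q"
  show thesis
  proof (rule that)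
    show "continuous_on UNIV (\<lambda>x. g (- x))"
      by (rule continuous_on_compose2[OF g(1)]) (auto intro!: continuous_intros)
    show "g (- x) = w x" if "x \<in> {b..c}" for x using g(2)[of "- x"] that by simp
    show "?h integrable_on {a..c}"
      using g(3) Henstock_Kurzweil_Integration.integrable_reflect_real[of ?h c a] by simp
    show "integral {a..c} ?h < \<epsilon>"
      using g(4) Henstock_Kurzweil_Integration.integral_reflect_real[of c a ?h] by simp
  qed
qed

text \<open>The geometric rate makes the increments of the sequence summable in the mean, which is what
  \<open>L1_fast_Cauchy_limit\<close> asks for.\<close>

lemma approximating_sequence:
  fixes w :: "real \<Rightarrow> complex ^ 'n"
  assumes "\<And>\<epsilon>::real. \<epsilon> > 0 \<Longrightarrow> \<exists>g. continuous_on UNIV g \<and> (\<forall>x\<in>S. g x = w x) \<and>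
      (\<lambda>x. norm (g x - w x) + norm (g x - w x) powr q) integrable_on {A..B} \<and>
      integral {A..B} (\<lambda>x. norm (g x - w x) + norm (g x - w x) powr q) < \<epsilon>"
    and w: "w absolutely_integrable_on {A..B}"
  obtains w' where "\<And>k. continuous_on UNIV (w' k)" "\<And>k x. x \<in> S \<Longrightarrow> w' k x = w x"
    "\<And>k. (\<lambda>x. norm (w' k x - w x) powr q) integrable_on {A..B}"
    "\<And>k. integral {A..B} (\<lambda>x. norm (w' k x - w x) powr q) \<le> (1/2) ^ k"
    "\<And>k i. integral {A..B} (\<lambda>x. norm (w' k x $ i - w x $ i)) \<le> (1/2) ^ k"
proof -
  have "\<forall>k. \<exists>g. continuous_on UNIV g \<and> (\<forall>x\<in>S. g x = w x) \<and>
      (\<lambda>x. norm (g x - w x) + norm (g x - w x) powr q) integrable_on {A..B} \<and>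
      integral {A..B} (\<lambda>x. norm (g x - w x) + norm (g x - w x) powr q) < (1/2) ^ k"
    by (intro allI assms(1)) simp
  then obtain w' where "\<forall>k. continuous_on UNIV (w' k) \<and> (\<forall>x\<in>S. w' k x = w x) \<and>
      (\<lambda>x. norm (w' k x - w x) + norm (w' k x - w x) powr q) integrable_on {A..B} \<and>
      integral {A..B} (\<lambda>x. norm (w' k x - w x) + norm (w' k x - w x) powr q) < (1/2) ^ k"
    unfolding choice_iff by (elim exE)
  then have c: "\<And>k. continuous_on UNIV (w' k)" and eq: "\<And>k x. x \<in> S \<Longrightarrow> w' k x = w x"
    and i: "\<And>k. (\<lambda>x. norm (w' k x - w x) + norm (w' k x - w x) powr q) integrable_on {A..B}"
    and l: "\<And>k. integral {A..B} (\<lambda>x. norm (w' k x - w x) + norm (w' k x - w x) powr q) < (1/2) ^ k"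
    by blast+
  have d: "(\<lambda>x. w' k x - w x) absolutely_integrable_on {A..B}" for k
    by (intro set_integral_diff(1) w absolutely_integrable_continuous_real continuous_on_subset[OF c]) auto
  then have dn: "(\<lambda>x. norm (w' k x - w x)) integrable_on {A..B}" for k by (simp add: absolutely_integrable_on_def)
  have dq: "(\<lambda>x. norm (w' k x - w x) powr q) integrable_on {A..B}" for k
    using integrable_diff[OF i dn, of k k] by simp
  have l1: "integral {A..B} (\<lambda>x. norm (w' k x - w x)) \<le> (1/2) ^ k" for k
    by (rule order_trans[OF integral_le[OF dn i] less_imp_le[OF l]]) simp
  show thesis
  proof (rule that[OF c eq dq])
    show "integral {A..B} (\<lambda>x. norm (w' k x - w x) powr q) \<le> (1/2) ^ k" for k
      by (rule order_trans[OF integral_le[OF dq i] less_imp_le[OF l]]) simp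
    show "integral {A..B} (\<lambda>x. norm (w' k x $ i - w x $ i)) \<le> (1/2) ^ k" for k i
    proof (rule order_trans[OF integral_le[OF _ dn] l1])
      show "(\<lambda>x. norm (w' k x $ i - w x $ i)) integrable_on {A..B}"
        using absolutely_integrable_vec_nth[OF d, of k i] by (simp add: absolutely_integrable_on_def)
      show "norm (w' k x $ i - w x $ i) \<le> norm (w' k x - w x)" for x
        using Finite_Cartesian_Product.norm_nth_le[of "w' k x - w x" i] by simp
    qed
  qed
qed

section \<open>Lebesgue spaces with an atom at zero\<close>

lemma nn_integral_leb_dirac0:
  assumes f: "f \<in> borel_measurable (lebesgue_on S)" and S: "0 \<in> S"
  shows "(\<integral>\<^sup>+x. f x \<partial>leb_dirac0 S) = (\<integral>\<^sup>+x. f x \<partial>lebesgue_on S) + f 0"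
  using f
proof (induction rule: borel_measurable_induct)
  case (cong f g)
  have "(\<integral>\<^sup>+x. f x \<partial>leb_dirac0 S) = (\<integral>\<^sup>+x. g x \<partial>leb_dirac0 S)"
    "(\<integral>\<^sup>+x. f x \<partial>lebesgue_on S) = (\<integral>\<^sup>+x. g x \<partial>lebesgue_on S)" "f 0 = g 0"
    using cong(3) S by (auto intro!: nn_integral_cong)
  with cong show ?case by simp
next
  case (set A)
  then show ?case by (simp add: emeasure_leb_dirac0)
next
  case (mult u c)
  then have "u \<in> borel_measurable (leb_dirac0 S)" by (simp cong: measurable_cong_sets)
  with mult show ?case by (simp add: nn_integral_cmult distrib_left)
next
  case (add u v)
  then have "u \<in> borel_measurable (leb_dirac0 S)" "v \<in> borel_measurable (leb_dirac0 S)" by (simp_all cong: measurable_cong_sets)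
  with add show ?case by (simp add: nn_integral_add add_ac)
next
  case (seq U)
  have inc: "incseq U" by fact
  have mU: "U i \<in> borel_measurable (lebesgue_on S)" for i by fact
  have IH: "(\<integral>\<^sup>+x. U i x \<partial>leb_dirac0 S) = (\<integral>\<^sup>+x. U i x \<partial>lebesgue_on S) + U i 0" for i by fact
  have m: "U i \<in> borel_measurable (leb_dirac0 S)" for i using mU[of i] by (simp cong: measurable_cong_sets)
  have "(\<integral>\<^sup>+x. (SUP i. U i) x \<partial>leb_dirac0 S) = (SUP i. \<integral>\<^sup>+x. U i x \<partial>leb_dirac0 S)"
    unfolding SUP_apply by (rule nn_integral_monotone_convergence_SUP[OF inc m])
  also have "\<dots> = (SUP i. (\<integral>\<^sup>+x. U i x \<partial>lebesgue_on S) + U i 0)"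
    by (simp add: IH)
  also have "\<dots> = (SUP i. (\<integral>\<^sup>+x. U i x \<partial>lebesgue_on S)) + (SUP i. U i 0)"
    by (rule ennreal_SUP_add)
      (use inc in \<open>auto simp: incseq_def le_fun_def intro!: nn_integral_mono\<close>)
  also have "(SUP i. (\<integral>\<^sup>+x. U i x \<partial>lebesgue_on S)) = (\<integral>\<^sup>+x. (SUP i. U i) x \<partial>lebesgue_on S)"
    unfolding SUP_apply by (rule nn_integral_monotone_convergence_SUP[OF inc mU, symmetric])
  finally show ?case by (simp add: SUP_apply image_comp)
qed

lemma Lp_fun_leb_dirac0:
  fixes f :: "real \<Rightarrow> 'b::euclidean_space"
  assumes f: "f \<in> Lp_fun q (lebesgue_on S)" and S: "0 \<in> S"
  shows "f \<in> Lp_fun q (leb_dirac0 S)"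
    and "(\<integral>x. norm (f x) powr q \<partial>leb_dirac0 S) = (\<integral>x. norm (f x) powr q \<partial>lebesgue_on S) + norm (f 0) powr q"
proof -
  let ?h = "\<lambda>x. norm (f x) powr q"
  have fm: "f \<in> borel_measurable (lebesgue_on S)" and hi: "integrable (lebesgue_on S) ?h"
    using f by (auto simp: Lp_fun_def)
  have hm: "?h \<in> borel_measurable (lebesgue_on S)" by (rule borel_measurable_integrable[OF hi])
  have m: "f \<in> borel_measurable (leb_dirac0 S)" "?h \<in> borel_measurable (leb_dirac0 S)"
    using fm hm by (simp_all cong: measurable_cong_sets)
  have "(\<integral>\<^sup>+x. ennreal (?h x) \<partial>leb_dirac0 S) = (\<integral>\<^sup>+x. ennreal (?h x) \<partial>lebesgue_on S) + ennreal (?h 0)"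
    by (rule nn_integral_leb_dirac0[OF measurable_compose[OF hm measurable_ennreal] S])
  also have "(\<integral>\<^sup>+x. ennreal (?h x) \<partial>lebesgue_on S) = ennreal (\<integral>x. ?h x \<partial>lebesgue_on S)"
    by (rule nn_integral_eq_integral[OF hi]) simp
  finally have nn: "(\<integral>\<^sup>+x. ennreal (?h x) \<partial>leb_dirac0 S) = ennreal ((\<integral>x. ?h x \<partial>lebesgue_on S) + ?h 0)"
    by (simp add: ennreal_plus)
  have hbi: "has_bochner_integral (leb_dirac0 S) ?h ((\<integral>x. ?h x \<partial>lebesgue_on S) + ?h 0)"
    by (rule has_bochner_integral_nn_integral[OF m(2) _ _ nn]) auto
  then show "f \<in> Lp_fun q (leb_dirac0 S)" using m(1) by (simp add: Lp_fun_def has_bochner_integral_iff)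
  show "(\<integral>x. ?h x \<partial>leb_dirac0 S) = (\<integral>x. ?h x \<partial>lebesgue_on S) + ?h 0"
    using hbi by (simp add: has_bochner_integral_iff)
qed

text \<open>On a bounded interval, \<open>norm y \<le> 1 + norm y powr q\<close> turns \<open>q\<close>-integrability into integrability.\<close>

lemma Lp_fun_Icc_iff:
  fixes f :: "real \<Rightarrow> 'b::euclidean_space"
  assumes q: "1 \<le> q"
  shows "f \<in> Lp_fun q (lebesgue_on {a..b}) \<longleftrightarrow>
    f absolutely_integrable_on {a..b} \<and> (\<lambda>x. norm (f x) powr q) integrable_on {a..b}"
proof
  assume "f \<in> Lp_fun q (lebesgue_on {a..b})"
  then have fm: "f \<in> borel_measurable (lebesgue_on {a..b})" and hi: "integrable (lebesgue_on {a..b}) (\<lambda>x. norm (f x) powr q)"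
    by (auto simp: Lp_fun_def)
  have "integrable (lebesgue_on {a..b}) (\<lambda>x. 1::real)"
    using absolutely_integrable_continuous_real[of a b "\<lambda>_. 1::real"] by (simp add: absolutely_integrable_on_iff_integrable)
  then have "integrable (lebesgue_on {a..b}) (\<lambda>x. 1 + norm (f x) powr q)"
    by (intro Bochner_Integration.integrable_add hi)
  then have "integrable (lebesgue_on {a..b}) f"
    by (rule Bochner_Integration.integrable_bound[OF _ fm]) (use le_one_plus_powr[OF norm_ge_zero q] in auto)
  with hi show "f absolutely_integrable_on {a..b} \<and> (\<lambda>x. norm (f x) powr q) integrable_on {a..b}"
    by (subst nonneg_integrable_on_iff) (auto simp: absolutely_integrable_on_iff_integrable)
next
  assume "f absolutely_integrable_on {a..b} \<and> (\<lambda>x. norm (f x) powr q) integrable_on {a..b}"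
  then show "f \<in> Lp_fun q (lebesgue_on {a..b})"
    unfolding Lp_fun_def by (subst (asm) nonneg_integrable_on_iff) (auto simp: absolutely_integrable_on_iff_integrable)
qed

text \<open>The atom at \<open>0\<close> picks out the value of \<open>w\<close> at \<open>t\<close>, so the norm of a translate depends on \<open>w\<close> as a
  function and not only on its equivalence class.\<close>

lemma Lp_fun_translate:
  fixes w :: "real \<Rightarrow> complex ^ 'n"
  assumes q: "1 \<le> q" and w: "w \<in> Lp_fun q (lebesgue_on {A..B})"
    and t: "A \<le> t + c" "t + d \<le> B" and cd: "c \<le> 0" "0 \<le> d"
  shows "translate w t \<in> Lp_fun q (leb_dirac0 {c..d})"
    and "Lp_norm q (leb_dirac0 {c..d}) (translate w t) \<le>
      (integral {A..B} (\<lambda>x. norm (w x) powr q) + norm (w t) powr q) powr (1 / q)"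
proof -
  let ?h = "\<lambda>x. norm (w x) powr q"
  have wi: "w absolutely_integrable_on {A..B}" and hi: "?h integrable_on {A..B}"
    using w Lp_fun_Icc_iff[OF q] by auto
  have sub: "{t + c..t + d} \<subseteq> {A..B}" using t by auto
  have "w absolutely_integrable_on {t + c..t + d}"
    by (rule absolutely_integrable_on_subinterval[OF wi sub])
  then have "(\<lambda>x. w (x + t)) absolutely_integrable_on {c..d}"
    unfolding absolutely_integrable_on_def
    using integrable_shift_real_ivl[of w "t + c" "t + d" t] integrable_shift_real_ivl[of "\<lambda>x. norm (w x)" "t + c" "t + d" t]
    by simp
  moreover have hs: "?h integrable_on {t + c..t + d}" by (rule integrable_subinterval_real[OF hi sub])
  then have "(\<lambda>x. ?h (x + t)) integrable_on {c..d}"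
    using integrable_shift_real_ivl[of ?h "t + c" "t + d" t] by simp
  ultimately have L: "translate w t \<in> Lp_fun q (lebesgue_on {c..d})"
    using Lp_fun_Icc_iff[OF q, of "translate w t" c d] by (simp add: translate_def add.commute)
  have 0: "0 \<in> {c..d}" using cd by simp
  show "translate w t \<in> Lp_fun q (leb_dirac0 {c..d})" by (rule Lp_fun_leb_dirac0(1)[OF L 0])
  have Li: "integrable (lebesgue_on {c..d}) (\<lambda>x. norm (translate w t x) powr q)" using L by (simp add: Lp_fun_def)
  have "(\<integral>x. norm (translate w t x) powr q \<partial>lebesgue_on {c..d}) = integral {c..d} (\<lambda>x. norm (translate w t x) powr q)"
    by (rule lebesgue_integral_eq_integral[OF Li]) simp
  also have "\<dots> = integral {t + c..t + d} ?h"
    using integral_shift_real_ivl[of "t + c" t "t + d" ?h] by (simp add: translate_def add.commute)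
  also have "\<dots> \<le> integral {A..B} ?h" by (rule integral_subset_le[OF sub hs hi]) simp
  finally have "(\<integral>x. norm (translate w t x) powr q \<partial>leb_dirac0 {c..d}) \<le> integral {A..B} ?h + ?h t"
    unfolding Lp_fun_leb_dirac0(2)[OF L 0] by (simp add: translate_def)
  then show "Lp_norm q (leb_dirac0 {c..d}) (translate w t) \<le> (integral {A..B} ?h + ?h t) powr (1 / q)"
    unfolding Lp_norm_def using q by (intro powr_mono2) auto
qed

lemma continuous_Lp_fun:
  fixes g :: "real \<Rightarrow> 'b::euclidean_space"
  assumes q: "1 \<le> q" and g: "continuous_on UNIV g"
  shows "g \<in> Lp_fun q (lebesgue_on {a..b})"
proof -
  have gc: "continuous_on {a..b} g" using g by (rule continuous_on_subset) simp
  have "continuous_on {a..b} (\<lambda>x. norm (g x) powr q)"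
    using q by (intro continuous_on_powr' continuous_on_norm gc continuous_on_const) auto
  then show ?thesis
    unfolding Lp_fun_Icc_iff[OF q] by (intro conjI absolutely_integrable_continuous_real gc integrable_continuous_real)
qed

text \<open>Write \<open>\<psi>' k = \<delta> k + \<psi>\<close> and \<open>\<phi>' k = \<gamma> k + \<phi>\<close> and expand by bilinearity; all terms but
  \<open>Bt \<psi> \<phi>\<close> contain a factor whose norm tends to \<open>0\<close>.\<close>

lemma bounded_bilinear_extension_tendsto:
  assumes ext: "is_bounded_bilinear_extension r \<eta> p q Bt"
    and \<psi>: "\<psi> \<in> Mq_star r q" "\<And>k. (\<lambda>x. \<psi>' k x - \<psi> x) \<in> Mq_star r q"
      "(\<lambda>k. Lp_norm q (leb_dirac0 {0..r}) (\<lambda>x. \<psi>' k x - \<psi> x)) \<longlonglongrightarrow> 0"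
    and \<phi>: "\<phi> \<in> Mp r p" "\<And>k. \<phi>' k \<in> Mp r p" "\<And>k. (\<lambda>x. \<phi>' k x - \<phi> x) \<in> Mp r p"
      "(\<lambda>k. Lp_norm p (leb_dirac0 {- r..0}) (\<lambda>x. \<phi>' k x - \<phi> x)) \<longlonglongrightarrow> 0"
  shows "(\<lambda>k. Bt (\<psi>' k) (\<phi>' k)) \<longlonglongrightarrow> Bt \<psi> \<phi>"
proof -
  define \<delta> where "\<delta> = (\<lambda>k x. \<psi>' k x - \<psi> x)"
  define \<gamma> where "\<gamma> = (\<lambda>k x. \<phi>' k x - \<phi> x)"
  note E = ext[unfolded is_bounded_bilinear_extension_def]
  from E obtain K where K: "\<forall>\<psi>\<in>Mq_star r q. \<forall>\<phi>\<in>Mp r p. norm (Bt \<psi> \<phi>) \<le>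
          K * Lp_norm q (leb_dirac0 {0..r}) \<psi> * Lp_norm p (leb_dirac0 {- r..0}) \<phi>"
    by (elim conjE exE)
  have lin1: "Bt (\<lambda>x. 1 *s \<psi>1 x + \<psi>2 x) \<phi> = 1 * Bt \<psi>1 \<phi> + Bt \<psi>2 \<phi>"
    if "\<psi>1 \<in> Mq_star r q" "\<psi>2 \<in> Mq_star r q" "\<phi> \<in> Mp r p" for \<psi>1 \<psi>2 \<phi>
    using conjunct1[OF E] that by blast
  have lin2: "Bt \<psi> (\<lambda>x. 1 *s \<phi>1 x + \<phi>2 x) = 1 * Bt \<psi> \<phi>1 + Bt \<psi> \<phi>2"
    if "\<psi> \<in> Mq_star r q" "\<phi>1 \<in> Mp r p" "\<phi>2 \<in> Mp r p" for \<psi> \<phi>1 \<phi>2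
    using conjunct1[OF conjunct2[OF E]] that by blast
  have \<delta>: "\<delta> k \<in> Mq_star r q" for k using \<psi>(2) by (simp add: \<delta>_def)
  have \<gamma>: "\<gamma> k \<in> Mp r p" for k using \<phi>(3) by (simp add: \<gamma>_def)
  have split: "Bt (\<psi>' k) (\<phi>' k) = Bt (\<delta> k) (\<gamma> k) + Bt (\<delta> k) \<phi> + Bt \<psi> (\<gamma> k) + Bt \<psi> \<phi>" for k
  proof -
    have "\<psi>' k = (\<lambda>x. 1 *s \<delta> k x + \<psi> x)" by (simp add: \<delta>_def fun_eq_iff)
    then have "Bt (\<psi>' k) (\<phi>' k) = Bt (\<delta> k) (\<phi>' k) + Bt \<psi> (\<phi>' k)"
      using lin1[OF \<delta> \<psi>(1) \<phi>(2), of k k] by simp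
    moreover have "\<phi>' k = (\<lambda>x. 1 *s \<gamma> k x + \<phi> x)" by (simp add: \<gamma>_def fun_eq_iff)
    then have "Bt (\<delta> k) (\<phi>' k) = Bt (\<delta> k) (\<gamma> k) + Bt (\<delta> k) \<phi>" "Bt \<psi> (\<phi>' k) = Bt \<psi> (\<gamma> k) + Bt \<psi> \<phi>"
      using lin2[OF \<delta> \<gamma> \<phi>(1), of k k] lin2[OF \<psi>(1) \<gamma> \<phi>(1), of k] by simp_all
    ultimately show ?thesis by simp
  qed
  let ?nq = "Lp_norm q (leb_dirac0 {0..r})" and ?np = "Lp_norm p (leb_dirac0 {- r..0})"
  have n\<delta>: "(\<lambda>k. ?nq (\<delta> k)) \<longlonglongrightarrow> 0" and n\<gamma>: "(\<lambda>k. ?np (\<gamma> k)) \<longlonglongrightarrow> 0"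
    using \<psi>(3) \<phi>(4) by (simp_all add: \<delta>_def \<gamma>_def)
  have 1: "(\<lambda>k. Bt (\<delta> k) (\<gamma> k)) \<longlonglongrightarrow> 0"
  proof (rule Lim_null_comparison)
    show "\<forall>\<^sub>F k in sequentially. norm (Bt (\<delta> k) (\<gamma> k)) \<le> K * ?nq (\<delta> k) * ?np (\<gamma> k)"
      using K \<delta> \<gamma> by simp
    show "(\<lambda>k. K * ?nq (\<delta> k) * ?np (\<gamma> k)) \<longlonglongrightarrow> 0"
      using tendsto_mult[OF tendsto_mult[OF tendsto_const[of K] n\<delta>] n\<gamma>] by simp
  qed
  have 2: "(\<lambda>k. Bt (\<delta> k) \<phi>) \<longlonglongrightarrow> 0"
  proof (rule Lim_null_comparison)
    show "\<forall>\<^sub>F k in sequentially. norm (Bt (\<delta> k) \<phi>) \<le> K * ?nq (\<delta> k) * ?np \<phi>"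
      using K \<delta> \<phi>(1) by simp
    show "(\<lambda>k. K * ?nq (\<delta> k) * ?np \<phi>) \<longlonglongrightarrow> 0"
      using tendsto_mult[OF tendsto_mult[OF tendsto_const[of K] n\<delta>] tendsto_const[of "?np \<phi>"]] by simp
  qed
  have 3: "(\<lambda>k. Bt \<psi> (\<gamma> k)) \<longlonglongrightarrow> 0"
  proof (rule Lim_null_comparison)
    show "\<forall>\<^sub>F k in sequentially. norm (Bt \<psi> (\<gamma> k)) \<le> K * ?nq \<psi> * ?np (\<gamma> k)"
      using K \<psi>(1) \<gamma> by simp
    show "(\<lambda>k. K * ?nq \<psi> * ?np (\<gamma> k)) \<longlonglongrightarrow> 0"
      using tendsto_mult[OF tendsto_const[of "K * ?nq \<psi>"] n\<gamma>] by simp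
  qed
  show ?thesis
    unfolding split using tendsto_add[OF tendsto_add[OF tendsto_add[OF 1 2] 3] tendsto_const[of "Bt \<psi> \<phi>"]] by simp
qed

text \<open>The approximations take the exact value at \<open>t\<close>, so the atom contributes nothing to the distance.\<close>

lemma translate_approximation_tendsto:
  fixes w :: "real \<Rightarrow> complex ^ 'n" and w' :: "nat \<Rightarrow> real \<Rightarrow> complex ^ 'n"
  assumes q: "1 \<le> q" and w: "w \<in> Lp_fun q (lebesgue_on {A..B})"
    and w': "\<And>k. continuous_on UNIV (w' k)" and wt: "\<And>k. w' k t = w t"
    and int: "\<And>k. (\<lambda>x. norm (w' k x - w x) powr q) integrable_on {A..B}"
    and fast: "\<And>k. integral {A..B} (\<lambda>x. norm (w' k x - w x) powr q) \<le> (1/2) ^ k"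
    and t: "A \<le> t + c" "t + d \<le> B" and cd: "c \<le> 0" "0 \<le> d"
  shows "translate w t \<in> Lp_fun q (leb_dirac0 {c..d})"
    and "translate (w' k) t \<in> Lp_fun q (leb_dirac0 {c..d})"
    and "(\<lambda>x. translate (w' k) t x - translate w t x) \<in> Lp_fun q (leb_dirac0 {c..d})"
    and "(\<lambda>k. Lp_norm q (leb_dirac0 {c..d}) (\<lambda>x. translate (w' k) t x - translate w t x)) \<longlonglongrightarrow> 0"
proof -
  have eq: "(\<lambda>x. translate (w' k) t x - translate w t x) = translate (\<lambda>x. w' k x - w x) t" for k
    by (simp add: translate_def)
  have dL: "(\<lambda>x. w' k x - w x) \<in> Lp_fun q (lebesgue_on {A..B})" for k
    using w continuous_Lp_fun[OF q w', of k A B] int unfolding Lp_fun_Icc_iff[OF q]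
    by (intro conjI set_integral_diff(1)) auto
  show "translate w t \<in> Lp_fun q (leb_dirac0 {c..d})"
    by (rule Lp_fun_translate(1)[OF q w t cd])
  show "translate (w' k) t \<in> Lp_fun q (leb_dirac0 {c..d})"
    by (rule Lp_fun_translate(1)[OF q continuous_Lp_fun[OF q w'] t cd])
  show "(\<lambda>x. translate (w' k) t x - translate w t x) \<in> Lp_fun q (leb_dirac0 {c..d})"
    unfolding eq by (rule Lp_fun_translate(1)[OF q dL t cd])
  show "(\<lambda>k. Lp_norm q (leb_dirac0 {c..d}) (\<lambda>x. translate (w' k) t x - translate w t x)) \<longlonglongrightarrow> 0"
  proof (rule Lim_null_comparison)
    have "norm (Lp_norm q (leb_dirac0 {c..d}) (\<lambda>x. translate (w' k) t x - translate w t x)) \<le> ((1/2) ^ k) powr (1/q)" for k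
    proof -
      have "Lp_norm q (leb_dirac0 {c..d}) (translate (\<lambda>x. w' k x - w x) t) \<le>
          (integral {A..B} (\<lambda>x. norm (w' k x - w x) powr q) + norm (w' k t - w t) powr q) powr (1/q)"
        by (rule Lp_fun_translate(2)[OF q dL t cd])
      also have "\<dots> = integral {A..B} (\<lambda>x. norm (w' k x - w x) powr q) powr (1/q)" by (simp add: wt)
      also have "\<dots> \<le> ((1/2) ^ k) powr (1/q)"
        using q fast[of k] by (intro powr_mono2 integral_nonneg int) auto
      finally show ?thesis unfolding eq by (simp add: Lp_norm_def)
    qed
    then show "\<forall>\<^sub>F k in sequentially. norm (Lp_norm q (leb_dirac0 {c..d}) (\<lambda>x. translate (w' k) t x - translate w t x)) \<le> ((1/2) ^ k) powr (1/q)"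
      by simp
    show "(\<lambda>k. ((1/2) ^ k) powr (1/q)) \<longlonglongrightarrow> (0::real)"
      using q by (intro tendsto_zero_powrI[OF _ tendsto_const] LIMSEQ_power_zero) auto
  qed
qed

section \<open>Stieltjes integrals of translates of integrable functions\<close>

text \<open>The telescoping series of the increments \<open>d k\<close> converges absolutely almost everywhere, and the sum of
  their norms is an integrable majorant of all remainders.\<close>

lemma L1_fast_Cauchy_limit:
  fixes f :: "nat \<Rightarrow> 'a \<Rightarrow> 'b::{banach, second_countable_topology}"
  assumes f: "\<And>k. integrable M (f k)" and fast: "\<And>k. (\<integral>x. norm (f (Suc k) x - f k x) \<partial>M) \<le> C * (1/2) ^ k"
  obtains g where "integrable M g" "(\<lambda>k. \<integral>x. norm (f k x - g x) \<partial>M) \<longlonglongrightarrow> 0"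
proof -
  define d where "d = (\<lambda>k x. f (Suc k) x - f k x)"
  have d: "integrable M (d k)" for k unfolding d_def by (intro Bochner_Integration.integrable_diff f)
  have dn: "integrable M (\<lambda>x. norm (d k x))" for k by (intro integrable_norm d)
  have sum: "summable (\<lambda>k. \<integral>x. norm (d k x) \<partial>M)"
  proof (rule summable_comparison_test')
    show "summable (\<lambda>k. C * (1/2::real) ^ k)" by (intro summable_mult summable_geometric) simp
    show "norm (\<integral>x. norm (d k x) \<partial>M) \<le> C * (1/2) ^ k" for k
      using fast[of k] by (simp add: d_def)
  qed
  have [measurable]: "d k \<in> borel_measurable M" for k by (rule borel_measurable_integrable[OF d])
  have AE: "AE x in M. summable (\<lambda>k. norm (d k x))"
  proof -
    have "(\<integral>\<^sup>+x. (\<Sum>k. ennreal (norm (d k x))) \<partial>M) = (\<Sum>k. \<integral>\<^sup>+x. ennreal (norm (d k x)) \<partial>M)"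
      by (rule nn_integral_suminf) measurable
    also have "\<dots> = (\<Sum>k. ennreal (\<integral>x. norm (d k x) \<partial>M))"
      by (intro suminf_cong nn_integral_eq_integral dn) auto
    also have "\<dots> = ennreal (\<Sum>k. \<integral>x. norm (d k x) \<partial>M)"
      by (rule suminf_ennreal2[OF _ sum]) simp
    finally have "(\<integral>\<^sup>+x. (\<Sum>k. ennreal (norm (d k x))) \<partial>M) \<noteq> \<infinity>" by simp
    then have "AE x in M. (\<Sum>k. ennreal (norm (d k x))) \<noteq> \<infinity>" by (intro nn_integral_PInf_AE) auto
    then show ?thesis by eventually_elim (rule summable_suminf_not_top, auto)
  qed
  have AE': "AE x in M. summable (\<lambda>k. norm (norm (d k x)))" using AE by simp
  define g where "g = (\<lambda>x. f 0 x + (\<Sum>k. d k x))"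
  have g: "integrable M g"
    unfolding g_def by (intro Bochner_Integration.integrable_add f integrable_suminf d AE sum)
  have S: "integrable M (\<lambda>x. \<Sum>k. norm (d k x))"
    by (rule integrable_suminf[OF dn AE']) (simp add: sum)
  have tele: "f k x = f 0 x + (\<Sum>j<k. d j x)" for k x
    by (induction k) (auto simp: d_def)
  have [measurable]: "f k \<in> borel_measurable M" "g \<in> borel_measurable M" for k
    by (rule borel_measurable_integrable[OF f], rule borel_measurable_integrable[OF g])
  have "(\<lambda>k. \<integral>x. norm (f k x - g x) \<partial>M) \<longlonglongrightarrow> (\<integral>x. 0 \<partial>M)"
  proof (rule integral_dominated_convergence[where w = "\<lambda>x. \<Sum>k. norm (d k x)"])
    show "AE x in M. (\<lambda>k. norm (f k x - g x)) \<longlonglongrightarrow> 0"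
      using AE
    proof eventually_elim
      case (elim x)
      have "(\<lambda>k. \<Sum>j<k. d j x) \<longlonglongrightarrow> (\<Sum>k. d k x)"
        by (rule summable_LIMSEQ[OF summable_norm_cancel[OF elim]])
      then have "(\<lambda>k. f 0 x + (\<Sum>j<k. d j x)) \<longlonglongrightarrow> g x"
        unfolding g_def by (intro tendsto_add tendsto_const)
      then have "(\<lambda>k. f k x) \<longlonglongrightarrow> g x" by (simp only: tele[symmetric])
      then show ?case by (simp add: tendsto_norm_zero LIM_zero)
    qed
    show "AE x in M. norm (norm (f k x - g x)) \<le> (\<Sum>k. norm (d k x))" for k
      using AE
    proof eventually_elim
      case (elim x)
      have sd: "summable (\<lambda>k. d k x)" by (rule summable_norm_cancel[OF elim])
      have "g x - f k x = (\<Sum>j. d (j + k) x)"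
        by (subst tele[of k x]) (simp add: g_def suminf_split_initial_segment[OF sd, of k])
      then have "norm (f k x - g x) = norm (\<Sum>j. d (j + k) x)" by (metis norm_minus_commute)
      also have "\<dots> \<le> (\<Sum>j. norm (d (j + k) x))"
        by (rule summable_norm) (rule summable_ignore_initial_segment[OF elim])
      also have "\<dots> \<le> (\<Sum>j. norm (d j x))"
        using suminf_split_initial_segment[OF elim, of k] by (simp add: sum_nonneg)
      finally show ?case by simp
    qed
  qed (use S in measurable)
  with g show thesis by (intro that) simp_all
qed

lemma continuous_mult_absolutely_integrable:
  fixes c G :: "real \<Rightarrow> complex"
  assumes c: "continuous_on {a..b} c" and G: "G absolutely_integrable_on {a..b}"
  shows "(\<lambda>x. c x * G x) absolutely_integrable_on {a..b}"
proof (rule absolutely_integrable_bounded_measurable_product[OF bilinear_times _ _ _ G])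
  show "c \<in> borel_measurable (lebesgue_on {a..b})" using c by (rule continuous_imp_measurable_on_sets_lebesgue) auto
  show "bounded (c ` {a..b})" using c by (intro compact_imp_bounded compact_continuous_image) auto
qed auto

lemma tendsto_weighted_integral:
  fixes f :: "nat \<Rightarrow> real \<Rightarrow> complex"
  assumes f: "\<And>k. f k absolutely_integrable_on {a..b}" and G: "G absolutely_integrable_on {a..b}"
    and c: "continuous_on {a..b} c" and lim: "(\<lambda>k. integral {a..b} (\<lambda>s. norm (f k s - G s))) \<longlonglongrightarrow> 0"
    and t: "t \<in> {a..b}"
  shows "(\<lambda>k. integral {a..t} (\<lambda>s. c s * f k s)) \<longlonglongrightarrow> integral {a..t} (\<lambda>s. c s * G s)"
proof -
  obtain M where "M > 0" and M': "\<forall>y\<in>c ` {a..b}. norm y \<le> M"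
    using compact_imp_bounded[OF compact_continuous_image[OF c compact_Icc]] unfolding bounded_pos by blast
  have sub: "{a..t} \<subseteq> {a..b}" using t by auto
  have ci: "(\<lambda>s. c s * h s) integrable_on {a..t}" if "h absolutely_integrable_on {a..b}" for h
    by (rule absolutely_integrable_integrable_subinterval[OF continuous_mult_absolutely_integrable[OF c that] sub])
  have d: "(\<lambda>s. f k s - G s) absolutely_integrable_on {a..b}" for k by (intro set_integral_diff f G)
  then have dn: "(\<lambda>s. norm (f k s - G s)) integrable_on {a..b}" for k by (simp add: absolutely_integrable_on_def)
  have "(\<lambda>k. integral {a..t} (\<lambda>s. c s * f k s) - integral {a..t} (\<lambda>s. c s * G s)) \<longlonglongrightarrow> 0"
  proof (rule Lim_null_comparison)
    show "(\<lambda>k. M * integral {a..b} (\<lambda>s. norm (f k s - G s))) \<longlonglongrightarrow> 0"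
      using tendsto_mult[OF tendsto_const[of M] lim] by simp
    have "norm (integral {a..t} (\<lambda>s. c s * f k s) - integral {a..t} (\<lambda>s. c s * G s)) \<le> M * integral {a..b} (\<lambda>s. norm (f k s - G s))" for k
    proof -
      have "integral {a..t} (\<lambda>s. c s * f k s) - integral {a..t} (\<lambda>s. c s * G s) = integral {a..t} (\<lambda>s. c s * f k s - c s * G s)"
        by (intro integral_diff[symmetric] ci f G)
      also have "norm \<dots> \<le> integral {a..t} (\<lambda>s. M * norm (f k s - G s))"
      proof (rule integral_norm_bound_integral)
        show "(\<lambda>s. c s * f k s - c s * G s) integrable_on {a..t}" by (intro integrable_diff ci f G)
        show "(\<lambda>s. M * norm (f k s - G s)) integrable_on {a..t}"
          using integrable_cmul[OF integrable_subinterval_real[OF dn sub], of M] by simp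
        show "norm (c s * f k s - c s * G s) \<le> M * norm (f k s - G s)" if "s \<in> {a..t}" for s
        proof -
          have "norm (c s * f k s - c s * G s) = norm (c s) * norm (f k s - G s)"
            by (simp only: norm_mult[symmetric] right_diff_distrib)
          also have "\<dots> \<le> M * norm (f k s - G s)" using M' that sub by (intro mult_right_mono) auto
          finally show ?thesis .
        qed
      qed
      also have "\<dots> = M * integral {a..t} (\<lambda>s. norm (f k s - G s))" by simp
      also have "\<dots> \<le> M * integral {a..b} (\<lambda>s. norm (f k s - G s))"
        using \<open>M > 0\<close> by (intro mult_left_mono integral_subset_le[OF sub integrable_subinterval_real[OF dn sub] dn]) auto
      finally show ?thesis .
    qed
    then show "\<forall>\<^sub>F k in sequentially. norm (integral {a..t} (\<lambda>s. c s * f k s) - integral {a..t} (\<lambda>s. c s * G s))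
        \<le> M * integral {a..b} (\<lambda>s. norm (f k s - G s))" by simp
  qed
  then show ?thesis by (rule LIM_zero_cancel)
qed

text \<open>The map that sends \<open>w\<close> to the function \<open>\<integral> w (s + \<sigma> \<theta>) dg(\<theta>)\<close> of \<open>s\<close> increases the norm in the mean by
  at most the factor \<open>V b - V a\<close>, so the images of the \<open>w' k\<close> converge in the mean. The limit \<open>G\<close> takes
  the place of this integral for the given \<open>w\<close>, for which it may fail to exist at individual points
  \<open>s\<close>. Integration over \<open>s\<close> restores continuity in \<open>\<theta>\<close>, so the indefinite integral of
  \<open>G\<close> is a genuine Stieltjes integral. The sign \<open>\<sigma>\<close> is \<open>-1\<close> for the functional \<^const>\<open>L_star\<close>
  and \<open>1\<close> for \<^const>\<open>L_op\<close>.\<close>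

lemma RS_integral_translate_L1_limit:
  fixes w g :: "real \<Rightarrow> complex" and w' :: "nat \<Rightarrow> real \<Rightarrow> complex"
  assumes V: "variation_majorant a b V g" and ab: "a \<le> b"
    and w': "\<And>k. continuous_on UNIV (w' k)" and w: "w absolutely_integrable_on {A..B}"
    and range: "\<And>s \<theta>. s \<in> {\<alpha>..\<beta>} \<Longrightarrow> \<theta> \<in> {a..b} \<Longrightarrow> s + \<sigma> * \<theta> \<in> {A..B}"
    and fast: "\<And>k. integral {A..B} (\<lambda>x. norm (w' k x - w x)) \<le> (1/2) ^ k"
  obtains G where "G absolutely_integrable_on {\<alpha>..\<beta>}"
    "(\<lambda>k. integral {\<alpha>..\<beta>} (\<lambda>s. norm (RS_integral a b (\<lambda>\<theta>. w' k (s + \<sigma> * \<theta>)) g - G s))) \<longlonglongrightarrow> 0"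
    "\<And>t. t \<in> {\<alpha>..\<beta>} \<Longrightarrow> RS_integral a b (\<lambda>\<theta>. integral {\<alpha>..t} (\<lambda>s. w (s + \<sigma> * \<theta>))) g = integral {\<alpha>..t} G"
proof -
  have shift: "integral {\<alpha>..t} (\<lambda>s. H (s + \<sigma> * \<theta>)) = integral {\<alpha> + \<sigma> * \<theta>..t + \<sigma> * \<theta>} H"
    for H :: "real \<Rightarrow> 'z::euclidean_space" and t \<theta>
    using integral_shift_real_ivl[of "\<alpha> + \<sigma> * \<theta>" "\<sigma> * \<theta>" "t + \<sigma> * \<theta>" H] by simp
  have sub: "{\<alpha> + \<sigma> * \<theta>..t + \<sigma> * \<theta>} \<subseteq> {A..B}" if "t \<in> {\<alpha>..\<beta>}" "\<theta> \<in> {a..b}" for t \<theta>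
    using range[of \<alpha> \<theta>] range[of t \<theta>] that by auto
  have w'a: "w' k absolutely_integrable_on {c..d}" for k c d
    by (intro absolutely_integrable_continuous_real continuous_on_subset[OF w']) auto
  have dn: "(\<lambda>x. norm (w' k x - w x)) integrable_on {A..B}" for k
    using set_integral_diff(1)[OF w'a w] by (simp add: absolutely_integrable_on_def)
  have dn': "(\<lambda>x. norm (w' k x - w' j x)) integrable_on {A..B}" for j k
    by (intro integrable_continuous_real continuous_intros continuous_on_subset[OF w']) auto
  have cauchy: "integral {A..B} (\<lambda>x. norm (w' (Suc k) x - w' k x)) \<le> 2 * (1/2) ^ k" for k
  proof -
    have "integral {A..B} (\<lambda>x. norm (w' (Suc k) x - w' k x)) \<le>
        integral {A..B} (\<lambda>x. norm (w' (Suc k) x - w x) + norm (w' k x - w x))"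
      by (intro integral_le dn' integrable_add dn) (metis norm_triangle_ineq4 diff_diff_eq2 diff_add_cancel)
    also have "\<dots> = integral {A..B} (\<lambda>x. norm (w' (Suc k) x - w x)) + integral {A..B} (\<lambda>x. norm (w' k x - w x))"
      by (intro integral_add dn)
    also have "\<dots> \<le> (1/2) ^ Suc k + (1/2) ^ k" by (intro add_mono fast)
    also have "\<dots> \<le> 2 * (1/2) ^ k" by simp
    finally show ?thesis .
  qed
  have kc: "continuous_on UNIV (\<lambda>(\<theta>, s). w' k (s + \<sigma> * \<theta>))" for k
    unfolding case_prod_beta by (intro continuous_on_compose2[OF w'] continuous_intros) auto
  have kc2: "continuous_on S (\<lambda>\<theta>. w' k (s + \<sigma> * \<theta>))" for k s S
    by (intro continuous_on_compose2[OF w'] continuous_intros) auto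
  have kcd: "continuous_on UNIV (\<lambda>(\<theta>, s). w' (Suc k) (s + \<sigma> * \<theta>) - w' k (s + \<sigma> * \<theta>))" for k
    using continuous_on_diff[OF kc[of "Suc k"] kc[of k]] by (simp add: case_prod_beta)
  define f where "f = (\<lambda>k s. RS_integral a b (\<lambda>\<theta>. w' k (s + \<sigma> * \<theta>)) g)"
  have fc: "continuous_on {\<alpha>..\<beta>} (f k)" for k
    unfolding f_def by (rule continuous_on_RS_integral[OF V ab kc])
  have fa: "f k absolutely_integrable_on {\<alpha>..\<beta>}" for k by (intro absolutely_integrable_continuous_real fc)
  have fd: "f (Suc k) s - f k s = RS_integral a b (\<lambda>\<theta>. w' (Suc k) (s + \<sigma> * \<theta>) - w' k (s + \<sigma> * \<theta>)) g" for k s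
    unfolding f_def by (rule RS_integral_diff[OF V ab kc2 kc2, symmetric])
  have L1: "integral {\<alpha>..\<beta>} (\<lambda>s. norm (f (Suc k) s - f k s)) \<le> 2 * (1/2) ^ k * (V b - V a)" for k
    unfolding fd
  proof (rule RS_integral_of_integral(2)[OF V ab kcd])
    fix \<theta> assume \<theta>: "\<theta> \<in> {a..b}"
    let ?H = "\<lambda>x. norm (w' (Suc k) x - w' k x)"
    show "integral {\<alpha>..\<beta>} (\<lambda>s. norm (w' (Suc k) (s + \<sigma> * \<theta>) - w' k (s + \<sigma> * \<theta>))) \<le> 2 * (1/2) ^ k"
    proof (cases "\<alpha> \<le> \<beta>")
      case True
      then have s: "{\<alpha> + \<sigma> * \<theta>..\<beta> + \<sigma> * \<theta>} \<subseteq> {A..B}" using sub[of \<beta> \<theta>] \<theta> by auto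
      have "integral {\<alpha>..\<beta>} (\<lambda>s. ?H (s + \<sigma> * \<theta>)) \<le> integral {A..B} ?H"
        unfolding shift[of \<beta> ?H]
        by (rule integral_subset_le[OF s integrable_subinterval_real[OF dn' s] dn']) simp
      with cauchy[of k] show ?thesis by simp
    qed simp
  qed
  have fI: "integrable (lebesgue_on {\<alpha>..\<beta>}) (f k)" for k using fa by (simp add: absolutely_integrable_on_iff_integrable)
  have "(\<integral>s. norm (f (Suc k) s - f k s) \<partial>lebesgue_on {\<alpha>..\<beta>}) \<le> (2 * (V b - V a)) * (1/2) ^ k" for k
  proof -
    have "(\<integral>s. norm (f (Suc k) s - f k s) \<partial>lebesgue_on {\<alpha>..\<beta>}) = integral {\<alpha>..\<beta>} (\<lambda>s. norm (f (Suc k) s - f k s))"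
      by (intro lebesgue_integral_eq_integral integrable_norm Bochner_Integration.integrable_diff fI) auto
    also note L1[of k]
    also have "2 * (1/2) ^ k * (V b - V a) = (2 * (V b - V a)) * (1/2) ^ k" by (simp only: mult_ac)
    finally show ?thesis .
  qed
  from L1_fast_Cauchy_limit[OF fI this] obtain G where G: "integrable (lebesgue_on {\<alpha>..\<beta>}) G"
    and limG: "(\<lambda>k. \<integral>x. norm (f k x - G x) \<partial>lebesgue_on {\<alpha>..\<beta>}) \<longlonglongrightarrow> 0" by blast
  have Ga: "G absolutely_integrable_on {\<alpha>..\<beta>}" using G by (simp add: absolutely_integrable_on_iff_integrable)
  have "(\<integral>x. norm (f k x - G x) \<partial>lebesgue_on {\<alpha>..\<beta>}) = integral {\<alpha>..\<beta>} (\<lambda>x. norm (f k x - G x))" for k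
    by (intro lebesgue_integral_eq_integral integrable_norm Bochner_Integration.integrable_diff fI G) auto
  with limG have lim: "(\<lambda>k. integral {\<alpha>..\<beta>} (\<lambda>s. norm (f k s - G s))) \<longlonglongrightarrow> 0" by simp
  show thesis
  proof (rule that[OF Ga lim[unfolded f_def]])
    fix t assume t: "t \<in> {\<alpha>..\<beta>}"
    \<comment> \<open>Integrals over \<open>s\<close> are continuous in \<open>\<theta>\<close>, being increments of an indefinite integral.\<close>
    let ?J = "\<lambda>H \<theta>. integral {\<alpha>..t} (\<lambda>s. H (s + \<sigma> * \<theta>))"
    have mc: "continuous_on {a..b} (?J H)"
      if H: "H absolutely_integrable_on {A..B}" for H :: "real \<Rightarrow> complex"
    proof -
      have Hi: "H integrable_on {A..B}" using H by (rule set_lebesgue_integral_eq_integral(1))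
      have Jc: "continuous_on {A..B} (\<lambda>x. integral {A..x} H)" by (rule indefinite_integral_continuous_1[OF Hi])
      have "continuous_on {a..b} (\<lambda>\<theta>. integral {A..t + \<sigma> * \<theta>} H - integral {A..\<alpha> + \<sigma> * \<theta>} H)"
        using range[of \<alpha>] range[of t] t
        by (intro continuous_on_diff continuous_on_compose2[OF Jc] continuous_intros) auto
      moreover have "?J H \<theta> = integral {A..t + \<sigma> * \<theta>} H - integral {A..\<alpha> + \<sigma> * \<theta>} H"
        if \<theta>: "\<theta> \<in> {a..b}" for \<theta>
      proof -
        have "\<alpha> + \<sigma> * \<theta> \<in> {A..B}" "t + \<sigma> * \<theta> \<in> {A..B}" using range t \<theta> by auto
        then have "integral {A..\<alpha> + \<sigma> * \<theta>} H + integral {\<alpha> + \<sigma> * \<theta>..t + \<sigma> * \<theta>} H = integral {A..t + \<sigma> * \<theta>} H"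
          using t by (intro HK_integral_combine integrable_subinterval_real[OF Hi]) auto
        then show ?thesis unfolding shift by (metis add_diff_cancel_left')
      qed
      ultimately show ?thesis by (subst continuous_on_cong[OF refl]) auto
    qed
    have "(\<lambda>k. integral {\<alpha>..t} (\<lambda>s. 1 * f k s)) \<longlonglongrightarrow> integral {\<alpha>..t} (\<lambda>s. 1 * G s)"
      by (rule tendsto_weighted_integral[OF fa Ga _ lim t]) simp
    then have l1: "(\<lambda>k. integral {\<alpha>..t} (f k)) \<longlonglongrightarrow> integral {\<alpha>..t} G" by simp
    have eq: "integral {\<alpha>..t} (f k) = RS_integral a b (?J (w' k)) g" for k
      unfolding f_def by (rule RS_integral_of_integral(1)[OF V ab kc, symmetric])
    have "(\<lambda>k. RS_integral a b (?J (w' k)) g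
        - RS_integral a b (?J w) g) \<longlonglongrightarrow> 0"
    proof (rule Lim_null_comparison)
      have "norm (RS_integral a b (?J (w' k)) g
        - RS_integral a b (?J w) g) \<le> (1/2) ^ k * (V b - V a)" for k
        unfolding RS_integral_diff[OF V ab mc[OF w'a] mc[OF w], symmetric]
      proof (rule RS_integral_bound[OF V ab continuous_on_diff[OF mc[OF w'a] mc[OF w]]])
        fix \<theta> assume \<theta>: "\<theta> \<in> {a..b}"
        note s = sub[OF t \<theta>]
        have "?J (w' k) \<theta> - ?J w \<theta>
            = integral {\<alpha> + \<sigma> * \<theta>..t + \<sigma> * \<theta>} (\<lambda>x. w' k x - w x)"
          unfolding shift
          by (intro integral_diff[symmetric] absolutely_integrable_integrable_subinterval[OF w'a s] absolutely_integrable_integrable_subinterval[OF w s])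
        also have "norm \<dots> \<le> integral {\<alpha> + \<sigma> * \<theta>..t + \<sigma> * \<theta>} (\<lambda>x. norm (w' k x - w x))"
          by (intro integral_norm_bound_integral integrable_diff absolutely_integrable_integrable_subinterval[OF w'a s]
              absolutely_integrable_integrable_subinterval[OF w s] integrable_subinterval_real[OF dn s]) auto
        also have "\<dots> \<le> integral {A..B} (\<lambda>x. norm (w' k x - w x))"
          by (rule integral_subset_le[OF s integrable_subinterval_real[OF dn s] dn]) simp
        also have "\<dots> \<le> (1/2) ^ k" by (rule fast)
        finally show "norm (?J (w' k) \<theta> - ?J w \<theta>) \<le> (1/2) ^ k" .
      qed
      then show "\<forall>\<^sub>F k in sequentially. norm (RS_integral a b (?J (w' k)) g
        - RS_integral a b (?J w) g) \<le> (1/2) ^ k * (V b - V a)" by simp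
      show "(\<lambda>k. (1/2) ^ k * (V b - V a)) \<longlonglongrightarrow> 0"
        by (rule tendsto_mult_left_zero) (simp add: LIMSEQ_power_zero)
    qed
    then have "(\<lambda>k. integral {\<alpha>..t} (f k)) \<longlonglongrightarrow> RS_integral a b (?J w) g"
      unfolding eq by (rule LIM_zero_cancel)
    then show "RS_integral a b (?J w) g = integral {\<alpha>..t} G"
      using l1 by (rule LIMSEQ_unique)
  qed
qed

section \<open>The derivative along translates\<close>

lemma bounded_bilinear_scalar_product:
  "bounded_bilinear (scalar_product :: complex ^ 'n \<Rightarrow> complex ^ 'n \<Rightarrow> complex)"
proof -
  have "bilinear (scalar_product :: complex ^ 'n \<Rightarrow> complex ^ 'n \<Rightarrow> complex)"
    unfolding bilinear_def scalar_product_def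
    by (intro conjI allI linearI) (simp_all add: sum.distrib distrib_left distrib_right scaleR_sum_right)
  then show ?thesis by (simp add: bilinear_conv_bounded_bilinear)
qed

lemma has_vector_derivative_of_indefinite_integral:
  assumes "((\<lambda>t. integral {a..t} g) has_vector_derivative D) (at x within {a..b})"
    and "\<And>t. t \<in> {a..b} \<Longrightarrow> f t = c + integral {a..t} g" and "x \<in> {a..b}"
  shows "(f has_vector_derivative D) (at x within {a..b})"
proof (rule has_vector_derivative_transform[OF assms(3)])
  show "((\<lambda>t. c + integral {a..t} g) has_vector_derivative D) (at x within {a..b})"
    using has_vector_derivative_add[OF has_vector_derivative_const[of c] assms(1)] by simp
qed (use assms(2) in simp)

theorem theorem5p12:
  fixes r p q \<alpha> \<beta> :: real
    and \<eta> :: "real \<Rightarrow> complex ^ 'n ^ 'n"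
    and Bt :: "(real \<Rightarrow> complex ^ 'n) \<Rightarrow> (real \<Rightarrow> complex ^ 'n) \<Rightarrow> complex"
    and u v :: "real \<Rightarrow> complex ^ 'n"
  assumes "r > 0"
    and "bounded_variation_on_interval (- r) 0 \<eta>"
    and "1 < p" and "1 / p + 1 / q = 1"
    and "is_bounded_bilinear_extension r \<eta> p q Bt"
    and "\<alpha> \<le> \<beta>"
    and "u \<in> Lp_fun p (lebesgue_on {\<alpha> - r..\<beta>})"
    and "v \<in> Lp_fun q (lebesgue_on {\<alpha>..\<beta> + r})"
    and "absolutely_continuous_on_interval \<alpha> \<beta> u"
    and "absolutely_continuous_on_interval \<alpha> \<beta> v"
  shows "absolutely_continuous_on_interval \<alpha> \<beta> (\<lambda>t. Bt (translate v t) (translate u t)) \<and>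
    (AE t in lebesgue_on {\<alpha>..\<beta>}. \<exists>dv du.
       ((\<lambda>t. v t + L_star r \<eta> (integral_translate \<alpha> t v)) has_vector_derivative dv)
         (at t within {\<alpha>..\<beta>}) \<and>
       ((\<lambda>t. u t - L_op r \<eta> (integral_translate \<alpha> t u)) has_vector_derivative du)
         (at t within {\<alpha>..\<beta>}) \<and>
       ((\<lambda>t. Bt (translate v t) (translate u t)) has_vector_derivative
           scalar_product dv (u t) + scalar_product (v t) du)
         (at t within {\<alpha>..\<beta>}))"
proof -
  note r = \<open>r > 0\<close> and ext = \<open>is_bounded_bilinear_extension r \<eta> p q Bt\<close> and \<alpha>\<beta> = \<open>\<alpha> \<le> \<beta>\<close>
    and uL = \<open>u \<in> Lp_fun p (lebesgue_on {\<alpha> - r..\<beta>})\<close> and vL = \<open>v \<in> Lp_fun q (lebesgue_on {\<alpha>..\<beta> + r})\<close>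
    and uac = \<open>absolutely_continuous_on_interval \<alpha> \<beta> u\<close> and vac = \<open>absolutely_continuous_on_interval \<alpha> \<beta> v\<close>
  have p: "1 \<le> p" using \<open>1 < p\<close> by simp
  have q: "1 \<le> q"
  proof -
    have "1 / p < 1" "0 < 1 / p" using \<open>1 < p\<close> by auto
    then have "0 < 1 / q" "1 / q < 1" using \<open>1 / p + 1 / q = 1\<close> by linarith+
    then have "q > 0" by (simp add: zero_less_divide_1_iff)
    with \<open>1 / q < 1\<close> show ?thesis by (simp add: divide_less_eq)
  qed
  have ab: "- r \<le> 0" and r0: "r \<ge> 0" using r by auto
  obtain V where V\<eta>: "\<And>x y. - r \<le> x \<Longrightarrow> x \<le> y \<Longrightarrow> y \<le> 0 \<Longrightarrow> norm (\<eta> y - \<eta> x) \<le> V y - V x"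
    using bounded_variation_majorant[OF \<open>bounded_variation_on_interval (- r) 0 \<eta>\<close>] by blast
  have V: "variation_majorant (- r) 0 V (\<lambda>\<theta>. \<eta> \<theta> $ i $ j)" for i j
    unfolding variation_majorant_def
  proof (intro allI impI)
    fix x y assume xy: "- r \<le> x \<and> x \<le> y \<and> y \<le> 0"
    have "norm (\<eta> y $ i $ j - \<eta> x $ i $ j) \<le> norm (\<eta> y $ i - \<eta> x $ i)"
      using Finite_Cartesian_Product.norm_nth_le[of "\<eta> y $ i - \<eta> x $ i" j] by simp
    also have "\<dots> \<le> norm (\<eta> y - \<eta> x)"
      using Finite_Cartesian_Product.norm_nth_le[of "\<eta> y - \<eta> x" i] by simp
    also have "\<dots> \<le> V y - V x" using xy by (intro V\<eta>) auto
    finally show "norm (\<eta> y $ i $ j - \<eta> x $ i $ j) \<le> V y - V x" .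
  qed
  have uc: "continuous_on {\<alpha>..\<beta>} u" and vc: "continuous_on {\<alpha>..\<beta>} v"
    using uac vac by (auto intro: absolutely_continuous_imp_continuous_on)
  have ucj: "continuous_on {\<alpha>..\<beta>} (\<lambda>s. u s $ j)" and vci: "continuous_on {\<alpha>..\<beta>} (\<lambda>s. v s $ j)" for j
    by (intro continuous_on_component uc vc)+
  have ui: "u absolutely_integrable_on {\<alpha> - r..\<beta>}" and uq: "(\<lambda>x. norm (u x) powr p) integrable_on {\<alpha> - r..\<beta>}"
    using uL unfolding Lp_fun_Icc_iff[OF p] by auto
  have vi: "v absolutely_integrable_on {\<alpha>..\<beta> + r}" and vq: "(\<lambda>x. norm (v x) powr q) integrable_on {\<alpha>..\<beta> + r}"
    using vL unfolding Lp_fun_Icc_iff[OF q] by auto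
  obtain v' where v': "\<And>k. continuous_on UNIV (v' k)" "\<And>k x. x \<in> {\<alpha>..\<beta>} \<Longrightarrow> v' k x = v x"
    "\<And>k. (\<lambda>x. norm (v' k x - v x) powr q) integrable_on {\<alpha>..\<beta> + r}"
    "\<And>k. integral {\<alpha>..\<beta> + r} (\<lambda>x. norm (v' k x - v x) powr q) \<le> (1/2) ^ k"
    "\<And>k i. integral {\<alpha>..\<beta> + r} (\<lambda>x. norm (v' k x $ i - v x $ i)) \<le> (1/2) ^ k"
  proof (rule approximating_sequence[of "{\<alpha>..\<beta>}" v q \<alpha> "\<beta> + r"])
    fix \<epsilon> :: real assume e: "\<epsilon> > 0"
    have "\<beta> \<le> \<beta> + r" using r by simp
    then show "\<exists>g. continuous_on UNIV g \<and> (\<forall>x\<in>{\<alpha>..\<beta>}. g x = v x) \<and>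
      (\<lambda>x. norm (g x - v x) + norm (g x - v x) powr q) integrable_on {\<alpha>..\<beta> + r} \<and>
      integral {\<alpha>..\<beta> + r} (\<lambda>x. norm (g x - v x) + norm (g x - v x) powr q) < \<epsilon>"
      by (rule continuous_approximation_fixing_interval[OF q \<alpha>\<beta> _ vc vi vq e]) blast
  qed (rule vi, rule that)
  obtain u' where u': "\<And>k. continuous_on UNIV (u' k)" "\<And>k x. x \<in> {\<alpha>..\<beta>} \<Longrightarrow> u' k x = u x"
    "\<And>k. (\<lambda>x. norm (u' k x - u x) powr p) integrable_on {\<alpha> - r..\<beta>}"
    "\<And>k. integral {\<alpha> - r..\<beta>} (\<lambda>x. norm (u' k x - u x) powr p) \<le> (1/2) ^ k"
    "\<And>k i. integral {\<alpha> - r..\<beta>} (\<lambda>x. norm (u' k x $ i - u x $ i)) \<le> (1/2) ^ k"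
  proof (rule approximating_sequence[of "{\<alpha>..\<beta>}" u p "\<alpha> - r" \<beta>])
    fix \<epsilon> :: real assume e: "\<epsilon> > 0"
    have "\<alpha> - r \<le> \<alpha>" using r by simp
    then show "\<exists>g. continuous_on UNIV g \<and> (\<forall>x\<in>{\<alpha>..\<beta>}. g x = u x) \<and>
      (\<lambda>x. norm (g x - u x) + norm (g x - u x) powr p) integrable_on {\<alpha> - r..\<beta>} \<and>
      integral {\<alpha> - r..\<beta>} (\<lambda>x. norm (g x - u x) + norm (g x - u x) powr p) < \<epsilon>"
      by (rule continuous_approximation_fixing_right_interval[OF p _ \<alpha>\<beta> uc ui uq e]) blast
  qed (rule ui, rule that)
  let ?e = "\<lambda>i j \<theta>. \<eta> \<theta> $ i $ j"
  let ?Rv = "\<lambda>k i j s. RS_integral (- r) 0 (\<lambda>\<theta>. v' k (s - \<theta>) $ i) (?e i j)"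
  let ?Ru = "\<lambda>k i j s. RS_integral (- r) 0 (\<lambda>\<theta>. u' k (s + \<theta>) $ j) (?e i j)"
  define F where "F = (\<lambda>t. Bt (translate v t) (translate u t))"
  have FB: "(\<lambda>k. B_form r \<eta> (translate (v' k) t) (translate (u' k) t)) \<longlonglongrightarrow> F t" if t: "t \<in> {\<alpha>..\<beta>}" for t
  proof -
    have tv: "\<alpha> \<le> t + 0" "t + r \<le> \<beta> + r" "(0::real) \<le> 0" and tu: "\<alpha> - r \<le> t + - r" "t + 0 \<le> \<beta>" "(0::real) \<le> 0"
      using t by auto
    have "(\<lambda>k. Bt (translate (v' k) t) (translate (u' k) t)) \<longlonglongrightarrow> F t"
      unfolding F_def
      by (rule bounded_bilinear_extension_tendsto[OF ext])
        (rule translate_approximation_tendsto[OF q vL v'(1) v'(2)[OF t] v'(3,4) tv r0]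
          translate_approximation_tendsto[OF p uL u'(1) u'(2)[OF t] u'(3,4) tu(1,2) ab tu(3)])+
    moreover have "Bt (translate (v' k) t) (translate (u' k) t) = B_form r \<eta> (translate (v' k) t) (translate (u' k) t)" for k
    proof -
      have "continuous_on {0..r} (translate (v' k) t)" "continuous_on {- r..0} (translate (u' k) t)"
        unfolding translate_def
        by (rule continuous_on_compose2[OF v'(1)] continuous_on_compose2[OF u'(1)]; auto intro!: continuous_intros)+
      with ext show ?thesis unfolding is_bounded_bilinear_extension_def by blast
    qed
    ultimately show ?thesis by simp
  qed
  \<comment> \<open>\<open>Gv i j\<close> is the density of the contribution of \<open>v\<^sub>i\<close> and \<open>\<eta>\<^sub>i\<^sub>j\<close> to \<open>L\<^sup>* \<integral> v\<^sup>s ds\<close>, and \<open>Gu i j\<close> below that of \<open>u\<^sub>j\<close> and \<open>\<eta>\<^sub>i\<^sub>j\<close> to \<open>L \<integral> u\<^sub>s ds\<close>.\<close>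
  define Pv where "Pv = (\<lambda>i j G. G absolutely_integrable_on {\<alpha>..\<beta>} \<and>
    (\<lambda>k. integral {\<alpha>..\<beta>} (\<lambda>s. norm (?Rv k i j s - G s))) \<longlonglongrightarrow> 0 \<and>
    (\<forall>t\<in>{\<alpha>..\<beta>}. RS_integral (- r) 0 (\<lambda>\<theta>. integral {\<alpha>..t} (\<lambda>s. v (s - \<theta>) $ i)) (?e i j) = integral {\<alpha>..t} G))"
  have "\<exists>G. Pv i j G" for i j
  proof (rule RS_integral_translate_L1_limit[OF V ab _ absolutely_integrable_vec_nth[OF vi], where w' = "\<lambda>k x. v' k x $ i" and \<sigma> = "- 1" and \<alpha> = \<alpha> and \<beta> = \<beta>])
    show "continuous_on UNIV (\<lambda>x. v' k x $ i)" for k by (intro continuous_on_component v'(1))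
    show "s + - 1 * \<theta> \<in> {\<alpha>..\<beta> + r}" if "s \<in> {\<alpha>..\<beta>}" "\<theta> \<in> {- r..0}" for s \<theta> using that by auto
    show "integral {\<alpha>..\<beta> + r} (\<lambda>x. norm (v' k x $ i - v x $ i)) \<le> (1/2) ^ k" for k by (rule v'(5))
    fix G assume G: "G absolutely_integrable_on {\<alpha>..\<beta>}"
      "(\<lambda>k. integral {\<alpha>..\<beta>} (\<lambda>s. norm (RS_integral (- r) 0 (\<lambda>\<theta>. v' k (s + - 1 * \<theta>) $ i) (?e i j) - G s))) \<longlonglongrightarrow> 0"
      "\<And>t. t \<in> {\<alpha>..\<beta>} \<Longrightarrow> RS_integral (- r) 0 (\<lambda>\<theta>. integral {\<alpha>..t} (\<lambda>s. v (s + - 1 * \<theta>) $ i)) (?e i j) = integral {\<alpha>..t} G"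
    have e: "s + - 1 * \<theta> = s - \<theta>" for s \<theta> :: real by simp
    show "\<exists>G. Pv i j G" unfolding Pv_def by (intro exI[of _ G] conjI ballI G[unfolded e])
  qed
  then obtain Gv where Pv: "\<And>i j. Pv i j (Gv i j)" by metis
  have Gv: "\<And>i j. Gv i j absolutely_integrable_on {\<alpha>..\<beta>}"
    and Gvl: "\<And>i j. (\<lambda>k. integral {\<alpha>..\<beta>} (\<lambda>s. norm (?Rv k i j s - Gv i j s))) \<longlonglongrightarrow> 0"
    and GvL: "\<And>i j t. t \<in> {\<alpha>..\<beta>} \<Longrightarrow> RS_integral (- r) 0 (\<lambda>\<theta>. integral {\<alpha>..t} (\<lambda>s. v (s - \<theta>) $ i)) (?e i j) = integral {\<alpha>..t} (Gv i j)"
    using Pv unfolding Pv_def by blast+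
  define Pu where "Pu = (\<lambda>i j G. G absolutely_integrable_on {\<alpha>..\<beta>} \<and>
    (\<lambda>k. integral {\<alpha>..\<beta>} (\<lambda>s. norm (?Ru k i j s - G s))) \<longlonglongrightarrow> 0 \<and>
    (\<forall>t\<in>{\<alpha>..\<beta>}. RS_integral (- r) 0 (\<lambda>\<theta>. integral {\<alpha>..t} (\<lambda>s. u (s + \<theta>) $ j)) (?e i j) = integral {\<alpha>..t} G))"
  have "\<exists>G. Pu i j G" for i j
  proof (rule RS_integral_translate_L1_limit[OF V ab _ absolutely_integrable_vec_nth[OF ui], where w' = "\<lambda>k x. u' k x $ j" and \<sigma> = "1" and \<alpha> = \<alpha> and \<beta> = \<beta>])
    show "continuous_on UNIV (\<lambda>x. u' k x $ j)" for k by (intro continuous_on_component u'(1))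
    show "s + 1 * \<theta> \<in> {\<alpha> - r..\<beta>}" if "s \<in> {\<alpha>..\<beta>}" "\<theta> \<in> {- r..0}" for s \<theta> using that by auto
    show "integral {\<alpha> - r..\<beta>} (\<lambda>x. norm (u' k x $ j - u x $ j)) \<le> (1/2) ^ k" for k by (rule u'(5))
    fix G assume G: "G absolutely_integrable_on {\<alpha>..\<beta>}"
      "(\<lambda>k. integral {\<alpha>..\<beta>} (\<lambda>s. norm (RS_integral (- r) 0 (\<lambda>\<theta>. u' k (s + 1 * \<theta>) $ j) (?e i j) - G s))) \<longlonglongrightarrow> 0"
      "\<And>t. t \<in> {\<alpha>..\<beta>} \<Longrightarrow> RS_integral (- r) 0 (\<lambda>\<theta>. integral {\<alpha>..t} (\<lambda>s. u (s + 1 * \<theta>) $ j)) (?e i j) = integral {\<alpha>..t} G"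
    have e: "s + 1 * \<theta> = s + \<theta>" for s \<theta> :: real by simp
    show "\<exists>G. Pu i j G" unfolding Pu_def by (intro exI[of _ G] conjI ballI G[unfolded e])
  qed
  then obtain Gu where Pu: "\<And>i j. Pu i j (Gu i j)" by metis
  have Gu: "\<And>i j. Gu i j absolutely_integrable_on {\<alpha>..\<beta>}"
    and Gul: "\<And>i j. (\<lambda>k. integral {\<alpha>..\<beta>} (\<lambda>s. norm (?Ru k i j s - Gu i j s))) \<longlonglongrightarrow> 0"
    and GuL: "\<And>i j t. t \<in> {\<alpha>..\<beta>} \<Longrightarrow> RS_integral (- r) 0 (\<lambda>\<theta>. integral {\<alpha>..t} (\<lambda>s. u (s + \<theta>) $ j)) (?e i j) = integral {\<alpha>..t} (Gu i j)"
    using Pu unfolding Pu_def by blast+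
  define gv where "gv = (\<lambda>s. \<chi> j. \<Sum>i\<in>UNIV. Gv i j s)"
  define gu where "gu = (\<lambda>s. \<chi> i. \<Sum>j\<in>UNIV. Gu i j s)"
  have gva: "gv absolutely_integrable_on {\<alpha>..\<beta>}" and gua: "gu absolutely_integrable_on {\<alpha>..\<beta>}"
    unfolding gv_def gu_def
    by (intro absolutely_integrable_vec_lambda absolutely_integrable_sum finite Gv Gu)+
  have subi: "f integrable_on {\<alpha>..t}" if "f absolutely_integrable_on {\<alpha>..\<beta>}" "t \<in> {\<alpha>..\<beta>}"
    for f :: "real \<Rightarrow> 'z::euclidean_space" and t
    by (rule absolutely_integrable_integrable_subinterval[OF that(1)]) (use that(2) in auto)
  have Lv: "L_star r \<eta> (integral_translate \<alpha> t v) = integral {\<alpha>..t} gv" if t: "t \<in> {\<alpha>..\<beta>}" for t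
  proof -
    have "L_star r \<eta> (integral_translate \<alpha> t v) $ j = integral {\<alpha>..t} gv $ j" for j
    proof -
      have "L_star r \<eta> (integral_translate \<alpha> t v) $ j =
          (\<Sum>i\<in>UNIV. RS_integral (- r) 0 (\<lambda>\<theta>. integral {\<alpha>..t} (\<lambda>s. v (s - \<theta>)) $ i) (?e i j))"
        by (simp add: L_star_def RS_integral_row_def integral_translate_def translate_def)
      also have "\<dots> = (\<Sum>i\<in>UNIV. RS_integral (- r) 0 (\<lambda>\<theta>. integral {\<alpha>..t} (\<lambda>s. v (s - \<theta>) $ i)) (?e i j))"
      proof (intro sum.cong refl RS_integral_cong integral_vec_nth)
        fix \<theta> assume \<theta>: "\<theta> \<in> {- r..0}"
        have "v integrable_on {\<alpha> - \<theta>..t - \<theta>}"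
          by (rule absolutely_integrable_integrable_subinterval[OF vi]) (use \<theta> t in auto)
        from integrable_shift_real_ivl[OF this, of "- \<theta>"] show "(\<lambda>s. v (s - \<theta>)) integrable_on {\<alpha>..t}" by simp
      qed
      also have "\<dots> = (\<Sum>i\<in>UNIV. integral {\<alpha>..t} (Gv i j))" by (simp only: GvL[OF t])
      also have "\<dots> = integral {\<alpha>..t} (\<lambda>s. \<Sum>i\<in>UNIV. Gv i j s)"
        by (rule integral_sum[symmetric]) (auto intro: subi[OF Gv t])
      also have "\<dots> = integral {\<alpha>..t} gv $ j"
        unfolding integral_vec_nth[OF subi[OF gva t]] by (simp add: gv_def)
      finally show ?thesis .
    qed
    then show ?thesis by (simp add: vec_eq_iff)
  qed
  have Lu: "L_op r \<eta> (integral_translate \<alpha> t u) = integral {\<alpha>..t} gu" if t: "t \<in> {\<alpha>..\<beta>}" for t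
  proof -
    have "L_op r \<eta> (integral_translate \<alpha> t u) $ i = integral {\<alpha>..t} gu $ i" for i
    proof -
      have "L_op r \<eta> (integral_translate \<alpha> t u) $ i =
          (\<Sum>j\<in>UNIV. RS_integral (- r) 0 (\<lambda>\<theta>. integral {\<alpha>..t} (\<lambda>s. u (s + \<theta>)) $ j) (?e i j))"
        by (simp add: L_op_def RS_integral_col_def integral_translate_def translate_def)
      also have "\<dots> = (\<Sum>j\<in>UNIV. RS_integral (- r) 0 (\<lambda>\<theta>. integral {\<alpha>..t} (\<lambda>s. u (s + \<theta>) $ j)) (?e i j))"
      proof (intro sum.cong refl RS_integral_cong integral_vec_nth)
        fix \<theta> assume \<theta>: "\<theta> \<in> {- r..0}"
        have "u integrable_on {\<alpha> + \<theta>..t + \<theta>}"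
          by (rule absolutely_integrable_integrable_subinterval[OF ui]) (use \<theta> t in auto)
        from integrable_shift_real_ivl[OF this, of \<theta>] show "(\<lambda>s. u (s + \<theta>)) integrable_on {\<alpha>..t}" by simp
      qed
      also have "\<dots> = (\<Sum>j\<in>UNIV. integral {\<alpha>..t} (Gu i j))" by (simp only: GuL[OF t])
      also have "\<dots> = integral {\<alpha>..t} (\<lambda>s. \<Sum>j\<in>UNIV. Gu i j s)"
        by (rule integral_sum[symmetric]) (auto intro: subi[OF Gu t])
      also have "\<dots> = integral {\<alpha>..t} gu $ i"
        unfolding integral_vec_nth[OF subi[OF gua t]] by (simp add: gu_def)
      finally show ?thesis .
    qed
    then show ?thesis by (simp add: vec_eq_iff)
  qed
  define h where "h = (\<lambda>s. scalar_product (gv s) (u s) - scalar_product (v s) (gu s))"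
  have h_eq: "h s = (\<Sum>j\<in>UNIV. \<Sum>i\<in>UNIV. u s $ j * Gv i j s - v s $ i * Gu i j s)" for s
  proof -
    have "scalar_product (gv s) (u s) = (\<Sum>j\<in>UNIV. \<Sum>i\<in>UNIV. u s $ j * Gv i j s)"
      by (simp add: scalar_product_def gv_def sum_distrib_left mult.commute)
    moreover have "scalar_product (v s) (gu s) = (\<Sum>j\<in>UNIV. \<Sum>i\<in>UNIV. v s $ i * Gu i j s)"
      by (subst sum.swap) (simp add: scalar_product_def gu_def sum_distrib_left)
    ultimately show ?thesis by (simp add: h_def sum_subtractf)
  qed
  have ha1: "(\<lambda>s. u s $ j * Gv i j s - v s $ i * Gu i j s) absolutely_integrable_on {\<alpha>..\<beta>}" for i j
    by (intro set_integral_diff continuous_mult_absolutely_integrable ucj vci Gv Gu)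
  have ha: "h absolutely_integrable_on {\<alpha>..\<beta>}"
    unfolding h_eq[abs_def] by (intro absolutely_integrable_sum ha1 finite)
  \<comment> \<open>The integrated form of the assertion, as the limit of \<open>B_form_translate_difference\<close>.\<close>
  have F_eq: "F t = (F \<alpha> - scalar_product (v \<alpha>) (u \<alpha>)) + scalar_product (v t) (u t) + integral {\<alpha>..t} h"
    if t: "t \<in> {\<alpha>..\<beta>}" for t
  proof -
    have \<alpha>: "\<alpha> \<in> {\<alpha>..\<beta>}" and "\<alpha> \<le> t" using t by auto
    define I where "I = (\<lambda>k i j. integral {\<alpha>..t} (\<lambda>s. u s $ j * ?Rv k i j s)
        - integral {\<alpha>..t} (\<lambda>s. v s $ i * ?Ru k i j s))"
    have Rv: "(?Rv k i j) absolutely_integrable_on {\<alpha>..\<beta>}" for k i j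
      by (intro absolutely_integrable_continuous_real continuous_on_RS_integral[OF V ab])
        (unfold case_prod_beta, intro continuous_on_component continuous_on_compose2[OF v'(1)] continuous_intros, simp)
    have Ru: "(?Ru k i j) absolutely_integrable_on {\<alpha>..\<beta>}" for k i j
      by (intro absolutely_integrable_continuous_real continuous_on_RS_integral[OF V ab])
        (unfold case_prod_beta, intro continuous_on_component continuous_on_compose2[OF u'(1)] continuous_intros, simp)
    have "B_form r \<eta> (translate (v' k) t) (translate (u' k) t) - B_form r \<eta> (translate (v' k) \<alpha>) (translate (u' k) \<alpha>) =
        scalar_product (v t) (u t) - scalar_product (v \<alpha>) (u \<alpha>) + (\<Sum>j\<in>UNIV. \<Sum>i\<in>UNIV. I k i j)" for k
    proof -
      have "integral {\<alpha>..t} (\<lambda>s. ?Rv k i j s * u' k s $ j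
          - v' k s $ i * ?Ru k i j s) = I k i j" for i j
      proof -
        have "integral {\<alpha>..t} (\<lambda>s. ?Rv k i j s * u' k s $ j
          - v' k s $ i * ?Ru k i j s) =
          integral {\<alpha>..t} (\<lambda>s. u s $ j * ?Rv k i j s
          - v s $ i * ?Ru k i j s)"
          using t by (intro integral_cong) (simp add: v'(2) u'(2) mult.commute)
        also have "\<dots> = I k i j" unfolding I_def
          by (intro integral_diff subi[OF _ t] continuous_mult_absolutely_integrable ucj vci Rv Ru)
        finally show ?thesis .
      qed
      then show ?thesis
        using B_form_translate_difference[OF V r0 v'(1) u'(1) \<open>\<alpha> \<le> t\<close>, of k k] 
        by (simp add: v'(2)[OF t] v'(2)[OF \<alpha>] u'(2)[OF t] u'(2)[OF \<alpha>])
    qed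
    moreover have "(\<lambda>k. I k i j) \<longlonglongrightarrow> integral {\<alpha>..t} (\<lambda>s. u s $ j * Gv i j s - v s $ i * Gu i j s)" for i j
    proof -
      have "integral {\<alpha>..t} (\<lambda>s. u s $ j * Gv i j s - v s $ i * Gu i j s) =
          integral {\<alpha>..t} (\<lambda>s. u s $ j * Gv i j s) - integral {\<alpha>..t} (\<lambda>s. v s $ i * Gu i j s)"
        by (intro integral_diff subi[OF _ t] continuous_mult_absolutely_integrable ucj vci Gv Gu)
      then show ?thesis unfolding I_def
        by (simp only:) (intro tendsto_diff tendsto_weighted_integral[OF Rv Gv ucj Gvl t] tendsto_weighted_integral[OF Ru Gu vci Gul t])
    qed
    then have "(\<lambda>k. scalar_product (v t) (u t) - scalar_product (v \<alpha>) (u \<alpha>) + (\<Sum>j\<in>UNIV. \<Sum>i\<in>UNIV. I k i j)) \<longlonglongrightarrow>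
        scalar_product (v t) (u t) - scalar_product (v \<alpha>) (u \<alpha>) + (\<Sum>j\<in>UNIV. \<Sum>i\<in>UNIV. integral {\<alpha>..t} (\<lambda>s. u s $ j * Gv i j s - v s $ i * Gu i j s))"
      by (intro tendsto_add tendsto_const tendsto_sum)
    ultimately have "F t - F \<alpha> = scalar_product (v t) (u t) - scalar_product (v \<alpha>) (u \<alpha>) + (\<Sum>j\<in>UNIV. \<Sum>i\<in>UNIV. integral {\<alpha>..t} (\<lambda>s. u s $ j * Gv i j s - v s $ i * Gu i j s))"
      using LIMSEQ_unique[OF tendsto_diff[OF FB[OF t] FB[OF \<alpha>]]] by simp
    also have "(\<Sum>j\<in>UNIV. \<Sum>i\<in>UNIV. integral {\<alpha>..t} (\<lambda>s. u s $ j * Gv i j s - v s $ i * Gu i j s)) = integral {\<alpha>..t} h"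
      unfolding h_eq[abs_def] using integrable_integral[OF subi[OF ha1 t]]
      by (intro integral_unique[symmetric] has_integral_sum finite)
    finally show ?thesis by (simp add: algebra_simps)
  qed
  interpret sp: bounded_bilinear "scalar_product :: complex ^ 'n \<Rightarrow> complex ^ 'n \<Rightarrow> complex"
    by (rule bounded_bilinear_scalar_product)
  have sp_ac: "absolutely_continuous_on_interval \<alpha> \<beta> (\<lambda>t. scalar_product (v t) (u t))"
    by (rule absolutely_continuous_bounded_bilinear[OF bounded_bilinear_scalar_product vac uac])
  have F_ac: "absolutely_continuous_on_interval \<alpha> \<beta> F"
  proof (rule absolutely_continuous_on_interval_dominated[OF sp_ac absolutely_continuous_indefinite_integral[OF ha], of 1])
    fix x y assume "\<alpha> \<le> x" "x \<le> y" "y \<le> \<beta>"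
    then have "x \<in> {\<alpha>..\<beta>}" "y \<in> {\<alpha>..\<beta>}" by auto
    then have "F y - F x = (scalar_product (v y) (u y) - scalar_product (v x) (u x)) + (integral {\<alpha>..y} h - integral {\<alpha>..x} h)"
      by (subst (1 2) F_eq) auto
    then show "norm (F y - F x) \<le> 1 * (norm (scalar_product (v y) (u y) - scalar_product (v x) (u x)) + norm (integral {\<alpha>..y} h - integral {\<alpha>..x} h))"
      by (simp only: mult_1 norm_triangle_ineq)
  qed simp
  \<comment> \<open>Almost everywhere, all five indefinite integrals have their integrands as derivatives.\<close>
  obtain u1 where u1: "u1 absolutely_integrable_on {\<alpha>..\<beta>}" "\<And>t. t \<in> {\<alpha>..\<beta>} \<Longrightarrow> u t = u \<alpha> + integral {\<alpha>..t} u1"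
    by (rule absolutely_continuous_imp_indefinite_integral[OF uac \<alpha>\<beta>]) blast
  obtain v1 where v1: "v1 absolutely_integrable_on {\<alpha>..\<beta>}" "\<And>t. t \<in> {\<alpha>..\<beta>} \<Longrightarrow> v t = v \<alpha> + integral {\<alpha>..t} v1"
    by (rule absolutely_continuous_imp_indefinite_integral[OF vac \<alpha>\<beta>]) blast
  have LD: "\<exists>N. negligible N \<and> (\<forall>x\<in>{\<alpha>..\<beta>} - N. ((\<lambda>t. integral {\<alpha>..t} f) has_vector_derivative f x) (at x within {\<alpha>..\<beta>}))"
    if "f absolutely_integrable_on {\<alpha>..\<beta>}" for f :: "real \<Rightarrow> 'z::euclidean_space"
    by (rule integral_has_vector_derivative_negligible[OF set_lebesgue_integral_eq_integral(1)[OF that]]) blast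
  obtain N1 where N1: "negligible N1" "\<forall>x\<in>{\<alpha>..\<beta>} - N1. ((\<lambda>t. integral {\<alpha>..t} u1) has_vector_derivative u1 x) (at x within {\<alpha>..\<beta>})"
    using LD[OF u1(1)] by blast
  obtain N2 where N2: "negligible N2" "\<forall>x\<in>{\<alpha>..\<beta>} - N2. ((\<lambda>t. integral {\<alpha>..t} v1) has_vector_derivative v1 x) (at x within {\<alpha>..\<beta>})"
    using LD[OF v1(1)] by blast
  obtain N3 where N3: "negligible N3" "\<forall>x\<in>{\<alpha>..\<beta>} - N3. ((\<lambda>t. integral {\<alpha>..t} gu) has_vector_derivative gu x) (at x within {\<alpha>..\<beta>})"
    using LD[OF gua] by blast
  obtain N4 where N4: "negligible N4" "\<forall>x\<in>{\<alpha>..\<beta>} - N4. ((\<lambda>t. integral {\<alpha>..t} gv) has_vector_derivative gv x) (at x within {\<alpha>..\<beta>})"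
    using LD[OF gva] by blast
  obtain N5 where N5: "negligible N5" "\<forall>x\<in>{\<alpha>..\<beta>} - N5. ((\<lambda>t. integral {\<alpha>..t} h) has_vector_derivative h x) (at x within {\<alpha>..\<beta>})"
    using LD[OF ha] by blast
  have neg: "negligible (N1 \<union> N2 \<union> N3 \<union> N4 \<union> N5)" by (intro negligible_Un N1(1) N2(1) N3(1) N4(1) N5(1))
  have "AE t in lebesgue_on {\<alpha>..\<beta>}. \<exists>dv du.
       ((\<lambda>t. v t + L_star r \<eta> (integral_translate \<alpha> t v)) has_vector_derivative dv) (at t within {\<alpha>..\<beta>}) \<and>
       ((\<lambda>t. u t - L_op r \<eta> (integral_translate \<alpha> t u)) has_vector_derivative du) (at t within {\<alpha>..\<beta>}) \<and>
       (F has_vector_derivative scalar_product dv (u t) + scalar_product (v t) du) (at t within {\<alpha>..\<beta>})"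
  proof (rule AE_lebesgue_on_Icc_I[OF neg])
    fix t assume t': "t \<in> {\<alpha>..\<beta>} - (N1 \<union> N2 \<union> N3 \<union> N4 \<union> N5)"
    then have t: "t \<in> {\<alpha>..\<beta>}" by blast
    have du: "(u has_vector_derivative u1 t) (at t within {\<alpha>..\<beta>})"
      by (rule has_vector_derivative_of_indefinite_integral[OF _ u1(2) t]) (use N1(2) t' in blast)+
    have dv: "(v has_vector_derivative v1 t) (at t within {\<alpha>..\<beta>})"
      by (rule has_vector_derivative_of_indefinite_integral[OF _ v1(2) t]) (use N2(2) t' in blast)+
    have dLu: "((\<lambda>t. L_op r \<eta> (integral_translate \<alpha> t u)) has_vector_derivative gu t) (at t within {\<alpha>..\<beta>})"
      by (rule has_vector_derivative_transform[OF t Lu]) (use N3(2) t' in blast)+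
    have dLv: "((\<lambda>t. L_star r \<eta> (integral_translate \<alpha> t v)) has_vector_derivative gv t) (at t within {\<alpha>..\<beta>})"
      by (rule has_vector_derivative_transform[OF t Lv]) (use N4(2) t' in blast)+
    have dh: "((\<lambda>t. integral {\<alpha>..t} h) has_vector_derivative h t) (at t within {\<alpha>..\<beta>})"
      using N5(2) t' by blast
    have "((\<lambda>t. (F \<alpha> - scalar_product (v \<alpha>) (u \<alpha>)) + scalar_product (v t) (u t) + integral {\<alpha>..t} h) has_vector_derivative
        0 + (scalar_product (v t) (u1 t) + scalar_product (v1 t) (u t)) + h t) (at t within {\<alpha>..\<beta>})"
      by (intro has_vector_derivative_add has_vector_derivative_const sp.has_vector_derivative du dv dh)
    then have "(F has_vector_derivative 0 + (scalar_product (v t) (u1 t) + scalar_product (v1 t) (u t)) + h t) (at t within {\<alpha>..\<beta>})"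
      by (rule has_vector_derivative_transform[OF t, rotated]) (rule F_eq)
    also have "0 + (scalar_product (v t) (u1 t) + scalar_product (v1 t) (u t)) + h t =
        scalar_product (v1 t + gv t) (u t) + scalar_product (v t) (u1 t - gu t)"
      by (simp add: h_def sp.add_left sp.diff_right)
    finally show "\<exists>dv du.
       ((\<lambda>t. v t + L_star r \<eta> (integral_translate \<alpha> t v)) has_vector_derivative dv) (at t within {\<alpha>..\<beta>}) \<and>
       ((\<lambda>t. u t - L_op r \<eta> (integral_translate \<alpha> t u)) has_vector_derivative du) (at t within {\<alpha>..\<beta>}) \<and>
       (F has_vector_derivative scalar_product dv (u t) + scalar_product (v t) du) (at t within {\<alpha>..\<beta>})"
      using has_vector_derivative_add[OF dv dLv] has_vector_derivative_diff[OF du dLu] by blast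
  qed
  with F_ac show ?thesis unfolding F_def by (rule conjI)
qed

end
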